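(* Let $\mathcal{E}$ be a unital qubit channel with Stokes matrix $R=B\,\mathrm{diag}[e_z,e_x,e_y]\,A$ ($A,B\in SO(3)$, $e_j$ real), and for $j\in\{z,x,y\}$ let $|\tilde A_j\rangle$ be the $j$-th column of $\mathrm{diag}[e_z,e_x,e_y]A$. Then $J_2(\mathcal{E})=\tilde J_2(\mathcal{E})$, where the maximum defining $\tilde J_2(\mathcal{E})$ is achieved by any pair of unitary channels $\mathcal{U}_A^*,\mathcal{U}_B^*$ such that $\mathcal{U}_B^*\circ\mathcal{E}\circ\mathcal{U}_A^*$ is a Pauli channel with Stokes matrix $\mathrm{diag}[e^*_z,e^*_x,e^*_y]$, $|e^*_z|\ge|e^*_x|\ge|e^*_y|$. Furthermore, $J_1(\mathcal{E})=\tilde J_1(\mathcal{E})$ if and only if $|\tilde A_z\rangle$ and $|\tilde A_x\rangle$ are orthogonal; if this holds, the maximum defining $\tilde J_1(\mathcal{E})$ is achieved by a rotation $O_B^*$ whose first and second rows are scalar multiples of $(R_{zz},R_{xz},R_{yz})$ and $(R_{zx},R_{xx},R_{yx})$ respectively.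
   Context: A qubit channel is described by its Stokes parameterization $(R,t)$: in Bloch coordinates $(\theta_z,\theta_x,\theta_y)$, $\theta_a=\mathrm{Tr}(\rho\sigma_a)$, it acts as $\theta\mapsto R\theta+t$ (indices ordered $z,x,y$); unital means $t=0$, Pauli means $t=0$ and $R$ diagonal. Unitary channels are identified with the rotations in $SO(3)$ they induce on Bloch vectors (every rotation arises), so $\mathcal{U}_B\circ\mathcal{E}\circ\mathcal{U}_A$ has Stokes matrix $O_BRO_A$. For a qubit channel $\mathcal{F}$ with complementary (environment) channel $\mathcal{F}_E$, and $|0_z\rangle,|1_z\rangle$ the $\pm1$ eigenvectors of $\sigma_z$: $H_{\mathcal{F}}(X|E)=H(\rho_{XE})-H(\rho_E)$ (von Neumann, base 2) for $\rho_{XE}=\sum_x\frac12|x_z\rangle\langle x_z|\otimes\mathcal{F}_E(|x_z\rangle\langle x_z|)$; $H_{\mathcal{F}}(X|Y)$ is the conditional Shannon entropy for $P_{XY}(x,y)=\frac12\langle y_z|\mathcal{F}(|x_z\rangle\langle x_z|)|y_z\rangle$; $K(\mathcal{F})=H_{\mathcal{F}}(X|E)-H_{\mathcal{F}}(X|Y)$. $\mathcal{P}_{ba}(\omega)$ ($\omega\in\mathbb{R}^6$) is the set of qubit channels with $(R_{zz},R_{zx},R_{xz},R_{xx},t_z,t_x)=\omega$; $\mathcal{P}_{bc}(\mu)$ ($\mu\in\mathbb{R}^2$) is the set of qubit channels with $(R_{zz},R_{xx})=\mu$ (other parameters arbitrary). With maxima over all unitary qubit channels and $\omega',\mu'$ the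 corresponding parameters of the compensated channel $\mathcal{E}'$: $J_1(\mathcal{E})=\max_{\mathcal{U}_B}\min_{\mathcal{P}_{ba}(\omega')}K$ and $\tilde J_1(\mathcal{E})=\max_{\mathcal{U}_B}\min_{\mathcal{P}_{bc}(\mu')}K$ with $\mathcal{E}'=\mathcal{U}_B\circ\mathcal{E}$; $J_2(\mathcal{E})=\max_{\mathcal{U}_A,\mathcal{U}_B}\min_{\mathcal{P}_{ba}(\omega')}K$ and $\tilde J_2(\mathcal{E})=\max_{\mathcal{U}_A,\mathcal{U}_B}\min_{\mathcal{P}_{bc}(\mu')}K$ with $\mathcal{E}'=\mathcal{U}_B\circ\mathcal{E}\circ\mathcal{U}_A$. *)

theory Defs
  imports Complex_Main "Jordan_Normal_Form.Char_Poly"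
begin

section \<open>Matrix helpers (complex 2x2 matrices; Bloch indices 0 = z, 1 = x, 2 = y)\<close>

definition mtrace :: "complex mat \<Rightarrow> complex" where
  "mtrace M = (\<Sum>i<dim_row M. M $$ (i,i))"

definition adj :: "complex mat \<Rightarrow> complex mat" where
  "adj M = mat (dim_col M) (dim_row M) (\<lambda>(i,j). cnj (M $$ (j,i)))"

definition pauli :: "nat \<Rightarrow> complex mat" where
  "pauli a = (if a = 0 then mat_of_rows_list 2 [[1,0],[0,-1]]
              else if a = 1 then mat_of_rows_list 2 [[0,1],[1,0]]
              else mat_of_rows_list 2 [[0,-\<i>],[\<i>,0]])"

definition ketbra :: "nat \<Rightarrow> complex mat" where
  "ketbra x = mat 2 2 (\<lambda>(i,j). if i = x \<and> j = x then 1 else 0)"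

text \<open>The linear map on 2x2 matrices with Stokes parameters (R,t): it sends
  (Tr M I + sum_a theta_a sigma_a)/2 to (Tr M I + sum_a (R theta + t Tr M)_a sigma_a)/2,
  theta_a = Tr (M sigma_a).\<close>
definition stokes_map :: "real mat \<Rightarrow> real vec \<Rightarrow> complex mat \<Rightarrow> complex mat" where
  "stokes_map R t M = mat 2 2 (\<lambda>(i,j). (1/2) *
      (mtrace M * (if i = j then 1 else 0) +
       (\<Sum>a<3. ((\<Sum>b<3. complex_of_real (R $$ (a,b)) * mtrace (M * pauli b))
                 + complex_of_real (t $ a) * mtrace M) * (pauli a $$ (i,j)))))"

definition kraus_rep :: "real mat \<Rightarrow> real vec \<Rightarrow> complex mat list \<Rightarrow> bool" where
  "kraus_rep R t Ks \<longleftrightarrow> set Ks \<subseteq> carrier_mat 2 2 \<and>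
     (\<forall>i<2. \<forall>j<2. (\<Sum>k<length Ks. (adj (Ks!k) * Ks!k) $$ (i,j)) = (if i = j then 1 else 0)) \<and>
     (\<forall>M \<in> carrier_mat 2 2. \<forall>i<2. \<forall>j<2.
        stokes_map R t M $$ (i,j) = (\<Sum>k<length Ks. (Ks!k * M * adj (Ks!k)) $$ (i,j)))"

definition qubit_channel :: "real mat \<Rightarrow> real vec \<Rightarrow> bool" where
  "qubit_channel R t \<longleftrightarrow> R \<in> carrier_mat 3 3 \<and> t \<in> carrier_vec 3 \<and> (\<exists>Ks. kraus_rep R t Ks)"

definition env_state :: "complex mat list \<Rightarrow> complex mat \<Rightarrow> complex mat" where
  "env_state Ks \<rho> = mat (length Ks) (length Ks) (\<lambda>(i,j). mtrace (Ks!i * \<rho> * adj (Ks!j)))"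

definition eta :: "real \<Rightarrow> real" where
  "eta p = - p * log 2 p"

definition vn_entropy :: "complex mat \<Rightarrow> real" where
  "vn_entropy A = (\<Sum>z \<in> {z. poly (char_poly A) z = 0}.
                      real (order z (char_poly A)) * eta (Re z))"

text \<open>H(X|E) = H(rho_XE) - H(rho_E), computed from a Kraus representation.\<close>
definition H_XE :: "complex mat list \<Rightarrow> real" where
  "H_XE Ks = (let m = length Ks; r0 = env_state Ks (ketbra 0); r1 = env_state Ks (ketbra 1) in
     vn_entropy (four_block_mat ((1/2) \<cdot>\<^sub>m r0) (0\<^sub>m m m) (0\<^sub>m m m) ((1/2) \<cdot>\<^sub>m r1))
     - vn_entropy ((1/2) \<cdot>\<^sub>m (r0 + r1)))"

definition P_XY :: "real mat \<Rightarrow> real vec \<Rightarrow> nat \<Rightarrow> nat \<Rightarrow> real" where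
  "P_XY R t x y = (1/2) * Re (stokes_map R t (ketbra x) $$ (y,y))"

definition H_XY :: "real mat \<Rightarrow> real vec \<Rightarrow> real" where
  "H_XY R t = (\<Sum>x<2. \<Sum>y<2. eta (P_XY R t x y)) - (\<Sum>y<2. eta (\<Sum>x<2. P_XY R t x y))"

definition Kkey :: "real mat \<Rightarrow> real vec \<Rightarrow> real" where
  "Kkey R t = H_XE (SOME Ks. kraus_rep R t Ks) - H_XY R t"

definition omega_ba :: "real mat \<Rightarrow> real vec \<Rightarrow> real list" where
  "omega_ba R t = [R $$ (0,0), R $$ (0,1), R $$ (1,0), R $$ (1,1), t $ 0, t $ 1]"

definition mu_bc :: "real mat \<Rightarrow> real list" where
  "mu_bc R = [R $$ (0,0), R $$ (1,1)]"

definition P_ba :: "real list \<Rightarrow> (real mat \<times> real vec) set" where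
  "P_ba \<omega> = {(R,t). qubit_channel R t \<and> omega_ba R t = \<omega>}"

definition P_bc :: "real list \<Rightarrow> (real mat \<times> real vec) set" where
  "P_bc \<mu> = {(R,t). qubit_channel R t \<and> mu_bc R = \<mu>}"

definition minK_ba :: "real mat \<Rightarrow> real vec \<Rightarrow> real" where
  "minK_ba R t = (INF F \<in> P_ba (omega_ba R t). Kkey (fst F) (snd F))"

definition minK_bc :: "real mat \<Rightarrow> real vec \<Rightarrow> real" where
  "minK_bc R t = (INF F \<in> P_bc (mu_bc R). Kkey (fst F) (snd F))"

definition SO3 :: "real mat set" where
  "SO3 = {Q. Q \<in> carrier_mat 3 3 \<and> Q * transpose_mat Q = 1\<^sub>m 3 \<and> det Q = 1}"

text \<open>Unitary channels = rotations; U_B o E o U_A has Stokes parameters (O_B R O_A, O_B t).\<close>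
definition J1 :: "real mat \<Rightarrow> real vec \<Rightarrow> real" where
  "J1 R t = (SUP OB \<in> SO3. minK_ba (OB * R) (OB *\<^sub>v t))"

definition J1t :: "real mat \<Rightarrow> real vec \<Rightarrow> real" where
  "J1t R t = (SUP OB \<in> SO3. minK_bc (OB * R) (OB *\<^sub>v t))"

definition J2 :: "real mat \<Rightarrow> real vec \<Rightarrow> real" where
  "J2 R t = (SUP W \<in> SO3 \<times> SO3. minK_ba (snd W * R * fst W) (snd W *\<^sub>v t))"

definition J2t :: "real mat \<Rightarrow> real vec \<Rightarrow> real" where
  "J2t R t = (SUP W \<in> SO3 \<times> SO3. minK_bc (snd W * R * fst W) (snd W *\<^sub>v t))"

definition diag3 :: "real \<Rightarrow> real \<Rightarrow> real \<Rightarrow> real mat" where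
  "diag3 a b c = mat 3 3 (\<lambda>(i,j). if i = j then [a,b,c] ! i else 0)"

end

theory Submission
  imports Defs "Jordan_Normal_Form.Schur_Decomposition"
begin

text \<open>
  Write \<open>h(x)\<close> for the binary entropy of \<open>(1 + x)/2\<close>. The environment states of a channel have the spectra
  of its output states and of its Choi state, hence
  \<open>K = H(\<rho>\<^sub>0/2) + H(\<rho>\<^sub>1/2) - H(Choi) - H(X|Y)\<close> with \<open>\<rho>\<^sub>x\<close> the output for the input \<open>|x\<rangle>\<close>.

  \<^bold>\<open>Lower bound.\<close> \<open>K \<ge> 1 - h(R\<^sub>z\<^sub>z) - h(w\<^sub>z R\<^sub>z\<^sub>x + w\<^sub>x R\<^sub>x\<^sub>x)\<close> for every unit vector \<open>(w\<^sub>z, w\<^sub>x)\<close>: the first three terms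
  are the relative entropy of the Choi state to its pinching in the input basis, which dominates the
  classical relative entropy of the outcomes of the observable \<open>\<sigma>\<^sub>x \<otimes> (w \<cdot> \<sigma>)\<close>.

  \<^bold>\<open>Upper bound.\<close> If \<open>a\<close>, \<open>b\<close> are the singular values of the first two columns of the Stokes matrix, then
  replacing the third column by the cross product of the first two gives a channel whose Choi state has
  the product spectrum \<open>(1 \<plusminus> a)(1 \<plusminus> b)/4\<close>, and so \<open>K \<le> 1 - h(a) - h(b)\<close>.

  Consequently the minimum over \<open>P_bc\<close> is \<open>1 - h(R\<^sub>z\<^sub>z) - h(R\<^sub>x\<^sub>x)\<close>, and the minimum over \<open>P_ba\<close> is at most the value
  of this expression after a suitable rotation of both sides, where for orthogonal columns no rotation
  of the input is needed. The maximum in \<open>J2t\<close> follows from Ky Fan's inequality and concavity of \<open>h\<close>.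
  If the columns \<open>r\<^sub>0\<close>, \<open>r\<^sub>1\<close> are not orthogonal, the lower bound with \<open>w\<close> along \<open>r\<^sub>1\<close> gives
  \<open>J1 \<ge> 1 - h(|r\<^sub>0|) - h(|r\<^sub>1|)\<close>, whereas orthonormal rows cannot be aligned with both columns, so that
  \<open>J1t\<close> is strictly smaller.
\<close>

section \<open>Binary entropy and the pinching inequality\<close>

text \<open>No operator logarithm appears in the lower bound. Once eigenvectors of the Choi state
  and of its pinching are fixed, only eigenvalues and overlaps remain, and monotonicity of relative
  entropy under a two-outcome observable becomes an inequality between real functions. The
  observable is off-diagonal with respect to the input, so its mean in the pinched state is 0 and
  the reference distribution is uniform; this is the origin of the 1 in \<open>1 - hbin b\<close>.

  The two bounds meet because the third singular value a b makes the outcomes of the two involutions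
  with means a and b independent, which gives the Choi state the largest entropy that these means
  allow. The lower bound holds for every shift t, so non-unital candidates in the minima need no
  separate treatment.

  Strictness for non-orthogonal columns has to survive a supremum over all rotations, so it rests on
  a gap that is uniform in the rotation.\<close>

lemma eta_tangent_strict:
  assumes "0 \<le> p" "0 < q" "p \<noteq> q"
  shows "eta p < - p * log 2 q + (q - p) / ln 2"
proof (cases "p = 0")
  case True
  then show ?thesis using assms by (simp add: eta_def)
next
  case False
  with assms have p: "0 < p" by simp
  have "ln (q / p) < q / p - 1"
    using ln_eq_minus_one[of "q / p"] ln_le_minus_one[of "q / p"] p assms
    by (fastforce simp: less_le)
  then have "p * (ln q - ln p) < p * (q / p - 1)"
    using p assms by (simp add: ln_div)
  then have "p * ln q - p * ln p < q - p"
    using p by (simp add: algebra_simps)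
  then have "(- p * ln p) / ln 2 < (- p * ln q + (q - p)) / ln 2"
    by (intro divide_strict_right_mono) auto
  then show ?thesis by (simp add: eta_def log_def add_divide_distrib diff_divide_distrib)
qed

text \<open>The right-hand side is the tangent of the concave function \<open>eta\<close> at
  \<open>q\<close>. The Jensen and Gibbs inequalities below are sums of such tangents.\<close>

lemma eta_tangent:
  assumes "0 \<le> p" "0 < q"
  shows "eta p \<le> - p * log 2 q + (q - p) / ln 2"
  using eta_tangent_strict[OF assms] by (cases "p = q") (auto simp: eta_def)

lemma eta_0 [simp]: "eta 0 = 0" and eta_1 [simp]: "eta 1 = 0"
  by (simp_all add: eta_def)

lemma eta_nonneg: "0 \<le> p \<Longrightarrow> p \<le> 1 \<Longrightarrow> 0 \<le> eta p"
  by (cases "p = 0") (auto simp: eta_def mult_nonneg_nonpos)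

lemma eta_half: "0 \<le> p \<Longrightarrow> eta (p / 2) = eta p / 2 + p / 2"
  by (cases "p = 0") (simp_all add: eta_def log_divide field_simps)

lemma eta_jensen:
  assumes I: "finite I" and d: "\<And>i. i \<in> I \<Longrightarrow> 0 \<le> d i" and sd: "sum d I = 1"
    and x: "\<And>i. i \<in> I \<Longrightarrow> 0 \<le> x i"
  shows "(\<Sum>i\<in>I. d i * eta (x i)) \<le> eta (\<Sum>i\<in>I. d i * x i)"
proof -
  define q where "q = (\<Sum>i\<in>I. d i * x i)"
  have q0: "0 \<le> q" unfolding q_def by (intro sum_nonneg mult_nonneg_nonneg d x)
  show ?thesis
  proof (cases "q = 0")
    case True
    then have "d i * x i = 0" if "i \<in> I" for i
      using sum_nonneg_eq_0_iff[OF I, of "\<lambda>i. d i * x i"] d x that by (simp add: q_def)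
    then have "d i * eta (x i) = 0" if "i \<in> I" for i using that by fastforce
    then have "(\<Sum>i\<in>I. d i * eta (x i)) = 0" by (intro sum.neutral) blast
    then show ?thesis using True unfolding q_def by simp
  next
    case False
    with q0 have q: "0 < q" by simp
    \<comment> \<open>The tangent is taken at the mean \<open>q\<close>, so the linear corrections
      cancel after weighting.\<close>
    have "(\<Sum>i\<in>I. d i * eta (x i)) \<le> (\<Sum>i\<in>I. d i * (- x i * log 2 q + (q - x i) / ln 2))"
      by (intro sum_mono mult_left_mono eta_tangent d x q)
    also have "\<dots> = (\<Sum>i\<in>I. (d i * x i) * (- log 2 q - 1 / ln 2) + d i * (q / ln 2))"
      by (intro sum.cong refl) (simp add: field_simps)
    also have "\<dots> = q * (- log 2 q - 1 / ln 2) + 1 * (q / ln 2)"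
      unfolding sum.distrib sum_distrib_right[symmetric] sd q_def ..
    also have "\<dots> = eta q" by (simp add: eta_def field_simps)
    finally show ?thesis unfolding q_def .
  qed
qed

section \<open>Binary entropy as a function of the bias\<close>

definition hbin :: "real \<Rightarrow> real" where
  "hbin x = eta ((1 + x) / 2) + eta ((1 - x) / 2)"

lemma hbin_minus [simp]: "hbin (- x) = hbin x"
  by (simp add: hbin_def)

lemma hbin_abs [simp]: "hbin \<bar>x\<bar> = hbin x"
  by (simp add: abs_if)

lemma hbin_0 [simp]: "hbin 0 = 1"
  by (simp add: hbin_def eta_def log_divide)

lemma hbin_nonneg: "\<bar>x\<bar> \<le> 1 \<Longrightarrow> 0 \<le> hbin x"
  unfolding hbin_def by (intro add_nonneg_nonneg eta_nonneg) auto

text \<open>Gibbs' inequality puts \<open>hbin x\<close> below the cross entropy relative to the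
  distribution of \<open>y\<close>. For \<open>0 \<le> y < x\<close> this cross entropy is at most
  \<open>hbin y\<close>, because weight moves to the likelier outcome.\<close>

lemma hbin_strict_antimono:
  assumes "\<bar>y\<bar> < \<bar>x\<bar>" "\<bar>x\<bar> \<le> 1"
  shows "hbin x < hbin y"
proof -
  have *: "hbin x < hbin y" if y0: "0 \<le> y" and yx: "y < x" and x1: "x \<le> 1" for x y
  proof -
    have "eta ((1 + x) / 2) < - ((1 + x) / 2) * log 2 ((1 + y) / 2) + ((1 + y) / 2 - (1 + x) / 2) / ln 2"
      using that by (intro eta_tangent_strict) auto
    moreover have "eta ((1 - x) / 2) < - ((1 - x) / 2) * log 2 ((1 - y) / 2) + ((1 - y) / 2 - (1 - x) / 2) / ln 2"
      using that by (intro eta_tangent_strict) auto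
    moreover have "((1 + y) / 2 - (1 + x) / 2) / ln 2 + ((1 - y) / 2 - (1 - x) / 2) / ln 2 = (0 :: real)"
      by (simp add: add_divide_distrib[symmetric]) (simp add: field_simps)
    ultimately have "hbin x < - ((1 + x) / 2) * log 2 ((1 + y) / 2) - ((1 - x) / 2) * log 2 ((1 - y) / 2)"
      unfolding hbin_def by linarith
    also have "\<dots> = hbin y + (x - y) / 2 * (log 2 ((1 - y) / 2) - log 2 ((1 + y) / 2))"
      unfolding hbin_def eta_def by (simp add: field_simps)
    also have "\<dots> \<le> hbin y"
    proof -
      have "log 2 ((1 - y) / 2) \<le> log 2 ((1 + y) / 2)" using that by simp
      then have "(x - y) / 2 * (log 2 ((1 - y) / 2) - log 2 ((1 + y) / 2)) \<le> 0"
        using that by (intro mult_nonneg_nonpos) auto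
      then show ?thesis by simp
    qed
    finally show ?thesis .
  qed
  show ?thesis using *[of "\<bar>y\<bar>" "\<bar>x\<bar>"] assms by simp
qed

lemma hbin_antimono: "\<bar>y\<bar> \<le> \<bar>x\<bar> \<Longrightarrow> \<bar>x\<bar> \<le> 1 \<Longrightarrow> hbin x \<le> hbin y"
  using hbin_strict_antimono[of y x] hbin_abs[of x] hbin_abs[of y]
  by (cases "\<bar>y\<bar> = \<bar>x\<bar>") (fastforce, auto simp: less_le)

lemma hbin_concave:
  assumes "0 \<le> l" "l \<le> 1" "\<bar>x\<bar> \<le> 1" "\<bar>y\<bar> \<le> 1"
  shows "l * hbin x + (1 - l) * hbin y \<le> hbin (l * x + (1 - l) * y)"
proof -
  have *: "l * eta p + (1 - l) * eta q \<le> eta (l * p + (1 - l) * q)" if "0 \<le> p" "0 \<le> q" for p q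
    using eta_jensen[of "{True, False}" "\<lambda>b. if b then l else 1 - l" "\<lambda>b. if b then p else q"]
      assms that by auto
  have "l * ((1 + x) / 2) + (1 - l) * ((1 + y) / 2) = (1 + (l * x + (1 - l) * y)) / 2"
    "l * ((1 - x) / 2) + (1 - l) * ((1 - y) / 2) = (1 - (l * x + (1 - l) * y)) / 2"
    by (simp_all add: field_simps)
  then have "l * eta ((1 + x) / 2) + (1 - l) * eta ((1 + y) / 2) \<le> eta ((1 + (l * x + (1 - l) * y)) / 2)"
    "l * eta ((1 - x) / 2) + (1 - l) * eta ((1 - y) / 2) \<le> eta ((1 - (l * x + (1 - l) * y)) / 2)"
    using *[of "(1 + x) / 2" "(1 + y) / 2"] *[of "(1 - x) / 2" "(1 - y) / 2"] assms by (simp_all only:) auto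
  then show ?thesis unfolding hbin_def distrib_left by linarith
qed

text \<open>If \<open>y\<close> exceeds \<open>e2\<close>, then \<open>y\<close> and
  \<open>e1 + e2 - y\<close> arise from \<open>e1\<close> and \<open>e2\<close> by mixing in
  opposite proportions, so concavity applies; passing from \<open>e1 + e2 - y\<close> down to
  \<open>x\<close> only raises the entropy.\<close>

lemma hbin_weak_majorization:
  assumes "0 \<le> x" "0 \<le> y" "x \<le> e1" "y \<le> e1" "x + y \<le> e1 + e2" "0 \<le> e2" "e2 \<le> e1" "e1 \<le> 1"
  shows "hbin e1 + hbin e2 \<le> hbin x + hbin y"
proof (cases "y \<le> e2")
  case True
  then show ?thesis
    using hbin_antimono[of x e1] hbin_antimono[of y e2] assms by auto
next
  case False
  \<comment> \<open>The weight with \<open>l * e1 + (1 - l) * e2 = y\<close>.\<close>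
  define l where "l = (y - e2) / (e1 - e2)"
  have ne: "e1 - e2 > 0" using False assms by auto
  have l: "0 \<le> l" "l \<le> 1" using False assms ne by (auto simp: l_def field_simps)
  have ly: "l * (e1 - e2) = y - e2" using ne by (simp add: l_def)
  have y: "l * e1 + (1 - l) * e2 = y" using ly by (simp add: algebra_simps)
  have y': "(1 - l) * e1 + (1 - (1 - l)) * e2 = e1 + e2 - y" using ly by (simp add: algebra_simps)
  have "hbin e1 + hbin e2 \<le> hbin y + hbin (e1 + e2 - y)"
    using hbin_concave[of l e1 e2] hbin_concave[of "1 - l" e1 e2] l assms
    unfolding y y' by (simp add: algebra_simps)
  also have "hbin (e1 + e2 - y) \<le> hbin x"
    using assms False by (intro hbin_antimono) auto
  finally show ?thesis by simp
qed

text \<open>The function interpolates between \<open>p ln q\<close> at \<open>0\<close> and \<open>p ln p - p + q\<close> at \<open>1\<close>; its derivative is the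
  \<open>\<chi>\<^sup>2\<close>-like quantity to which the Cauchy-Schwarz inequality applies.\<close>

lemma entropy_interpolation_deriv:
  assumes "0 < q" "0 \<le> p" "0 < s" "s < 1"
  shows "((\<lambda>s. p * ln ((1 - s) * q + s * p) - (p - q) * s) has_real_derivative
     (1 - s) * (p - q)\<^sup>2 / ((1 - s) * q + s * p)) (at s)"
proof -
  have w: "(1 - s) * q + s * p > 0" using assms by (intro add_pos_nonneg) auto
  have "p * (p - q) / ((1 - s) * q + s * p) - (p - q) = (1 - s) * (p - q)\<^sup>2 / ((1 - s) * q + s * p)"
    using w by (simp add: divide_simps) (simp add: algebra_simps power2_eq_square)
  moreover have "((\<lambda>s. p * ln ((1 - s) * q + s * p) - (p - q) * s) has_real_derivative
     p * ((p - q) / ((1 - s) * q + s * p)) - (p - q)) (at s)"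
    by (rule derivative_eq_intros refl | use w in \<open>simp add: algebra_simps\<close>)+
  ultimately show ?thesis by simp
qed

lemma entropy_interpolation_cont:
  fixes p q :: real
  assumes "0 < q" "0 \<le> p"
  shows "continuous_on {0..1} (\<lambda>s. p * ln ((1 - s) * q + s * p) - (p - q) * s)"
proof (cases "p = 0")
  case True
  then show ?thesis by (simp add: continuous_intros)
next
  case False
  have "(1 - s) * q + s * p \<noteq> 0" if "s \<in> {0..1}" for s
  proof (cases "s = 0")
    case True then show ?thesis using assms by auto
  next
    case s: False
    then have "(1 - s) * q + s * p > 0" using that assms False by (intro add_nonneg_pos) auto
    then show ?thesis by simp
  qed
  then show ?thesis by (intro continuous_intros) auto
qed

text \<open>Cauchy-Schwarz linearized by a free multiplier \<open>k\<close>: the square of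
  \<open>(p - q) u - k w m\<close>, divided by \<open>w\<close>, is nonnegative. In this form it can
  be summed term by term and optimized over \<open>k\<close> afterwards.\<close>

lemma complex_cauchy_weight:
  fixes u m :: complex and p q k w :: real
  assumes "w > 0"
  shows "2 * k * (p - q) * Re (cnj u * m) - k\<^sup>2 * w * (cmod m)\<^sup>2 \<le> (cmod u)\<^sup>2 * ((p - q)\<^sup>2 / w)"
proof -
  have "0 \<le> (cmod ((p - q) * u - k * w * m))\<^sup>2 / w" using assms by simp
  also have "(cmod ((p - q) * u - k * w * m))\<^sup>2
     = (p - q)\<^sup>2 * (cmod u)\<^sup>2 - 2 * k * w * (p - q) * Re (cnj u * m) + k\<^sup>2 * w\<^sup>2 * (cmod m)\<^sup>2"
    unfolding cmod_power2 by (simp add: power2_eq_square algebra_simps)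
  also have "\<dots> / w = (cmod u)\<^sup>2 * ((p - q)\<^sup>2 / w) - 2 * k * (p - q) * Re (cnj u * m) + k\<^sup>2 * w * (cmod m)\<^sup>2"
    using assms by (simp add: field_simps power2_eq_square)
  finally show ?thesis by simp
qed

text \<open>Here \<open>i\<close> runs over eigenvectors of a state, \<open>j\<close> over those of
  its pinching, \<open>u\<close> holds their overlaps and \<open>g\<close> the matrix elements of an
  observable with square 1. Hypothesis \<open>diag\<close> says that the observable has diagonal 0
  in the pinching basis, and \<open>b\<close> is its mean in the state. Along the segment from
  \<open>q\<close> to \<open>p\<close> the entropy gap grows at least as fast as the gap between the
  outcome distributions.\<close>

lemma pinched_entropy_bound:
  fixes p :: "'i \<Rightarrow> real" and q :: "'j \<Rightarrow> real" and u g :: "'i \<Rightarrow> 'j \<Rightarrow> complex" and b :: real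
  assumes I: "finite I" and J: "finite J"
    and p: "\<And>i. i \<in> I \<Longrightarrow> 0 \<le> p i" and sp: "sum p I = 1"
    and q: "\<And>j. j \<in> J \<Longrightarrow> q j = (\<Sum>i\<in>I. p i * (cmod (u i j))\<^sup>2)"
    and u1: "\<And>i. i \<in> I \<Longrightarrow> (\<Sum>j\<in>J. (cmod (u i j))\<^sup>2) = 1"
    and u2: "\<And>j. j \<in> J \<Longrightarrow> (\<Sum>i\<in>I. (cmod (u i j))\<^sup>2) = 1"
    and g1: "\<And>i. i \<in> I \<Longrightarrow> (\<Sum>j\<in>J. (cmod (g i j))\<^sup>2) = 1"
    and g2: "\<And>j. j \<in> J \<Longrightarrow> (\<Sum>i\<in>I. (cmod (g i j))\<^sup>2) = 1"
    and diag: "\<And>j. j \<in> J \<Longrightarrow> (\<Sum>i\<in>I. Re (cnj (u i j) * g i j)) = 0"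
    and b: "b = (\<Sum>i\<in>I. p i * (\<Sum>j\<in>J. Re (cnj (u i j) * g i j)))"
  shows "(\<Sum>i\<in>I. eta (p i)) \<le> (\<Sum>j\<in>J. eta (q j)) - (1 - hbin b)"
proof -
  have q0: "0 \<le> q j" if "j \<in> J" for j
    unfolding q[OF that] by (intro sum_nonneg mult_nonneg_nonneg p) auto
  have sq: "sum q J = 1"
  proof -
    have "sum q J = (\<Sum>j\<in>J. \<Sum>i\<in>I. p i * (cmod (u i j))\<^sup>2)" by (intro sum.cong refl q)
    also have "\<dots> = (\<Sum>i\<in>I. p i * (\<Sum>j\<in>J. (cmod (u i j))\<^sup>2))"
      by (subst sum.swap) (simp add: sum_distrib_left)
    also have "\<dots> = 1" using sp u1 by simp
    finally show ?thesis .
  qed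
  have b1: "\<bar>b\<bar> \<le> 1"
  proof -
    have ag: "\<bar>Re (cnj (u i j) * g i j)\<bar> \<le> ((cmod (u i j))\<^sup>2 + (cmod (g i j))\<^sup>2) / 2" for i j
    proof -
      have "\<bar>Re (cnj (u i j) * g i j)\<bar> \<le> cmod (u i j) * cmod (g i j)"
        using abs_Re_le_cmod[of "cnj (u i j) * g i j"] by (simp add: norm_mult)
      then show ?thesis using sum_squares_bound[of "cmod (u i j)" "cmod (g i j)"] by simp
    qed
    have "\<bar>\<Sum>j\<in>J. Re (cnj (u i j) * g i j)\<bar> \<le> 1" if "i \<in> I" for i
    proof -
      have "\<bar>\<Sum>j\<in>J. Re (cnj (u i j) * g i j)\<bar> \<le> (\<Sum>j\<in>J. ((cmod (u i j))\<^sup>2 + (cmod (g i j))\<^sup>2) / 2)"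
        by (rule order_trans[OF sum_abs], rule sum_mono) (rule ag)
      also have "\<dots> = 1" unfolding sum_divide_distrib[symmetric] sum.distrib u1[OF that] g1[OF that] by simp
      finally show ?thesis .
    qed
    then have "\<bar>p i * (\<Sum>j\<in>J. Re (cnj (u i j) * g i j))\<bar> \<le> p i" if "i \<in> I" for i
      using that p[OF that] by (simp add: abs_mult mult_left_le)
    then have "\<bar>b\<bar> \<le> sum p I" unfolding b by (intro order_trans[OF sum_abs] sum_mono)
    then show ?thesis using sp by simp
  qed
  define T where "T i j s = p i * ln ((1 - s) * q j + s * p i) - (p i - q j) * s" for i j s
  \<comment> \<open>Up to the constant \<open>ln 2\<close>, this is the same interpolation as
    \<open>T\<close>, summed over two outcomes of probabilities \<open>(1 + b) / 2\<close> and
    \<open>(1 - b) / 2\<close> against the uniform distribution.\<close>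
  define L where "L s = (((1 + b) * ln (1 + s * b)) + ((1 - b) * ln (1 - s * b))) / 2" for s
  define Phi where "Phi s = (\<Sum>i\<in>I. \<Sum>j\<in>J. (cmod (u i j))\<^sup>2 * T i j s) - L s" for s
  define T' where "T' i j s = (1 - s) * (p i - q j)\<^sup>2 / ((1 - s) * q j + s * p i)" for i j s
  \<comment> \<open>A vanishing \<open>q j\<close> forces \<open>p i = 0\<close> wherever the
    overlap is nonzero. So every term that would contain a singular logarithm is identically
    0.\<close>
  have zero: "p i = 0" if "i \<in> I" "j \<in> J" "q j = 0" "u i j \<noteq> 0" for i j
  proof -
    have "p i * (cmod (u i j))\<^sup>2 = 0"
      using sum_nonneg_eq_0_iff[OF I, of "\<lambda>i. p i * (cmod (u i j))\<^sup>2"] p q[OF that(2)] that by fastforce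
    then show ?thesis using that by simp
  qed
  have Tcont: "continuous_on {0..1} (\<lambda>s. (cmod (u i j))\<^sup>2 * T i j s)" if ij: "i \<in> I" "j \<in> J" for i j
  proof (cases "q j = 0 \<or> u i j = 0")
    case True
    then have "(\<lambda>s. (cmod (u i j))\<^sup>2 * T i j s) = (\<lambda>s. 0)" using zero[OF ij] by (auto simp: T_def fun_eq_iff)
    then show ?thesis by (rule ssubst) (rule continuous_on_const)
  next
    case False
    then show ?thesis unfolding T_def using p q0 ij
      by (intro continuous_on_mult_left entropy_interpolation_cont) (auto simp: less_le)
  qed
  have Tderiv: "((\<lambda>s. (cmod (u i j))\<^sup>2 * T i j s) has_real_derivative (cmod (u i j))\<^sup>2 * T' i j s) (at s)"
    if ij: "i \<in> I" "j \<in> J" and s: "0 < s" "s < 1" for i j s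
  proof (cases "q j = 0 \<or> u i j = 0")
    case True
    then have "(\<lambda>s. (cmod (u i j))\<^sup>2 * T i j s) = (\<lambda>s. 0)" "(cmod (u i j))\<^sup>2 * T' i j s = 0"
      using zero[OF ij] by (auto simp: T_def T'_def fun_eq_iff)
    then show ?thesis by (simp only: DERIV_const)
  next
    case False
    then show ?thesis unfolding T_def T'_def using p q0 ij s
      by (intro DERIV_cmult entropy_interpolation_deriv) (auto simp: less_le)
  qed
  have pos1: "1 + s * b > 0" "1 - s * b > 0" if "0 \<le> s" "s < 1" for s
  proof -
    have "\<bar>s * b\<bar> < 1" using that b1 by (cases "s = 0") (auto simp: abs_mult intro: le_less_trans[OF mult_left_le])
    then show "1 + s * b > 0" "1 - s * b > 0" by auto
  qed
  \<comment> \<open>At \<open>s = 1\<close> and \<open>c = -1\<close> the logarithm degenerates, but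
    its coefficient vanishes.\<close>
  have lncont: "continuous_on {0..1} (\<lambda>s. (1 + c) * ln (1 + s * c))" if "\<bar>c\<bar> \<le> 1" for c :: real
  proof (cases "c = -1")
    case True then show ?thesis by simp
  next
    case False
    have "1 + s * c \<noteq> 0" if s: "s \<in> {0..1}" for s
    proof -
      have "s * c \<ge> - 1 \<and> (s * c = -1 \<longrightarrow> c = -1)"
      proof (cases "c \<ge> 0")
        case True
        then have "0 \<le> s * c" using s by simp
        then show ?thesis by linarith
      next
        case False
        then have "s * c \<ge> 1 * c" using s by (intro mult_right_mono_neg) auto
        then show ?thesis using \<open>\<bar>c\<bar> \<le> 1\<close> by auto
      qed
      then show ?thesis using False by auto
    qed
    then show ?thesis by (intro continuous_intros) auto
  qed
  have Lcont: "continuous_on {0..1} L"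
    unfolding L_def using lncont[of b] lncont[of "-b"] b1
    by (intro continuous_on_divide continuous_on_add continuous_on_const) auto
  have Lderiv: "(L has_real_derivative (1 - s) * (b\<^sup>2 / (1 - s\<^sup>2 * b\<^sup>2))) (at s)" if "0 < s" "s < 1" for s
  proof -
    have P: "1 + s * b > 0" "1 - s * b > 0" using pos1 that by auto
    have "(1 + s * b) * (1 - s * b) = 1 - s\<^sup>2 * b\<^sup>2" by (simp add: algebra_simps power2_eq_square)
    then have "((1 + b) * (b / (1 + s * b)) + (1 - b) * (- b / (1 - s * b))) / 2 = (1 - s) * (b\<^sup>2 / (1 - s\<^sup>2 * b\<^sup>2))"
      using P by (simp add: divide_simps flip: \<open>(1 + s * b) * (1 - s * b) = 1 - s\<^sup>2 * b\<^sup>2\<close>)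
        (simp add: algebra_simps power2_eq_square)
    moreover have "(L has_real_derivative ((1 + b) * (b / (1 + s * b)) + (1 - b) * (- b / (1 - s * b))) / 2) (at s)"
    proof -
      have d: "((\<lambda>s. ln (1 + s * c)) has_real_derivative c / (1 + s * c)) (at s)" if "1 + s * c > 0" for c
        using that by (auto intro!: derivative_eq_intros)
      have "L = (\<lambda>s. ((1 + b) * ln (1 + s * b) + (1 - b) * ln (1 + s * (- b))) / 2)"
        by (simp add: L_def fun_eq_iff)
      moreover have "((\<lambda>s. ((1 + b) * ln (1 + s * b) + (1 - b) * ln (1 + s * (- b))) / 2) has_real_derivative
         ((1 + b) * (b / (1 + s * b)) + (1 - b) * (- b / (1 + s * (- b)))) / 2) (at s)"
        using P by (intro DERIV_cdivide DERIV_add DERIV_cmult d) auto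
      ultimately show ?thesis by simp
    qed
    ultimately show ?thesis by (simp only:)
  qed
  have key: "b\<^sup>2 / (1 - s\<^sup>2 * b\<^sup>2) \<le> (\<Sum>i\<in>I. \<Sum>j\<in>J. (cmod (u i j))\<^sup>2 * ((p i - q j)\<^sup>2 / ((1 - s) * q j + s * p i)))"
    if s: "0 < s" "s < 1" for s
  proof -
    define c where "c = 1 - s\<^sup>2 * b\<^sup>2"
    have c: "c > 0" unfolding c_def using mult_pos_pos[of "1 + s * b" "1 - s * b"] pos1[of s] s
      by (simp add: algebra_simps power2_eq_square)
    \<comment> \<open>The optimal multiplier. The array \<open>m\<close> comes from the observable
      minus its mean \<open>s * b\<close> in the interpolated state, and \<open>c\<close> is the
      corresponding variance, since the observable squares to 1.\<close>
    define k where "k = b / c"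
    define m where "m i j = g i j - s * b * u i j" for i j
    define w where "w i j = (1 - s) * q j + s * p i" for i j
    have Rm: "Re (cnj (u i j) * m i j) = Re (cnj (u i j) * g i j) - s * b * (cmod (u i j))\<^sup>2" for i j
      unfolding m_def cmod_power2 by (simp add: algebra_simps power2_eq_square)
    have Nm: "(cmod (m i j))\<^sup>2 = (cmod (g i j))\<^sup>2 - 2 * s * b * Re (cnj (u i j) * g i j) + s\<^sup>2 * b\<^sup>2 * (cmod (u i j))\<^sup>2" for i j
      unfolding m_def cmod_power2 by (simp add: algebra_simps power2_eq_square)
    have P1: "(\<Sum>i\<in>I. \<Sum>j\<in>J. p i * f i j) = (\<Sum>i\<in>I. p i * (\<Sum>j\<in>J. f i j))" for f :: "'i \<Rightarrow> 'j \<Rightarrow> real"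
      by (simp add: sum_distrib_left)
    have Q1: "(\<Sum>i\<in>I. \<Sum>j\<in>J. q j * f i j) = (\<Sum>j\<in>J. q j * (\<Sum>i\<in>I. f i j))" for f :: "'i \<Rightarrow> 'j \<Rightarrow> real"
      by (subst sum.swap) (simp add: sum_distrib_left)
    have pu: "(\<Sum>i\<in>I. \<Sum>j\<in>J. p i * (cmod (u i j))\<^sup>2) = 1" and pg: "(\<Sum>i\<in>I. \<Sum>j\<in>J. p i * (cmod (g i j))\<^sup>2) = 1"
      unfolding P1 using u1 g1 sp by simp_all
    have qu: "(\<Sum>i\<in>I. \<Sum>j\<in>J. q j * (cmod (u i j))\<^sup>2) = 1" and qg: "(\<Sum>i\<in>I. \<Sum>j\<in>J. q j * (cmod (g i j))\<^sup>2) = 1"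
      unfolding Q1 using u2 g2 sq by simp_all
    have px: "(\<Sum>i\<in>I. \<Sum>j\<in>J. p i * Re (cnj (u i j) * g i j)) = b" unfolding P1 b ..
    have qx: "(\<Sum>i\<in>I. \<Sum>j\<in>J. q j * Re (cnj (u i j) * g i j)) = 0" unfolding Q1 using diag by simp
    have A: "(\<Sum>i\<in>I. \<Sum>j\<in>J. (p i - q j) * Re (cnj (u i j) * m i j)) = b"
    proof -
      have "(\<Sum>i\<in>I. \<Sum>j\<in>J. (p i - q j) * Re (cnj (u i j) * m i j))
        = (\<Sum>i\<in>I. \<Sum>j\<in>J. p i * Re (cnj (u i j) * g i j) - q j * Re (cnj (u i j) * g i j)
           - s * b * (p i * (cmod (u i j))\<^sup>2) + s * b * (q j * (cmod (u i j))\<^sup>2))"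
        unfolding Rm by (intro sum.cong refl) (simp only: algebra_simps)
      also have "\<dots> = b"
        unfolding sum.distrib sum_subtractf px qx unfolding sum_distrib_left[symmetric] pu[unfolded P1] qu by simp
      finally show ?thesis .
    qed
    have B: "(\<Sum>i\<in>I. \<Sum>j\<in>J. w i j * (cmod (m i j))\<^sup>2) = c"
    proof -
      have "(\<Sum>i\<in>I. \<Sum>j\<in>J. w i j * (cmod (m i j))\<^sup>2)
        = (\<Sum>i\<in>I. \<Sum>j\<in>J. (1 - s) * (q j * (cmod (g i j))\<^sup>2) + s * (p i * (cmod (g i j))\<^sup>2)
            - (2 * s * b * (1 - s)) * (q j * Re (cnj (u i j) * g i j)) - (2 * s * b * s) * (p i * Re (cnj (u i j) * g i j))
           + (s\<^sup>2 * b\<^sup>2 * (1 - s)) * (q j * (cmod (u i j))\<^sup>2) + (s\<^sup>2 * b\<^sup>2 * s) * (p i * (cmod (u i j))\<^sup>2))"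
        unfolding Nm w_def by (intro sum.cong refl) (simp only: algebra_simps)
      also have "\<dots> = c"
        unfolding sum.distrib sum_subtractf unfolding sum_distrib_left[symmetric] pu[unfolded P1] qu pg[unfolded P1] qg px[unfolded P1] qx c_def
        by (simp add: algebra_simps power2_eq_square)
      finally show ?thesis .
    qed
    have "b\<^sup>2 / c = 2 * k * b - k\<^sup>2 * c"
      using c by (simp add: k_def field_simps power2_eq_square)
    also have "\<dots> = (\<Sum>i\<in>I. \<Sum>j\<in>J. 2 * k * ((p i - q j) * Re (cnj (u i j) * m i j)) - k\<^sup>2 * (w i j * (cmod (m i j))\<^sup>2))"
      unfolding sum_subtractf sum_distrib_left[symmetric] A B ..
    also have "\<dots> \<le> (\<Sum>i\<in>I. \<Sum>j\<in>J. (cmod (u i j))\<^sup>2 * ((p i - q j)\<^sup>2 / w i j))"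
    proof (intro sum_mono)
      fix i j assume ij: "i \<in> I" "j \<in> J"
      have n: "0 \<le> (1 - s) * q j" "0 \<le> s * p i" using s p q0 ij by auto
      show "2 * k * ((p i - q j) * Re (cnj (u i j) * m i j)) - k\<^sup>2 * (w i j * (cmod (m i j))\<^sup>2)
        \<le> (cmod (u i j))\<^sup>2 * ((p i - q j)\<^sup>2 / w i j)"
      proof (cases "w i j = 0")
        case True
        then have "(1 - s) * q j = 0" "s * p i = 0" using n unfolding w_def by linarith+
        then show ?thesis using s by (simp add: w_def)
      next
        case False
        then have "w i j > 0" using n unfolding w_def by linarith
        from complex_cauchy_weight[OF this] show ?thesis by (simp only: mult.assoc)
      qed
    qed
    finally show ?thesis unfolding c_def w_def .
  qed
  have "Phi 0 \<le> Phi 1"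
  \<comment> \<open>The open interval is essential: a denominator of \<open>T'\<close> may vanish at
    an endpoint, where only continuity is available.\<close>
  proof (rule DERIV_nonneg_imp_increasing_open[where f = Phi and a = 0 and b = 1])
    show "continuous_on {0..1} Phi" unfolding Phi_def
      by (intro continuous_intros Tcont Lcont)
    fix s :: real assume s: "0 < s" "s < 1"
    have "(Phi has_real_derivative (\<Sum>i\<in>I. \<Sum>j\<in>J. (cmod (u i j))\<^sup>2 * T' i j s) - (1 - s) * (b\<^sup>2 / (1 - s\<^sup>2 * b\<^sup>2))) (at s)"
      unfolding Phi_def by (intro DERIV_diff DERIV_sum Tderiv Lderiv s)
    moreover have "(\<Sum>i\<in>I. \<Sum>j\<in>J. (cmod (u i j))\<^sup>2 * T' i j s)
       = (1 - s) * (\<Sum>i\<in>I. \<Sum>j\<in>J. (cmod (u i j))\<^sup>2 * ((p i - q j)\<^sup>2 / ((1 - s) * q j + s * p i)))"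
      unfolding T'_def sum_distrib_left by (intro sum.cong refl) simp
    then have "(\<Sum>i\<in>I. \<Sum>j\<in>J. (cmod (u i j))\<^sup>2 * T' i j s) - (1 - s) * (b\<^sup>2 / (1 - s\<^sup>2 * b\<^sup>2)) \<ge> 0"
      using mult_left_mono[OF key[OF s], of "1 - s"] s by simp
    ultimately show "\<exists>y. (Phi has_real_derivative y) (at s) \<and> 0 \<le> y" by blast
  qed simp
  moreover have "Phi 0 = (\<Sum>j\<in>J. q j * ln (q j))"
  proof -
    have "Phi 0 = (\<Sum>i\<in>I. \<Sum>j\<in>J. (cmod (u i j))\<^sup>2 * (p i * ln (q j)))" by (simp add: Phi_def T_def L_def)
    also have "\<dots> = (\<Sum>j\<in>J. (\<Sum>i\<in>I. p i * (cmod (u i j))\<^sup>2) * ln (q j))"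
      by (subst sum.swap) (simp add: sum_distrib_left sum_distrib_right mult_ac)
    finally show ?thesis using q by simp
  qed
  moreover have "Phi 1 = (\<Sum>i\<in>I. p i * ln (p i)) - L 1"
  proof -
    have "(\<Sum>i\<in>I. \<Sum>j\<in>J. (cmod (u i j))\<^sup>2 * T i j 1)
       = (\<Sum>i\<in>I. \<Sum>j\<in>J. (cmod (u i j))\<^sup>2 * (p i * ln (p i) - p i)) + (\<Sum>j\<in>J. \<Sum>i\<in>I. (cmod (u i j))\<^sup>2 * q j)"
      by (subst (2) sum.swap, simp only: sum.distrib[symmetric])
         (intro sum.cong refl, simp add: T_def algebra_simps)
    also have "\<dots> = (\<Sum>i\<in>I. p i * ln (p i) - p i) + sum q J"
      unfolding sum_distrib_right[symmetric] using u1 u2 by simp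
    finally show ?thesis unfolding Phi_def by (simp add: sum_subtractf sp sq)
  qed
  moreover have "L 1 = ln 2 * (1 - hbin b)"
  proof -
    have *: "(1 + c) * ln ((1 + c) / 2) = (1 + c) * ln (1 + c) - (1 + c) * ln 2" if "\<bar>c\<bar> \<le> 1" for c :: real
      using that by (cases "c = -1") (simp_all add: ln_div algebra_simps)
    have "ln 2 * hbin b = - ((1 + b) * ln ((1 + b) / 2) + (1 + (-b)) * ln ((1 + (-b)) / 2)) / 2"
      unfolding hbin_def eta_def log_def by (simp add: field_simps)
    also have "\<dots> = ln 2 - L 1"
      using b1 by (subst (1 2) *) (auto simp: L_def field_simps)
    finally show ?thesis by (simp add: algebra_simps)
  qed
  ultimately have "(\<Sum>j\<in>J. q j * ln (q j)) \<le> (\<Sum>i\<in>I. p i * ln (p i)) - ln 2 * (1 - hbin b)"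
    by simp
  then have "(\<Sum>j\<in>J. q j * ln (q j)) / ln 2 \<le> ((\<Sum>i\<in>I. p i * ln (p i)) - ln 2 * (1 - hbin b)) / ln 2"
    by (intro divide_right_mono) auto
  then show ?thesis
    by (simp add: eta_def log_def sum_negf diff_divide_distrib flip: sum_divide_distrib)
qed

section \<open>Spectral decomposition and von Neumann entropy\<close>

lemma mult_mat_index:
  assumes "A \<in> carrier_mat a n" "B \<in> carrier_mat n c" "i < a" "j < c"
  shows "(A * B) $$ (i,j) = (\<Sum>k<n. A $$ (i,k) * B $$ (k,j))"
  using assms by (simp add: scalar_prod_def lessThan_atLeast0)

lemma mult_square_carrier [simp]:
  "A \<in> carrier_mat n n \<Longrightarrow> B \<in> carrier_mat n n \<Longrightarrow> A * B \<in> carrier_mat n n"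
  by (rule mult_carrier_mat)

lemma adj_carrier [simp]: "A \<in> carrier_mat n m \<Longrightarrow> adj A \<in> carrier_mat m n"
  by (simp add: adj_def)

lemma dim_adj [simp]: "dim_row (adj A) = dim_col A" "dim_col (adj A) = dim_row A"
  by (simp_all add: adj_def)

lemma adj_index: "A \<in> carrier_mat n m \<Longrightarrow> i < m \<Longrightarrow> j < n \<Longrightarrow> adj A $$ (i,j) = cnj (A $$ (j,i))"
  by (simp add: adj_def)

lemma adj_adj [simp]: "adj (adj A) = A"
  by (rule eq_matI) (simp_all add: adj_def)

lemma adj_mult:
  assumes A: "A \<in> carrier_mat a n" and B: "B \<in> carrier_mat n c"
  shows "adj (A * B) = adj B * adj A"
proof (rule eq_matI)
  have AB: "A * B \<in> carrier_mat a c" using A B by simp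
  show "dim_row (adj (A * B)) = dim_row (adj B * adj A)" "dim_col (adj (A * B)) = dim_col (adj B * adj A)"
    using A B by (simp_all add: adj_def)
  fix i j assume "i < dim_row (adj B * adj A)" "j < dim_col (adj B * adj A)"
  then have i: "i < c" and j: "j < a" using A B by (simp_all add: adj_def)
  show "adj (A * B) $$ (i, j) = (adj B * adj A) $$ (i, j)"
    unfolding adj_index[OF AB i j] mult_mat_index[OF A B j i]
      mult_mat_index[OF adj_carrier[OF B] adj_carrier[OF A] i j]
    using i j by (simp add: adj_index[OF A] adj_index[OF B] mult.commute)
qed

section \<open>Von Neumann entropy from characteristic polynomials\<close>

lemma sum_set_mset_count:
  "(\<Sum>x\<in>set_mset M. real (count M x) * f x) = (\<Sum>x\<in>#M. f x)"
proof (induction M)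
  case (add y M)
  have "(\<Sum>x\<in>set_mset (add_mset y M). real (count (add_mset y M) x) * f x)
     = (\<Sum>x\<in>set_mset (add_mset y M). real (count M x) * f x + (if x = y then f x else 0))"
    by (intro sum.cong refl) (auto simp: algebra_simps)
  also have "\<dots> = (\<Sum>x\<in>set_mset (add_mset y M). real (count M x) * f x) + f y"
    by (simp add: sum.distrib)
  also have "(\<Sum>x\<in>set_mset (add_mset y M). real (count M x) * f x) = (\<Sum>x\<in>set_mset M. real (count M x) * f x)"
    by (rule sum.mono_neutral_right) (auto simp: not_in_iff)
  finally show ?case using add by simp
qed simp

lemma char_poly_nonzero: "(A :: 'a :: idom mat) \<in> carrier_mat n n \<Longrightarrow> char_poly A \<noteq> 0"
  using degree_monic_char_poly[of A n] by auto

text \<open>As a sum over the multiset of roots, the entropy becomes additive when characteristic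
  polynomials multiply.\<close>

lemma vn_entropy_proots:
  assumes "A \<in> carrier_mat n n"
  shows "vn_entropy A = (\<Sum>z\<in>#proots (char_poly A). eta (Re z))"
  unfolding sum_set_mset_count[symmetric] vn_entropy_def
  using char_poly_nonzero[OF assms] by simp

lemma vn_entropy_cong: "char_poly A = char_poly B \<Longrightarrow> vn_entropy A = vn_entropy B"
  by (simp add: vn_entropy_def)

lemma vn_entropy_upper_triangular:
  assumes A: "A \<in> carrier_mat n n" and "upper_triangular A"
  shows "vn_entropy A = (\<Sum>i<n. eta (Re (A $$ (i,i))))"
proof -
  have "proots (\<Prod>a\<leftarrow>as. [:- a, 1:]) = mset as" for as :: "complex list"
  proof (induction as)
    case (Cons a as)
    have "(\<Prod>a\<leftarrow>as. [:- a, 1:]) \<noteq> 0" by (auto simp: prod_list_zero_iff)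
    then show ?case using Cons by (simp add: proots_mult del: mult_pCons_left)
  qed simp
  then have "proots (char_poly A) = mset (diag_mat A)"
    unfolding char_poly_upper_triangular[OF assms] .
  then have "vn_entropy A = sum_list (map (\<lambda>z. eta (Re z)) (diag_mat A))"
    unfolding vn_entropy_proots[OF A] by (simp only: sum_mset_sum_list flip: mset_map)
  then show ?thesis
    using A by (simp add: diag_mat_def o_def interv_sum_list_conv_sum_set_nat lessThan_atLeast0)
qed

lemma vn_entropy_zero [simp]: "vn_entropy (0\<^sub>m n n) = 0"
  by (subst vn_entropy_upper_triangular[of _ n]) auto

lemma vn_entropy_lower_block:
  assumes B: "B \<in> carrier_mat n n" and C: "C \<in> carrier_mat m n" and D: "D \<in> carrier_mat m m"
  shows "vn_entropy (four_block_mat B (0\<^sub>m n m) C D) = vn_entropy B + vn_entropy D"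
proof -
  have "char_poly (four_block_mat B (0\<^sub>m n m) C D) = char_poly B * char_poly D"
    using char_poly_factorized[OF B] char_poly_factorized[OF D] B C D
    by (intro char_poly_0_block'[OF refl]) auto
  then show ?thesis
    using char_poly_nonzero[OF B] char_poly_nonzero[OF D]
    by (simp add: vn_entropy_proots[OF B] vn_entropy_proots[OF D] proots_mult
        vn_entropy_proots[OF four_block_carrier_mat[OF B D]])
qed

lemma vn_entropy_similar: "similar_mat A B \<Longrightarrow> vn_entropy A = vn_entropy B"
  by (intro vn_entropy_cong char_poly_similar)

text \<open>The two products may differ in size. Padded with zero blocks to the common size
  \<open>m + n\<close>, they sit in the matrices \<open>M1\<close> and \<open>M2\<close>, which the
  unipotent \<open>P\<close> makes similar; the added eigenvalues cost \<open>eta 0 = 0\<close>.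
  This carries entropies from the environment to the Choi state.\<close>

lemma vn_entropy_mult_commute:
  assumes A: "A \<in> carrier_mat m n" and B: "B \<in> carrier_mat n m"
  shows "vn_entropy (A * B) = vn_entropy (B * A)"
proof -
  define M1 where "M1 = four_block_mat (A * B) (0\<^sub>m m n) B (0\<^sub>m n n)"
  define M2 where "M2 = four_block_mat (0\<^sub>m m m) (0\<^sub>m m n) B (B * A)"
  define P where "P = four_block_mat (1\<^sub>m m) A (0\<^sub>m n m) (1\<^sub>m n)"
  define Q where "Q = four_block_mat (1\<^sub>m m) (- A) (0\<^sub>m n m) (1\<^sub>m n)"
  have carr: "M1 \<in> carrier_mat (m+n) (m+n)" "M2 \<in> carrier_mat (m+n) (m+n)"
    "P \<in> carrier_mat (m+n) (m+n)" "Q \<in> carrier_mat (m+n) (m+n)"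
    using A B by (auto simp: M1_def M2_def P_def Q_def)
  have AA: "- A + A = 0\<^sub>m m n" "A + - A = 0\<^sub>m m n" using A by auto
  have Z: "- 0\<^sub>m n n + 1\<^sub>m n = (1\<^sub>m n :: complex mat)" by auto
  have PQ: "P * Q = 1\<^sub>m (m + n)"
    unfolding P_def Q_def using A AA Z
    by (subst mult_four_block_mat[of _ m m _ n _ n _ _ m _ n]) auto
  have QP: "Q * P = 1\<^sub>m (m + n)"
    unfolding P_def Q_def using A AA
    by (subst mult_four_block_mat[of _ m m _ n _ n _ _ m _ n]) auto
  have ABA: "A * B * A = A * (B * A)" using A B by simp
  have "M1 * P = P * M2"
    unfolding P_def M1_def M2_def using A B
    by (subst (1 2) mult_four_block_mat[of _ m m _ n _ n _ _ m _ n]) (auto simp: ABA)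
  then have "M1 = P * M2 * Q"
    using PQ carr by (metis assoc_mult_mat right_mult_one_mat)
  then have "similar_mat_wit M1 M2 P Q"
    using carr PQ QP by (intro similar_mat_witI[of _ _ "m+n"]) auto
  then have "vn_entropy M1 = vn_entropy M2"
    by (intro vn_entropy_similar) (auto simp: similar_mat_def)
  moreover have "vn_entropy M1 = vn_entropy (A * B)" unfolding M1_def
    using A B by (subst vn_entropy_lower_block) auto
  moreover have "vn_entropy M2 = vn_entropy (B * A)" unfolding M2_def
    using A B by (subst vn_entropy_lower_block) auto
  ultimately show ?thesis by simp
qed

section \<open>Unitary matrices and the spectral theorem\<close>

definition diagr :: "nat \<Rightarrow> (nat \<Rightarrow> real) \<Rightarrow> complex mat" where
  "diagr n p = mat n n (\<lambda>(i,j). if i = j then complex_of_real (p i) else 0)"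

lemma diagr_carrier [simp]: "diagr n p \<in> carrier_mat n n"
  by (simp add: diagr_def)

lemma dim_diagr [simp]: "dim_row (diagr n p) = n" "dim_col (diagr n p) = n"
  by (simp_all add: diagr_def)

definition unitary_mat :: "nat \<Rightarrow> complex mat \<Rightarrow> bool" where
  "unitary_mat n U \<longleftrightarrow> U \<in> carrier_mat n n \<and> adj U * U = 1\<^sub>m n"

lemma unitary_matD:
  assumes "unitary_mat n U"
  shows "U \<in> carrier_mat n n" "adj U * U = 1\<^sub>m n" "U * adj U = 1\<^sub>m n"
proof -
  show U: "U \<in> carrier_mat n n" "adj U * U = 1\<^sub>m n" using assms by (simp_all add: unitary_mat_def)
  show "U * adj U = 1\<^sub>m n" using mat_mult_left_right_inverse[OF _ U(1) U(2)] U(1) by simp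
qed

lemma unitary_mat_mult:
  assumes "unitary_mat n U" "unitary_mat n V"
  shows "unitary_mat n (U * V)"
proof -
  note U = unitary_matD[OF assms(1)] and V = unitary_matD[OF assms(2)]
  have "adj (U * V) * (U * V) = adj V * (adj U * U) * V"
    using U(1) V(1) adj_carrier[OF U(1)] adj_carrier[OF V(1)]
    by (simp add: adj_mult[OF U(1) V(1)] assoc_mult_mat[of _ n n _ n _ n])
  then show ?thesis using U V by (simp add: unitary_mat_def right_mult_one_mat[of _ n n])
qed

lemma unitary_mat_adj:
  assumes "unitary_mat n U"
  shows "unitary_mat n (adj U)"
  unfolding unitary_mat_def adj_adj using unitary_matD[OF assms] by auto

lemma unitary_mat_block:
  assumes "unitary_mat n U" "unitary_mat m V"
  shows "unitary_mat (n + m) (four_block_mat U (0\<^sub>m n m) (0\<^sub>m m n) V)"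
proof -
  note U = unitary_matD[OF assms(1)] and V = unitary_matD[OF assms(2)]
  have "adj (four_block_mat U (0\<^sub>m n m) (0\<^sub>m m n) V) = four_block_mat (adj U) (0\<^sub>m n m) (0\<^sub>m m n) (adj V)"
    using U(1) V(1) by (intro eq_matI) (auto simp: adj_def)
  moreover have "four_block_mat (adj U) (0\<^sub>m n m) (0\<^sub>m m n) (adj V) * four_block_mat U (0\<^sub>m n m) (0\<^sub>m m n) V = 1\<^sub>m (n + m)"
    using U V by (subst mult_four_block_mat[of _ n n _ m _ m _ _ n _ m]) auto
  ultimately show ?thesis using U(1) V(1) by (simp add: unitary_mat_def)
qed

text \<open>Complete \<open>v\<close> to a basis, orthogonalize starting from \<open>v\<close>, and
  normalize the columns; \<open>c\<close> is the normalization of \<open>v\<close>.\<close>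

lemma unitary_mat_extend:
  fixes v :: "complex vec"
  assumes v: "v \<in> carrier_vec n" and v0: "v \<noteq> 0\<^sub>v n"
  shows "\<exists>W c. unitary_mat n W \<and> col W 0 = c \<cdot>\<^sub>v v"
proof -
  have n: "n \<noteq> 0" using v v0 by (cases "n = 0") auto
  interpret cof_vec_space n "TYPE(complex)" .
  define b where "b = basis_completion v"
  define ws where "ws = gram_schmidt n b"
  from basis_completion[OF v v0, folded b_def]
  have b: "distinct b" "\<not> lin_dep (set b)" "set b \<subseteq> carrier_vec n" "hd b = v" "length b = n" by auto
  then obtain vs where bv: "b = v # vs" using n by (cases b) auto
  from gram_schmidt_result[OF b(3,1,2) refl, folded ws_def]
  have ws: "set ws \<subseteq> carrier_vec n" "corthogonal ws" "length ws = n" by (auto simp: b)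
  have hdws: "hd ws = v" using gram_schmidt_hd[OF v, of vs, folded bv] unfolding ws_def .
  have wsc: "ws ! j \<in> carrier_vec n" if "j < n" for j using ws that by auto
  define N where "N j = (\<Sum>k<n. (cmod (ws ! j $ k))\<^sup>2)" for j
  have ip: "(\<Sum>k<n. ws ! j $ k * cnj (ws ! i $ k)) = (if i = j then of_real (N i) else 0)" if "i < n" "j < n" for i j
  proof (cases "i = j")
    case True
    then show ?thesis by (simp only: N_def complex_norm_square of_real_sum simp_thms if_True)
  next
    case False
    then have "ws ! j \<bullet>c ws ! i = 0" using corthogonalD[OF ws(2), of j i] ws(3) that by auto
    then show ?thesis using False wsc[OF that(1)] wsc[OF that(2)] that
      by (auto simp add: scalar_prod_def lessThan_atLeast0)
  qed
  have Npos: "N i > 0" if "i < n" for i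
  proof -
    have "ws ! i \<bullet>c ws ! i \<noteq> 0" using corthogonalD[OF ws(2), of i i] ws(3) that by auto
    then have "(\<Sum>k<n. ws ! i $ k * cnj (ws ! i $ k)) \<noteq> 0"
      using wsc[OF that] that by (auto simp add: scalar_prod_def lessThan_atLeast0)
    then have "N i \<noteq> 0" using ip[OF that that] by auto
    moreover have "N i \<ge> 0" unfolding N_def by (intro sum_nonneg) auto
    ultimately show ?thesis by simp
  qed
  define W where "W = mat n n (\<lambda>(k,j). ws ! j $ k / sqrt (N j))"
  have W: "W \<in> carrier_mat n n" by (simp add: W_def)
  have "adj W * W = 1\<^sub>m n"
  proof (rule eq_matI)
    fix i j assume "i < dim_row (1\<^sub>m n :: complex mat)" "j < dim_col (1\<^sub>m n :: complex mat)"
    then have i: "i < n" and j: "j < n" by auto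
    have "(adj W * W) $$ (i,j) = (\<Sum>k<n. ws ! j $ k * cnj (ws ! i $ k)) / (sqrt (N i) * sqrt (N j))"
      unfolding mult_mat_index[OF adj_carrier[OF W] W i j] sum_divide_distrib
      using i j by (intro sum.cong refl) (simp add: adj_index[OF W], simp add: W_def mult_ac)
    also have "\<dots> = (if i = j then 1 else 0)"
      unfolding ip[OF i j] using Npos[OF i] by (auto simp flip: of_real_mult)
    finally show "(adj W * W) $$ (i,j) = 1\<^sub>m n $$ (i,j)" using i j by simp
  qed (use W in \<open>auto simp: adj_def\<close>)
  moreover have "col W 0 = (1 / sqrt (N 0)) \<cdot>\<^sub>v v"
    proof -
    have "ws \<noteq> []" using n ws(3) by auto
    then have "ws ! 0 = v" using hdws hd_conv_nth[of ws] by simp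
    then show ?thesis using n v W by (intro eq_vecI) (auto simp: W_def)
  qed
  ultimately show ?thesis using W by (auto simp: unitary_mat_def)
qed

text \<open>Deflation: in a unitary basis whose first vector is an eigenvector, the first column
  vanishes below the diagonal, and by Hermiticity so does the first row. The remaining block is
  Hermitian of size \<open>m\<close>.\<close>

lemma hermitian_diagonalization:
  assumes "A \<in> carrier_mat n n" "adj A = A"
  shows "\<exists>U p. unitary_mat n U \<and> A = U * diagr n p * adj U"
  using assms
proof (induction n arbitrary: A)
  case 0
  then have "A = 1\<^sub>m 0 * diagr 0 p * adj (1\<^sub>m 0)" for p by (intro eq_matI) (auto simp: adj_def)
  moreover have "unitary_mat 0 (1\<^sub>m 0)" by (auto simp: unitary_mat_def adj_def)
  ultimately show ?case by blast
next
  case (Suc m A)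
  let ?n = "Suc m"
  note A = Suc.prems(1)
  obtain as where as: "char_poly A = (\<Prod>a\<leftarrow>as. [:- a, 1:])" "length as = ?n"
    using char_poly_factorized[OF A] by blast
  then obtain e es where "as = e # es" by (cases as) auto
  then have "poly (char_poly A) e = 0" using as by simp
  then have "eigenvalue A e" using eigenvalue_root_char_poly[OF A] by simp
  then obtain v where "eigenvector A v e" unfolding eigenvalue_def by blast
  then have v: "v \<in> carrier_vec ?n" "v \<noteq> 0\<^sub>v ?n" "A *\<^sub>v v = e \<cdot>\<^sub>v v"
    using A unfolding eigenvector_def by auto
  obtain W c where uW: "unitary_mat ?n W" and c: "col W 0 = c \<cdot>\<^sub>v v"
    using unitary_mat_extend[OF v(1,2)] by blast
  note W = unitary_matD[OF uW]
  define A' where "A' = adj W * A * W"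
  have A': "A' \<in> carrier_mat ?n ?n" using A W(1) by (simp add: A'_def)
  have A'h: "adj A' = A'"
    unfolding A'_def using A W(1) adj_carrier[OF W(1)]
    by (simp add: adj_mult[of _ ?n ?n _ ?n] Suc.prems(2) assoc_mult_mat[of _ ?n ?n _ ?n _ ?n])
  have "A *\<^sub>v (c \<cdot>\<^sub>v v) = c \<cdot>\<^sub>v (A *\<^sub>v v)" using A v by (simp add: mult_mat_vec)
  then have colA: "col (A * W) 0 = e \<cdot>\<^sub>v col W 0"
    using col_mult2[OF A W(1), of 0] by (simp add: c v(3) smult_smult_assoc mult.commute)
  have col0: "A' $$ (i,0) = (if i = 0 then e else 0)" if i: "i < ?n" for i
  proof -
    have "A' = adj W * (A * W)" unfolding A'_def using A W(1) by (simp add: assoc_mult_mat[of _ ?n ?n _ ?n _ ?n])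
    then have "A' $$ (i,0) = row (adj W) i \<bullet> col (A * W) 0" using A W(1) i by (simp add: adj_def)
    also have "\<dots> = e * (row (adj W) i \<bullet> col W 0)" unfolding colA using W(1) i by (simp add: adj_def)
    also have "row (adj W) i \<bullet> col W 0 = (adj W * W) $$ (i,0)" using W(1) i by (simp add: adj_def)
    finally show ?thesis unfolding W(2) using i by simp
  qed
  have row0: "A' $$ (0,j) = (if j = 0 then cnj e else 0)" if j: "j < ?n" for j
    using adj_index[OF A', of 0 j] col0[OF j] j unfolding A'h by simp
  \<comment> \<open>Comparing the corner entry as part of the first column and of the first row
    shows that \<open>e\<close> is real, as \<open>diagr\<close> demands.\<close>
  have e: "of_real (Re e) = e" using col0[of 0] row0[of 0] by (simp add: complex_eq_iff)
  define A3 where "A3 = mat m m (\<lambda>(i,j). A' $$ (Suc i, Suc j))"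
  have A3: "A3 \<in> carrier_mat m m" by (simp add: A3_def)
  have "adj A3 = A3"
    proof (rule eq_matI)
    fix i j assume "i < dim_row A3" "j < dim_col A3"
    then have ij: "i < m" "j < m" using A3 by auto
    then have "A' $$ (Suc i, Suc j) = cnj (A' $$ (Suc j, Suc i))"
      using adj_index[OF A', of "Suc i" "Suc j"] A'h by simp
    then show "adj A3 $$ (i,j) = A3 $$ (i,j)" using ij adj_index[OF A3] by (simp add: A3_def)
  qed (use A3 in \<open>auto simp: adj_def\<close>)
  then obtain U3 p3 where uU3: "unitary_mat m U3" and A3e: "A3 = U3 * diagr m p3 * adj U3"
    using Suc.IH[OF A3] by blast
  note U3 = unitary_matD[OF uU3]
  define F where "F = four_block_mat (1\<^sub>m 1) (0\<^sub>m 1 m) (0\<^sub>m m 1) U3"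
  have one: "unitary_mat 1 (1\<^sub>m 1)"
    unfolding unitary_mat_def by (auto simp: adj_def intro!: eq_matI)
  have uF: "unitary_mat ?n F" using unitary_mat_block[OF one uU3] by (simp add: F_def)
  note F = unitary_matD[OF uF]
  define p where "p i = (if i = 0 then Re e else p3 (i - 1))" for i
  have D: "diagr ?n p = four_block_mat (diagr 1 (\<lambda>_. Re e)) (0\<^sub>m 1 m) (0\<^sub>m m 1) (diagr m p3)"
    by (rule eq_matI) (auto simp: diagr_def p_def)
  have aF: "adj F = four_block_mat (1\<^sub>m 1) (0\<^sub>m 1 m) (0\<^sub>m m 1) (adj U3)"
    unfolding F_def using U3(1) by (intro eq_matI) (auto simp: adj_def)
  have FD: "F * diagr ?n p = four_block_mat (diagr 1 (\<lambda>_. Re e)) (0\<^sub>m 1 m) (0\<^sub>m m 1) (U3 * diagr m p3)"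
    unfolding D F_def using U3(1)
    by (subst mult_four_block_mat[of _ 1 1 _ m _ m _ _ 1 _ m]) (auto simp del: One_nat_def simp: left_mult_zero_mat[of _ _ m] left_mult_zero_mat[of _ _ 1] right_mult_zero_mat[of _ _ 1] right_mult_zero_mat[of _ m m] left_mult_one_mat[of _ 1 1] right_mult_one_mat[of _ 1 1])
  have FDF: "F * diagr ?n p * adj F = four_block_mat (diagr 1 (\<lambda>_. Re e)) (0\<^sub>m 1 m) (0\<^sub>m m 1) A3"
    unfolding FD aF A3e using U3(1)
    by (subst mult_four_block_mat[of _ 1 1 _ m _ m _ _ 1 _ m]) (auto simp del: One_nat_def simp: left_mult_zero_mat[of _ _ m] left_mult_zero_mat[of _ _ 1] right_mult_zero_mat[of _ _ 1] right_mult_zero_mat[of _ m m] left_mult_one_mat[of _ 1 1] right_mult_one_mat[of _ 1 1])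
  have A'D: "A' = F * diagr ?n p * adj F"
    unfolding FDF
  proof (rule eq_matI)
    fix i j assume "i < dim_row (four_block_mat (diagr 1 (\<lambda>_. Re e)) (0\<^sub>m 1 m) (0\<^sub>m m 1) A3)"
      "j < dim_col (four_block_mat (diagr 1 (\<lambda>_. Re e)) (0\<^sub>m 1 m) (0\<^sub>m m 1) A3)"
    then have "i < ?n" "j < ?n" using A3 by (auto simp: diagr_def)
    then show "A' $$ (i,j) = four_block_mat (diagr 1 (\<lambda>_. Re e)) (0\<^sub>m 1 m) (0\<^sub>m m 1) A3 $$ (i,j)"
      using A3 col0 row0 e by (cases i; cases j) (auto simp: diagr_def A3_def)
  qed (use A' A3 in \<open>auto simp: diagr_def\<close>)
  have "W * A' * adj W = (W * adj W) * A * (W * adj W)"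
    unfolding A'_def using A W(1) adj_carrier[OF W(1)]
    by (simp add: assoc_mult_mat[of _ ?n ?n _ ?n _ ?n])
  then have "A = W * A' * adj W" using A W by simp
  also have "\<dots> = (W * F) * diagr ?n p * adj (W * F)"
    unfolding A'D using A W(1) F(1) adj_carrier[OF W(1)] adj_carrier[OF F(1)]
    by (simp add: adj_mult[of _ ?n ?n _ ?n] assoc_mult_mat[of _ ?n ?n _ ?n _ ?n])
  finally show ?case using unitary_mat_mult[OF uW uF] by blast
qed

lemma vn_entropy_unitary_diag:
  assumes "unitary_mat n U"
  shows "vn_entropy (U * diagr n p * adj U) = (\<Sum>i<n. eta (p i))"
proof -
  note U = unitary_matD[OF assms]
  have "similar_mat_wit (U * diagr n p * adj U) (diagr n p) U (adj U)"
    using U adj_carrier[OF U(1)] by (intro similar_mat_witI[of _ _ n]) auto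
  then have "vn_entropy (U * diagr n p * adj U) = vn_entropy (diagr n p)"
    by (intro vn_entropy_similar) (auto simp: similar_mat_def)
  also have "\<dots> = (\<Sum>i<n. eta (p i))"
    by (subst vn_entropy_upper_triangular[of _ n]) (auto simp: diagr_def)
  finally show ?thesis .
qed

lemma unitary_diag_index:
  assumes X: "X \<in> carrier_mat n n" and ij: "i < n" "j < n"
  shows "(X * diagr n p * adj X) $$ (i,j) = (\<Sum>k<n. of_real (p k) * X $$ (i,k) * cnj (X $$ (j,k)))"
proof -
  have XD: "(X * diagr n p) $$ (i,k) = of_real (p k) * X $$ (i,k)" if "k < n" for k
    unfolding mult_mat_index[OF X diagr_carrier ij(1) that]
    using that by (simp add: diagr_def if_distrib[of "\<lambda>x. _ * x"] cong: if_cong)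
  show ?thesis
    unfolding mult_mat_index[OF mult_square_carrier[OF X diagr_carrier] adj_carrier[OF X] ij]
    using ij by (intro sum.cong refl) (simp add: XD adj_index[OF X] del: index_mult_mat)
qed

lemma gram_diag_index:
  assumes W: "W \<in> carrier_mat m n" and i: "i < n"
  shows "(adj W * W) $$ (i,i) = of_real (\<Sum>k<m. (cmod (W $$ (k,i)))\<^sup>2)"
  unfolding of_real_sum complex_norm_square mult_mat_index[OF adj_carrier[OF W] W i i]
  using i by (intro sum.cong refl) (simp add: adj_index[OF W] mult.commute)

lemma unitary_mat_col_norm:
  assumes "unitary_mat n X" "i < n"
  shows "(\<Sum>k<n. (cmod (X $$ (k,i)))\<^sup>2) = 1"
proof -
  note X = unitary_matD[OF assms(1)]
  have "complex_of_real (\<Sum>k<n. (cmod (X $$ (k,i)))\<^sup>2) = complex_of_real 1"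
    unfolding gram_diag_index[OF X(1) assms(2), symmetric] X(2) using assms(2) by simp
  then show ?thesis by (simp only: of_real_eq_iff)
qed

lemma unitary_mat_row_norm:
  assumes "unitary_mat n X" "i < n"
  shows "(\<Sum>k<n. (cmod (X $$ (i,k)))\<^sup>2) = 1"
  using unitary_mat_col_norm[OF unitary_mat_adj[OF assms(1)] assms(2)] assms(2)
  by (simp add: adj_index[OF unitary_matD(1)[OF assms(1)]])

text \<open>Positivity is encoded throughout by a factorization \<open>adj W * W\<close> with
  possibly rectangular \<open>W\<close>: in the eigenbasis the diagonal entries are squared column
  norms of \<open>W * U\<close>.\<close>

lemma psd_diagonalization:
  assumes W: "W \<in> carrier_mat m n"
  shows "\<exists>U p. unitary_mat n U \<and> adj W * W = U * diagr n p * adj U \<and> (\<forall>i<n. 0 \<le> p i) \<and>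
     vn_entropy (adj W * W) = (\<Sum>i<n. eta (p i))"
proof -
  have A: "adj W * W \<in> carrier_mat n n" using W adj_carrier[OF W] by (rule mult_carrier_mat[rotated])
  have "adj (adj W * W) = adj W * W" using adj_mult[OF adj_carrier[OF W] W] by simp
  then obtain U p where uU: "unitary_mat n U" and D: "adj W * W = U * diagr n p * adj U"
    using hermitian_diagonalization[OF A] by blast
  note U = unitary_matD[OF uU]
  have WU: "W * U \<in> carrier_mat m n" using W U(1) by (rule mult_carrier_mat)
  have "adj (W * U) * (W * U) = adj U * (adj W * W) * U"
    unfolding adj_mult[OF W U(1)] assoc_mult_mat[OF adj_carrier[OF U(1)] adj_carrier[OF W] WU]
      assoc_mult_mat[OF adj_carrier[OF U(1)] A U(1)] assoc_mult_mat[OF adj_carrier[OF W] W U(1)] ..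
  also have "\<dots> = (adj U * U) * diagr n p * (adj U * U)"
    unfolding D using U(1) adj_carrier[OF U(1)]
    by (simp add: assoc_mult_mat[of _ n n _ n _ n])
  also have "\<dots> = diagr n p" unfolding U(2) by simp
  finally have E: "adj (W * U) * (W * U) = diagr n p" .
  have "0 \<le> p i" if "i < n" for i
  proof -
    have "complex_of_real (p i) = (adj (W * U) * (W * U)) $$ (i,i)"
      unfolding E using that by (simp add: diagr_def)
    also have "\<dots> = complex_of_real (\<Sum>k<m. (cmod ((W * U) $$ (k,i)))\<^sup>2)"
      by (rule gram_diag_index[OF WU that])
    finally have "p i = (\<Sum>k<m. (cmod ((W * U) $$ (k,i)))\<^sup>2)" by (simp only: of_real_eq_iff)
    then show ?thesis by (simp add: sum_nonneg)
  qed
  then show ?thesis using uU D vn_entropy_unitary_diag[OF uU] by metis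
qed

section \<open>Traces in an eigenbasis\<close>

lemma unitary_diag_trace:
  assumes "unitary_mat n U"
  shows "(\<Sum>i<n. (U * diagr n p * adj U) $$ (i,i)) = of_real (\<Sum>i<n. p i)"
proof -
  note U = unitary_matD[OF assms]
  have "(\<Sum>i<n. (U * diagr n p * adj U) $$ (i,i)) = (\<Sum>i<n. \<Sum>k<n. of_real (p k * (cmod (U $$ (i,k)))\<^sup>2))"
    by (intro sum.cong refl) (simp add: unitary_diag_index[OF U(1)] complex_norm_square mult.assoc
        del: assoc_mult_mat index_mult_mat of_real_power)
  also have "\<dots> = of_real (\<Sum>k<n. p k * (\<Sum>i<n. (cmod (U $$ (i,k)))\<^sup>2))"
    by (subst sum.swap) (simp add: sum_distrib_left)
  also have "(\<Sum>k<n. p k * (\<Sum>i<n. (cmod (U $$ (i,k)))\<^sup>2)) = (\<Sum>k<n. p k)"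
    by (intro sum.cong refl) (simp add: unitary_mat_col_norm[OF assms])
  finally show ?thesis .
qed

lemma unitary_diag_trace_mult:
  assumes uU: "unitary_mat n U" and G: "G \<in> carrier_mat n n"
  shows "(\<Sum>i<n. of_real (p i) * (adj U * G * U) $$ (i,i))
     = (\<Sum>r<n. \<Sum>s<n. G $$ (r,s) * (U * diagr n p * adj U) $$ (s,r))"
proof -
  note U = unitary_matD[OF uU]
  note carr = U(1) adj_carrier[OF U(1)] G
  have "(\<Sum>i<n. of_real (p i) * (adj U * G * U) $$ (i,i)) = (\<Sum>i<n. \<Sum>s<n. \<Sum>r<n. of_real (p i) * (cnj (U $$ (r,i)) * G $$ (r,s) * U $$ (s,i)))"
  proof (intro sum.cong refl)
    fix i assume "i \<in> {..<n}"
    then have i: "i < n" by simp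
    show "of_real (p i) * (adj U * G * U) $$ (i,i) = (\<Sum>s<n. \<Sum>r<n. of_real (p i) * (cnj (U $$ (r,i)) * G $$ (r,s) * U $$ (s,i)))"
      using carr i by (simp add: mult_mat_index[of "adj U * G" n n U n] mult_mat_index[of "adj U" n n G n] adj_index[OF U(1)]
        sum_distrib_left sum_distrib_right del: assoc_mult_mat index_mult_mat)
  qed
  also have "\<dots> = (\<Sum>r<n. \<Sum>s<n. \<Sum>i<n. of_real (p i) * (cnj (U $$ (r,i)) * G $$ (r,s) * U $$ (s,i)))"
    by (subst sum.swap, subst (2) sum.swap, subst sum.swap) simp
  also have "\<dots> = (\<Sum>r<n. \<Sum>s<n. G $$ (r,s) * (U * diagr n p * adj U) $$ (s,r))"
    by (intro sum.cong refl)
      (simp add: unitary_diag_index[OF U(1)] sum_distrib_left mult_ac del: assoc_mult_mat)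
  finally show ?thesis .
qed

lemma unitary_mat_norm_le_1:
  assumes "unitary_mat n X" "i < n" "k < n"
  shows "cmod (X $$ (i,k)) \<le> 1"
proof -
  have "(cmod (X $$ (i,k)))\<^sup>2 \<le> (\<Sum>k<n. (cmod (X $$ (i,k)))\<^sup>2)"
    using assms(3) by (intro member_le_sum) auto
  then show ?thesis unfolding unitary_mat_row_norm[OF assms(1,2)] by (simp add: abs_square_le_1)
qed

text \<open>In the eigenbasis of the state the trace is a convex combination of diagonal entries of
  a unitary matrix, each of modulus at most 1.\<close>

lemma psd_trace_unitary_bound:
  assumes W: "W \<in> carrier_mat m n" and uG: "unitary_mat n G"
    and tr: "(\<Sum>i<n. (adj W * W) $$ (i,i)) = 1"
  shows "cmod (\<Sum>r<n. \<Sum>s<n. G $$ (r,s) * (adj W * W) $$ (s,r)) \<le> 1"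
proof -
  obtain U p where uU: "unitary_mat n U" and D: "adj W * W = U * diagr n p * adj U"
    and p: "\<And>i. i < n \<Longrightarrow> 0 \<le> p i"
    using psd_diagonalization[OF W] by blast
  have "complex_of_real (\<Sum>i<n. p i) = complex_of_real 1"
    using tr unfolding D unitary_diag_trace[OF uU] by simp
  then have sp: "(\<Sum>i<n. p i) = 1" by (simp only: of_real_eq_iff)
  have uY: "unitary_mat n (adj U * G * U)" by (intro unitary_mat_mult unitary_mat_adj uU uG)
  have "cmod (\<Sum>i<n. of_real (p i) * (adj U * G * U) $$ (i,i)) \<le> (\<Sum>i<n. p i)"
  proof (intro sum_norm_le)
    fix i assume "i \<in> {..<n}"
    then show "cmod (of_real (p i) * (adj U * G * U) $$ (i,i)) \<le> p i"
      using p[of i] unitary_mat_norm_le_1[OF uY, of i i]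
      by (simp add: norm_mult mult_left_le del: index_mult_mat assoc_mult_mat)
  qed
  then show ?thesis unfolding D unitary_diag_trace_mult[OF uU unitary_matD(1)[OF uG]] sp .
qed

text \<open>\<open>X\<close> collects the overlaps of the eigenvectors in \<open>U\<close> with the
  basis \<open>V\<close>, and \<open>Y\<close> those after applying \<open>G\<close>. Both are
  unitary, which supplies all norm hypotheses of the scalar inequality.\<close>

lemma pinched_entropy_bound_mat:
  assumes uU: "unitary_mat n U" and uV: "unitary_mat n V" and uG: "unitary_mat n G"
    and p: "\<And>i. i < n \<Longrightarrow> 0 \<le> p i" and sp: "(\<Sum>i<n. p i) = 1"
    and rho: "rho = U * diagr n p * adj U"
    and q: "\<And>j. j < n \<Longrightarrow> (adj V * rho * V) $$ (j,j) = complex_of_real (q j)"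
    and diag: "\<And>j. j < n \<Longrightarrow> (adj V * G * V) $$ (j,j) = 0"
    and b: "b = Re (\<Sum>r<n. \<Sum>s<n. G $$ (r,s) * rho $$ (s,r))"
  shows "(\<Sum>i<n. eta (p i)) \<le> (\<Sum>j<n. eta (q j)) - (1 - hbin b)"
proof -
  note U = unitary_matD[OF uU] and V = unitary_matD[OF uV] and G = unitary_matD[OF uG]
  note carr = U(1) V(1) G(1) adj_carrier[OF U(1)] adj_carrier[OF V(1)] adj_carrier[OF G(1)]
  note as = assoc_mult_mat[of _ n n _ n _ n]
  define X where "X = adj V * U"
  define Y where "Y = adj V * G * U"
  have uX: "unitary_mat n X" unfolding X_def by (intro unitary_mat_mult unitary_mat_adj uU uV)
  have uY: "unitary_mat n Y" unfolding Y_def by (intro unitary_mat_mult unitary_mat_adj uU uV uG)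
  note X = unitary_matD[OF uX] and Y = unitary_matD[OF uY]
  have XDX: "X * diagr n p * adj X = adj V * rho * V"
    unfolding X_def rho adj_mult[OF adj_carrier[OF V(1)] U(1)] adj_adj using carr by (simp add: as)
  have YX: "Y * adj X = adj V * G * V"
  proof -
    have "Y * adj X = adj V * G * (U * adj U) * V"
      unfolding X_def Y_def adj_mult[OF adj_carrier[OF V(1)] U(1)] adj_adj using carr by (simp add: as)
    then show ?thesis using carr U(3) right_mult_one_mat[of "adj V * G" n n] by (simp add: as)
  qed
  have XY: "adj X * Y = adj U * G * U"
  proof -
    have "adj X * Y = adj U * (V * adj V) * (G * U)"
      unfolding X_def Y_def adj_mult[OF adj_carrier[OF V(1)] U(1)] adj_adj using carr by (simp add: as)
    then show ?thesis using carr V(3) right_mult_one_mat[of "adj U" n n] by (simp add: as)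
  qed
  show ?thesis
  proof (rule pinched_entropy_bound[where u = "\<lambda>i j. X $$ (j,i)" and g = "\<lambda>i j. Y $$ (j,i)"])
    fix j assume "j \<in> {..<n}"
    then have j: "j < n" by simp
    have "complex_of_real (q j) = complex_of_real (\<Sum>i<n. p i * (cmod (X $$ (j,i)))\<^sup>2)"
      unfolding q[OF j, symmetric] XDX[symmetric] unitary_diag_index[OF X(1) j j]
      by (simp add: complex_norm_square mult.assoc del: of_real_power)
    then show "q j = (\<Sum>i<n. p i * (cmod (X $$ (j,i)))\<^sup>2)" by (simp only: of_real_eq_iff)
    have "(\<Sum>i<n. cnj (X $$ (j,i)) * Y $$ (j,i)) = (Y * adj X) $$ (j,j)"
      unfolding mult_mat_index[OF Y(1) adj_carrier[OF X(1)] j j]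
      using j by (intro sum.cong refl) (simp add: adj_index[OF X(1)])
    also have "\<dots> = 0" unfolding YX by (rule diag[OF j])
    finally show "(\<Sum>i<n. Re (cnj (X $$ (j,i)) * Y $$ (j,i))) = 0" by (simp only: Re_sum[symmetric]) simp
  next
    have "(\<Sum>i<n. of_real (p i) * (\<Sum>j<n. cnj (X $$ (j,i)) * Y $$ (j,i))) = (\<Sum>i<n. of_real (p i) * (adj U * G * U) $$ (i,i))"
    proof (intro sum.cong refl arg_cong2[where f = "(*)"])
      fix i assume "i \<in> {..<n}"
      then have i: "i < n" by simp
      show "(\<Sum>j<n. cnj (X $$ (j,i)) * Y $$ (j,i)) = (adj U * G * U) $$ (i,i)"
        unfolding XY[symmetric] mult_mat_index[OF adj_carrier[OF X(1)] Y(1) i i]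
        using i by (intro sum.cong refl) (simp add: adj_index[OF X(1)])
    qed
    also have "\<dots> = (\<Sum>r<n. \<Sum>s<n. G $$ (r,s) * rho $$ (s,r))"
      unfolding rho by (rule unitary_diag_trace_mult[OF uU G(1)])
    finally have "b = Re (\<Sum>i<n. of_real (p i) * (\<Sum>j<n. cnj (X $$ (j,i)) * Y $$ (j,i)))" unfolding b by simp
    then show "b = (\<Sum>i<n. p i * (\<Sum>j<n. Re (cnj (X $$ (j,i)) * Y $$ (j,i))))" by simp
  qed (use p sp unitary_mat_col_norm[OF uX] unitary_mat_row_norm[OF uX] unitary_mat_col_norm[OF uY]
     unitary_mat_row_norm[OF uY] in auto)
qed

section \<open>Choi states\<close>

lemma less_2_cases_nat: "(n :: nat) < 2 \<Longrightarrow> n = 0 \<or> n = 1"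
  by auto

lemma less_4_cases: "(n :: nat) < 4 \<Longrightarrow> n = 0 \<or> n = 1 \<or> n = 2 \<or> n = 3"
  by auto

lemma sum_lessThan_2: "(\<Sum>i<(2::nat). f i) = f 0 + f 1"
  by (simp add: numeral_eq_Suc)

lemma sum_lessThan_3: "(\<Sum>i<(3::nat). f i) = f 0 + f 1 + f 2"
  by (simp add: numeral_eq_Suc)

lemma sum_lessThan_4: "(\<Sum>i<(4::nat). f i) = f 0 + f 1 + f 2 + f 3"
  by (simp add: numeral_eq_Suc)

lemma pauli_carrier [simp]: "pauli a \<in> carrier_mat 2 2"
  by (auto simp: pauli_def mat_of_rows_list_def intro!: carrier_matI)

lemma pauli_index:
  "pauli 0 $$ (0,0) = 1" "pauli 0 $$ (0,1) = 0" "pauli 0 $$ (1,0) = 0" "pauli 0 $$ (1,1) = -1"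
  "pauli 1 $$ (0,0) = 0" "pauli 1 $$ (0,1) = 1" "pauli 1 $$ (1,0) = 1" "pauli 1 $$ (1,1) = 0"
  "pauli 2 $$ (0,0) = 0" "pauli 2 $$ (0,1) = - \<i>" "pauli 2 $$ (1,0) = \<i>" "pauli 2 $$ (1,1) = 0"
  by (simp_all add: pauli_def mat_of_rows_list_def)

lemma mtrace_2: "M \<in> carrier_mat 2 2 \<Longrightarrow> mtrace M = M $$ (0,0) + M $$ (1,1)"
  by (simp add: mtrace_def sum_lessThan_2)

lemma mtrace_mult_2:
  assumes "M \<in> carrier_mat 2 2" "N \<in> carrier_mat 2 2"
  shows "mtrace (M * N) = M $$ (0,0) * N $$ (0,0) + M $$ (0,1) * N $$ (1,0)
     + M $$ (1,0) * N $$ (0,1) + M $$ (1,1) * N $$ (1,1)"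
  using assms by (simp add: mtrace_2 mult_mat_index[OF assms] sum_lessThan_2 del: index_mult_mat)

text \<open>The Bloch component of the image, extended complex-linearly: the Choi state evaluates
  the channel on matrix units, which need not be Hermitian.\<close>

definition bloch_image :: "real mat \<Rightarrow> real vec \<Rightarrow> complex mat \<Rightarrow> nat \<Rightarrow> complex" where
  "bloch_image R t M a = R $$ (a,0) * (M $$ (0,0) - M $$ (1,1)) + R $$ (a,1) * (M $$ (0,1) + M $$ (1,0))
     + R $$ (a,2) * (\<i> * (M $$ (0,1) - M $$ (1,0))) + t $ a * (M $$ (0,0) + M $$ (1,1))"

lemma stokes_map_index:
  assumes M: "M \<in> carrier_mat 2 2"
  shows "stokes_map R t M $$ (0,0) = (M $$ (0,0) + M $$ (1,1) + bloch_image R t M 0) / 2" (is ?A)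
    "stokes_map R t M $$ (0,1) = (bloch_image R t M 1 - \<i> * bloch_image R t M 2) / 2" (is ?B)
    "stokes_map R t M $$ (1,0) = (bloch_image R t M 1 + \<i> * bloch_image R t M 2) / 2" (is ?C)
    "stokes_map R t M $$ (1,1) = (M $$ (0,0) + M $$ (1,1) - bloch_image R t M 0) / 2" (is ?D)
proof -
  have tr: "mtrace (M * pauli 0) = M $$ (0,0) - M $$ (1,1)" "mtrace (M * pauli 1) = M $$ (0,1) + M $$ (1,0)"
    "mtrace (M * pauli 2) = \<i> * (M $$ (0,1) - M $$ (1,0))"
    unfolding mtrace_mult_2[OF M pauli_carrier] pauli_index by (simp_all add: algebra_simps)
  have b: "(\<Sum>b<3. complex_of_real (R $$ (a,b)) * mtrace (M * pauli b)) + complex_of_real (t $ a) * mtrace M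
     = bloch_image R t M a" for a
    unfolding sum_lessThan_3 tr mtrace_2[OF M] bloch_image_def by (simp add: algebra_simps)
  have S: "stokes_map R t M $$ (i,j) = (1/2) * (mtrace M * (if i = j then 1 else 0) +
      (\<Sum>a<3. bloch_image R t M a * pauli a $$ (i,j)))" if "i < 2" "j < 2" for i j
    unfolding stokes_map_def b using that by simp
  show ?A ?B ?C ?D
    by (subst S; simp add: sum_lessThan_3 pauli_index[unfolded One_nat_def] mtrace_2[OF M] field_simps)+
qed

text \<open>Row and column index \<open>r\<close> stands for the pair of the input index \<open>r div 2\<close> and the output
  index \<open>r mod 2\<close>. The complex conjugate of the usual Choi state is used, because its factorization
  through the Kraus operators has the environment state as the reversed product.\<close>

definition eunit :: "nat \<Rightarrow> nat \<Rightarrow> complex mat" where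
  "eunit x y = mat 2 2 (\<lambda>(i,j). if i = x \<and> j = y then 1 else 0)"

definition choi :: "real mat \<Rightarrow> real vec \<Rightarrow> complex mat" where
  "choi R t = mat 4 4 (\<lambda>(r,s). cnj (stokes_map R t (eunit (r div 2) (s div 2)) $$ (r mod 2, s mod 2)) / 2)"

lemma choi_carrier [simp]: "choi R t \<in> carrier_mat 4 4"
  by (simp add: choi_def)

lemma eunit_carrier [simp]: "eunit x y \<in> carrier_mat 2 2"
  by (simp add: eunit_def)

lemma choi_index:
  "choi R t $$ (0,0) = (1 + R $$ (0,0) + t $ 0) / 4"
  "choi R t $$ (1,1) = (1 - R $$ (0,0) - t $ 0) / 4"
  "choi R t $$ (2,2) = (1 - R $$ (0,0) + t $ 0) / 4"
  "choi R t $$ (3,3) = (1 + R $$ (0,0) - t $ 0) / 4"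
  "choi R t $$ (0,1) = (R $$ (1,0) + t $ 1 + \<i> * (R $$ (2,0) + t $ 2)) / 4"
  "choi R t $$ (1,0) = (R $$ (1,0) + t $ 1 - \<i> * (R $$ (2,0) + t $ 2)) / 4"
  "choi R t $$ (2,3) = (- R $$ (1,0) + t $ 1 + \<i> * (- R $$ (2,0) + t $ 2)) / 4"
  "choi R t $$ (3,2) = (- R $$ (1,0) + t $ 1 - \<i> * (- R $$ (2,0) + t $ 2)) / 4"
  "choi R t $$ (0,2) = (R $$ (0,1) - \<i> * R $$ (0,2)) / 4"
  "choi R t $$ (2,0) = (R $$ (0,1) + \<i> * R $$ (0,2)) / 4"
  "choi R t $$ (1,3) = - (R $$ (0,1) - \<i> * R $$ (0,2)) / 4"
  "choi R t $$ (3,1) = - (R $$ (0,1) + \<i> * R $$ (0,2)) / 4"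
  "choi R t $$ (0,3) = (R $$ (1,1) - \<i> * R $$ (1,2) + \<i> * (R $$ (2,1) - \<i> * R $$ (2,2))) / 4"
  "choi R t $$ (3,0) = (R $$ (1,1) + \<i> * R $$ (1,2) - \<i> * (R $$ (2,1) + \<i> * R $$ (2,2))) / 4"
  "choi R t $$ (1,2) = (R $$ (1,1) - \<i> * R $$ (1,2) - \<i> * (R $$ (2,1) - \<i> * R $$ (2,2))) / 4"
  "choi R t $$ (2,1) = (R $$ (1,1) + \<i> * R $$ (1,2) + \<i> * (R $$ (2,1) + \<i> * R $$ (2,2))) / 4"
  by (simp_all add: choi_def stokes_map_index[OF eunit_carrier, unfolded One_nat_def],
      simp_all add: bloch_image_def eunit_def complex_eq_iff)

lemma stokes_map_choi:
  assumes M: "M \<in> carrier_mat 2 2" and ij: "i < 2" "j < 2"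
  shows "stokes_map R t M $$ (i,j) = (\<Sum>x<2. \<Sum>y<2. M $$ (x,y) * (2 * cnj (choi R t $$ (2 * x + i, 2 * y + j))))"
proof -
  have E: "2 * cnj (choi R t $$ (2 * x + i, 2 * y + j)) = stokes_map R t (eunit x y) $$ (i,j)" if "x < 2" "y < 2" for x y
  proof -
    have "2 * x + i < 4" "2 * y + j < 4" "(2 * x + i) div 2 = x" "(2 * y + j) div 2 = y"
      "(2 * x + i) mod 2 = i" "(2 * y + j) mod 2 = j"
      using that ij by auto
    then show ?thesis by (simp add: choi_def)
  qed
  have lin: "stokes_map R t M $$ (i,j) = (\<Sum>x<2. \<Sum>y<2. M $$ (x,y) * stokes_map R t (eunit x y) $$ (i,j))"
    using less_2_cases_nat[OF ij(1)] less_2_cases_nat[OF ij(2)]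
    unfolding sum_lessThan_2
    by (elim disjE; simp only: stokes_map_index[OF M] stokes_map_index[OF eunit_carrier] bloch_image_def;
        simp add: eunit_def; simp add: algebra_simps add_divide_distrib diff_divide_distrib)
  show ?thesis unfolding lin by (intro sum.cong refl) (simp add: E)
qed

text \<open>Vectorization in the index convention of \<open>choi\<close>: the column of
  \<open>K\<close> is the input index and the row is the output index.\<close>

definition kvec :: "complex mat \<Rightarrow> nat \<Rightarrow> complex" where
  "kvec K r = K $$ (r mod 2, r div 2)"

lemma kraus_conj_index:
  assumes K: "K \<in> carrier_mat 2 2" and M: "M \<in> carrier_mat 2 2" and ij: "i < 2" "j < 2"
  shows "(K * M * adj K) $$ (i,j) = (\<Sum>x<2. \<Sum>y<2. M $$ (x,y) * (K $$ (i,x) * cnj (K $$ (j,y))))"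
  unfolding mult_mat_index[OF mult_square_carrier[OF K M] adj_carrier[OF K] ij]
  using ij by (simp add: sum_lessThan_2 mult_mat_index[OF K M] adj_index[OF K] algebra_simps del: index_mult_mat)

lemma kraus_gram_index:
  assumes K: "K \<in> carrier_mat 2 2" and ij: "i < 2" "j < 2"
  shows "(adj K * K) $$ (i,j) = (\<Sum>a<2. cnj (K $$ (a,i)) * K $$ (a,j))"
  unfolding mult_mat_index[OF adj_carrier[OF K] K ij]
  using ij by (simp add: adj_index[OF K])

text \<open>By linearity it suffices to test the Kraus form on matrix units, where it says that the
  vectorized Kraus operators factor the Choi state.\<close>

lemma kraus_rep_iff_choi:
  "kraus_rep R t Ks \<longleftrightarrow> set Ks \<subseteq> carrier_mat 2 2 \<and>
     (\<forall>r<4. \<forall>s<4. (\<Sum>k<length Ks. cnj (kvec (Ks ! k) r) * kvec (Ks ! k) s) = 2 * choi R t $$ (r,s))"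
proof (intro iffI conjI)
  assume kr: "kraus_rep R t Ks"
  then show Ks: "set Ks \<subseteq> carrier_mat 2 2" by (simp add: kraus_rep_def)
  show "\<forall>r<4. \<forall>s<4. (\<Sum>k<length Ks. cnj (kvec (Ks ! k) r) * kvec (Ks ! k) s) = 2 * choi R t $$ (r,s)"
  proof (intro allI impI)
    fix r s :: nat assume rs: "r < 4" "s < 4"
    have K: "Ks ! k \<in> carrier_mat 2 2" if "k < length Ks" for k using Ks that by (meson nth_mem subsetD)
    have d: "r div 2 < 2" "s div 2 < 2" "r mod 2 < 2" "s mod 2 < 2" using rs by auto
    have "stokes_map R t (eunit (r div 2) (s div 2)) $$ (r mod 2, s mod 2)
      = (\<Sum>k<length Ks. (Ks ! k * eunit (r div 2) (s div 2) * adj (Ks ! k)) $$ (r mod 2, s mod 2))"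
      using kr d unfolding kraus_rep_def by simp
    also have "\<dots> = (\<Sum>k<length Ks. kvec (Ks ! k) r * cnj (kvec (Ks ! k) s))"
    proof (intro sum.cong refl)
      fix k assume "k \<in> {..<length Ks}"
      then have k: "k < length Ks" by simp
      show "(Ks ! k * eunit (r div 2) (s div 2) * adj (Ks ! k)) $$ (r mod 2, s mod 2) = kvec (Ks ! k) r * cnj (kvec (Ks ! k) s)"
        unfolding kraus_conj_index[OF K[OF k] eunit_carrier d(3,4)] kvec_def
        using less_2_cases_nat[OF d(1)] less_2_cases_nat[OF d(2)]
        by (elim disjE) (simp_all add: sum_lessThan_2 eunit_def)
    qed
    finally show "(\<Sum>k<length Ks. cnj (kvec (Ks ! k) r) * kvec (Ks ! k) s) = 2 * choi R t $$ (r,s)"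
      using rs by (simp add: choi_def)
  qed
next
  assume "set Ks \<subseteq> carrier_mat 2 2 \<and>
     (\<forall>r<4. \<forall>s<4. (\<Sum>k<length Ks. cnj (kvec (Ks ! k) r) * kvec (Ks ! k) s) = 2 * choi R t $$ (r,s))"
  then have Ks: "set Ks \<subseteq> carrier_mat 2 2"
    and C: "\<And>r s. r < 4 \<Longrightarrow> s < 4 \<Longrightarrow> (\<Sum>k<length Ks. cnj (kvec (Ks ! k) r) * kvec (Ks ! k) s) = 2 * choi R t $$ (r,s)"
    by auto
  have K: "Ks ! k \<in> carrier_mat 2 2" if "k < length Ks" for k using Ks that by (meson nth_mem subsetD)
  have C': "(\<Sum>k<length Ks. cnj (Ks ! k $$ (i,x)) * Ks ! k $$ (j,y)) = 2 * choi R t $$ (2 * x + i, 2 * y + j)"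
    if "x < 2" "y < 2" "i < 2" "j < 2" for x y i j
    using C[of "2 * x + i" "2 * y + j"] that by (simp add: kvec_def)
  show "kraus_rep R t Ks" unfolding kraus_rep_def
  proof (intro conjI Ks allI ballI impI)
    fix i j :: nat assume ij: "i < 2" "j < 2"
    have "(\<Sum>k<length Ks. (adj (Ks ! k) * Ks ! k) $$ (i,j)) = (\<Sum>a<2. \<Sum>k<length Ks. cnj (Ks ! k $$ (a,i)) * Ks ! k $$ (a,j))"
      by (subst sum.swap) (intro sum.cong refl, simp add: kraus_gram_index[OF K] ij del: index_mult_mat)
    also have "\<dots> = (\<Sum>a<2. 2 * choi R t $$ (2 * i + a, 2 * j + a))"
      by (intro sum.cong refl C') (use ij in auto)
    \<comment> \<open>Trace preservation is built into the Stokes form: the partial trace of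
      \<open>choi R t\<close> over the output is half the identity.\<close>
    also have "\<dots> = (if i = j then 1 else 0)"
      using less_2_cases_nat[OF ij(1)] less_2_cases_nat[OF ij(2)]
      by (elim disjE; simp add: sum_lessThan_2 choi_index[unfolded One_nat_def] numeral_3_eq_3[symmetric] numeral_2_eq_2[symmetric];
         simp add: field_simps)
    finally show "(\<Sum>k<length Ks. (adj (Ks ! k) * Ks ! k) $$ (i,j)) = (if i = j then 1 else 0)" .
  next
    fix M :: "complex mat" and i j :: nat assume M: "M \<in> carrier_mat 2 2" and ij: "i < 2" "j < 2"
    have "(\<Sum>k<length Ks. (Ks ! k * M * adj (Ks ! k)) $$ (i,j))
       = (\<Sum>k<length Ks. \<Sum>x<2. \<Sum>y<2. M $$ (x,y) * (Ks ! k $$ (i,x) * cnj (Ks ! k $$ (j,y))))"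
      by (intro sum.cong refl) (simp add: kraus_conj_index[OF K M ij] del: index_mult_mat assoc_mult_mat)
    also have "\<dots> = (\<Sum>x<2. \<Sum>y<2. \<Sum>k<length Ks. M $$ (x,y) * (Ks ! k $$ (i,x) * cnj (Ks ! k $$ (j,y))))"
      by (subst sum.swap, rule sum.cong[OF refl], subst sum.swap) simp
    also have "\<dots> = (\<Sum>x<2. \<Sum>y<2. M $$ (x,y) * cnj (\<Sum>k<length Ks. cnj (Ks ! k $$ (i,x)) * Ks ! k $$ (j,y)))"
      by (simp add: sum_distrib_left)
    also have "\<dots> = (\<Sum>x<2. \<Sum>y<2. M $$ (x,y) * (2 * cnj (choi R t $$ (2 * x + i, 2 * y + j))))"
      by (intro sum.cong refl) (simp add: C' ij)
    finally show "stokes_map R t M $$ (i,j) = (\<Sum>k<length Ks. (Ks ! k * M * adj (Ks ! k)) $$ (i,j))"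
      unfolding stokes_map_choi[OF M ij] by simp
  qed
qed

section \<open>Environment entropies through the Choi state\<close>

definition choi_block :: "real mat \<Rightarrow> real vec \<Rightarrow> nat \<Rightarrow> complex mat" where
  "choi_block R t x = mat 2 2 (\<lambda>(a,b). choi R t $$ (2 * x + a, 2 * x + b))"

lemma choi_block_carrier [simp]: "choi_block R t x \<in> carrier_mat 2 2"
  by (simp add: choi_block_def)

text \<open>A factor with two useful products: \<open>adj W * W\<close> is a diagonal block of the
  Choi state, while \<open>W * adj W\<close> is half an environment state. The division by
  \<open>sqrt 2\<close> splits the weight of the uniform input between the two factors.
  \<open>kraus_stack\<close> does the same for the whole Choi state.\<close>

definition kraus_block :: "complex mat list \<Rightarrow> nat \<Rightarrow> complex mat" where
  "kraus_block Ks x = mat (length Ks) 2 (\<lambda>(k,a). kvec (Ks ! k) (2 * x + a) / sqrt 2)"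

definition kraus_stack :: "complex mat list \<Rightarrow> complex mat" where
  "kraus_stack Ks = mat (length Ks) 4 (\<lambda>(k,r). kvec (Ks ! k) r / sqrt 2)"

lemma kraus_block_carrier [simp]: "kraus_block Ks x \<in> carrier_mat (length Ks) 2"
  and kraus_stack_carrier [simp]: "kraus_stack Ks \<in> carrier_mat (length Ks) 4"
  by (simp_all add: kraus_block_def kraus_stack_def)

lemma sqrt2_sqrt2: "complex_of_real (sqrt 2) * complex_of_real (sqrt 2) = 2"
  by (simp flip: of_real_mult)

lemma kraus_stack_gram:
  assumes "kraus_rep R t Ks"
  shows "adj (kraus_stack Ks) * kraus_stack Ks = choi R t"
proof (rule eq_matI)
  fix r s assume "r < dim_row (choi R t)" "s < dim_col (choi R t)"
  then have rs: "r < 4" "s < 4" by (auto simp: choi_def)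
  have "(adj (kraus_stack Ks) * kraus_stack Ks) $$ (r,s) = (\<Sum>k<length Ks. cnj (kvec (Ks ! k) r) * kvec (Ks ! k) s) / 2"
    unfolding mult_mat_index[OF adj_carrier[OF kraus_stack_carrier] kraus_stack_carrier rs] sum_divide_distrib
    using rs by (intro sum.cong refl) (simp add: adj_index[OF kraus_stack_carrier], simp add: kraus_stack_def sqrt2_sqrt2)
  then show "(adj (kraus_stack Ks) * kraus_stack Ks) $$ (r,s) = choi R t $$ (r,s)"
    using assms rs unfolding kraus_rep_iff_choi by simp
qed (auto simp: choi_def kraus_stack_def)

lemma kraus_block_gram:
  assumes "kraus_rep R t Ks" "x < 2"
  shows "adj (kraus_block Ks x) * kraus_block Ks x = choi_block R t x"
proof (rule eq_matI)
  fix a b assume "a < dim_row (choi_block R t x)" "b < dim_col (choi_block R t x)"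
  then have ab: "a < 2" "b < 2" by (auto simp: choi_block_def)
  have x: "2 * x + a < 4" "2 * x + b < 4" using assms(2) ab by auto
  have "(adj (kraus_block Ks x) * kraus_block Ks x) $$ (a,b)
     = (\<Sum>k<length Ks. cnj (kvec (Ks ! k) (2 * x + a)) * kvec (Ks ! k) (2 * x + b)) / 2"
    unfolding mult_mat_index[OF adj_carrier[OF kraus_block_carrier] kraus_block_carrier ab] sum_divide_distrib
    using ab by (intro sum.cong refl) (simp add: adj_index[OF kraus_block_carrier], simp add: kraus_block_def sqrt2_sqrt2)
  then show "(adj (kraus_block Ks x) * kraus_block Ks x) $$ (a,b) = choi_block R t x $$ (a,b)"
    using assms ab x unfolding kraus_rep_iff_choi by (simp add: choi_block_def)
qed (auto simp: choi_block_def kraus_block_def)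

lemma env_state_index:
  assumes Ks: "set Ks \<subseteq> carrier_mat 2 2" and ij: "i < length Ks" "j < length Ks" and x: "x < 2"
  shows "env_state Ks (ketbra x) $$ (i,j) = (\<Sum>a<2. kvec (Ks ! i) (2 * x + a) * cnj (kvec (Ks ! j) (2 * x + a)))"
proof -
  have K: "Ks ! k \<in> carrier_mat 2 2" if "k < length Ks" for k using Ks that by (meson nth_mem subsetD)
  have kb: "ketbra x \<in> carrier_mat 2 2" by (simp add: ketbra_def)
  have kx: "(Ks ! i * ketbra x) $$ (a,b) = (if b = x then Ks ! i $$ (a,x) else 0)" if "a < 2" "b < 2" for a b
    unfolding mult_mat_index[OF K[OF ij(1)] kb that] sum_lessThan_2
    using less_2_cases_nat[OF x] less_2_cases_nat[OF that(2)] by (elim disjE) (simp_all add: ketbra_def)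
  have "env_state Ks (ketbra x) $$ (i,j) = mtrace (Ks ! i * ketbra x * adj (Ks ! j))"
    using ij by (simp add: env_state_def)
  also have "\<dots> = (\<Sum>a<2. kvec (Ks ! i) (2 * x + a) * cnj (kvec (Ks ! j) (2 * x + a)))"
    unfolding mtrace_mult_2[OF mult_square_carrier[OF K[OF ij(1)] kb] adj_carrier[OF K[OF ij(2)]]]
    using x by (simp add: kx adj_index[OF K[OF ij(2)]] kvec_def sum_lessThan_2 del: index_mult_mat)
      (auto dest!: less_2_cases_nat)
  finally show ?thesis .
qed

text \<open>The environment and the Choi picture are reversed products of the same factors, so their
  entropies agree even though the environment dimension is the arbitrary number of Kraus
  operators.\<close>

lemma H_XE_choi:
  assumes kr: "kraus_rep R t Ks"
  shows "H_XE Ks = vn_entropy (choi_block R t 0) + vn_entropy (choi_block R t 1) - vn_entropy (choi R t)"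
proof -
  let ?m = "length Ks"
  have Ks: "set Ks \<subseteq> carrier_mat 2 2" using kr by (simp add: kraus_rep_def)
  have r: "(1/2) \<cdot>\<^sub>m env_state Ks (ketbra x) = kraus_block Ks x * adj (kraus_block Ks x)" if "x < 2" for x
  proof (rule eq_matI)
    fix i j assume "i < dim_row (kraus_block Ks x * adj (kraus_block Ks x))" "j < dim_col (kraus_block Ks x * adj (kraus_block Ks x))"
    then have ij: "i < ?m" "j < ?m" by (auto simp: kraus_block_def)
    show "((1/2) \<cdot>\<^sub>m env_state Ks (ketbra x)) $$ (i,j) = (kraus_block Ks x * adj (kraus_block Ks x)) $$ (i,j)"
      unfolding mult_mat_index[OF kraus_block_carrier adj_carrier[OF kraus_block_carrier] ij]
      using ij env_state_index[OF Ks ij that]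
      by (simp add: env_state_def adj_index[OF kraus_block_carrier] sum_lessThan_2,
          simp add: kraus_block_def sqrt2_sqrt2 add_divide_distrib)
  qed (auto simp: env_state_def kraus_block_def)
  have r01: "(1/2) \<cdot>\<^sub>m (env_state Ks (ketbra 0) + env_state Ks (ketbra 1)) = kraus_stack Ks * adj (kraus_stack Ks)"
  proof (rule eq_matI)
    fix i j assume "i < dim_row (kraus_stack Ks * adj (kraus_stack Ks))" "j < dim_col (kraus_stack Ks * adj (kraus_stack Ks))"
    then have ij: "i < ?m" "j < ?m" by (auto simp: kraus_stack_def)
    show "((1/2) \<cdot>\<^sub>m (env_state Ks (ketbra 0) + env_state Ks (ketbra 1))) $$ (i,j) = (kraus_stack Ks * adj (kraus_stack Ks)) $$ (i,j)"
      unfolding mult_mat_index[OF kraus_stack_carrier adj_carrier[OF kraus_stack_carrier] ij]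
      using ij env_state_index[OF Ks ij, of 0] env_state_index[OF Ks ij, of 1]
      by (simp add: env_state_def adj_index[OF kraus_stack_carrier] sum_lessThan_2 sum_lessThan_4,
          simp add: kraus_stack_def sqrt2_sqrt2 add_divide_distrib numeral_3_eq_3 numeral_2_eq_2)
  qed (auto simp: env_state_def kraus_stack_def)
  have r0: "(1/2) \<cdot>\<^sub>m env_state Ks (ketbra 0) = kraus_block Ks 0 * adj (kraus_block Ks 0)"
    and r1: "(1/2) \<cdot>\<^sub>m env_state Ks (ketbra 1) = kraus_block Ks 1 * adj (kraus_block Ks 1)"
    by (rule r, simp)+
  have "H_XE Ks = vn_entropy (kraus_block Ks 0 * adj (kraus_block Ks 0)) + vn_entropy (kraus_block Ks 1 * adj (kraus_block Ks 1))
     - vn_entropy (kraus_stack Ks * adj (kraus_stack Ks))"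
    unfolding H_XE_def Let_def r01 r0 r1
    by (subst vn_entropy_lower_block) (auto intro!: mult_carrier_mat[of _ _ 2])
  then show ?thesis
    unfolding vn_entropy_mult_commute[OF kraus_block_carrier adj_carrier[OF kraus_block_carrier]]
      vn_entropy_mult_commute[OF kraus_stack_carrier adj_carrier[OF kraus_stack_carrier]]
      kraus_stack_gram[OF kr] using kraus_block_gram[OF kr, of 0] kraus_block_gram[OF kr, of 1] by simp
qed

text \<open>Removes the choice of Kraus operators from \<open>Kkey\<close>: the right-hand side
  depends on the Stokes parameters alone.\<close>

lemma Kkey_choi:
  assumes "qubit_channel R t"
  shows "Kkey R t = vn_entropy (choi_block R t 0) + vn_entropy (choi_block R t 1) - vn_entropy (choi R t) - H_XY R t"
proof -
  have "kraus_rep R t (SOME Ks. kraus_rep R t Ks)"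
    using assms unfolding qubit_channel_def by (blast intro: someI_ex)
  from H_XE_choi[OF this] show ?thesis unfolding Kkey_def by simp
qed

section \<open>Entropy compared with diagonals and with known spectral projections\<close>

lemma unitary_conj_diag:
  assumes "unitary_mat n V" "A = V * diagr n q * adj V"
  shows "adj V * A * V = diagr n q"
proof -
  note V = unitary_matD[OF assms(1)]
  have "adj V * A * V = (adj V * V) * diagr n q * (adj V * V)"
    unfolding assms(2) using V(1) adj_carrier[OF V(1)] by (simp add: assoc_mult_mat[of _ n n _ n _ n])
  then show ?thesis unfolding V(2) by simp
qed

text \<open>The diagonal is the spectrum averaged by the doubly stochastic matrix of squared moduli
  of \<open>U\<close>; concavity of \<open>eta\<close> does the rest.\<close>

lemma psd_entropy_le_diag:
  assumes W: "W \<in> carrier_mat m n"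
  shows "vn_entropy (adj W * W) \<le> (\<Sum>i<n. eta (Re ((adj W * W) $$ (i,i))))"
proof -
  obtain U p where uU: "unitary_mat n U" and D: "adj W * W = U * diagr n p * adj U"
    and p: "\<And>i. i < n \<Longrightarrow> 0 \<le> p i" and vn: "vn_entropy (adj W * W) = (\<Sum>i<n. eta (p i))"
    using psd_diagonalization[OF W] by blast
  note U = unitary_matD[OF uU]
  have "vn_entropy (adj W * W) = (\<Sum>k<n. (\<Sum>i<n. (cmod (U $$ (i,k)))\<^sup>2) * eta (p k))"
    unfolding vn by (intro sum.cong refl) (simp add: unitary_mat_col_norm[OF uU])
  also have "\<dots> = (\<Sum>i<n. \<Sum>k<n. (cmod (U $$ (i,k)))\<^sup>2 * eta (p k))"
    unfolding sum_distrib_right by (rule sum.swap)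
  also have "\<dots> \<le> (\<Sum>i<n. eta (\<Sum>k<n. (cmod (U $$ (i,k)))\<^sup>2 * p k))"
    by (intro sum_mono eta_jensen) (auto simp: unitary_mat_row_norm[OF uU] p)
  also have "\<dots> = (\<Sum>i<n. eta (Re ((adj W * W) $$ (i,i))))"
  proof (intro sum.cong refl arg_cong[where f = eta])
    fix i assume "i \<in> {..<n}"
    then have i: "i < n" by simp
    have "(adj W * W) $$ (i,i) = of_real (\<Sum>k<n. (cmod (U $$ (i,k)))\<^sup>2 * p k)"
      unfolding D unitary_diag_index[OF U(1) i i] of_real_sum of_real_mult complex_norm_square
      by (intro sum.cong refl) (simp add: mult_ac)
    then show "(\<Sum>k<n. (cmod (U $$ (i,k)))\<^sup>2 * p k) = Re ((adj W * W) $$ (i,i))" by simp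
  qed
  finally show ?thesis .
qed

text \<open>Relates a spectral decomposition found by hand to the abstract eigenvalues without
  computing a characteristic polynomial. This direction is the one that bounds \<open>Kkey\<close>
  from above, where the Choi entropy enters negatively.\<close>

lemma psd_entropy_ge_projections:
  fixes N :: nat
  assumes W: "W \<in> carrier_mat m n" and Pr: "\<And>l. l < N \<Longrightarrow> Pr l \<in> carrier_mat n n"
    and dec: "\<And>r s. r < n \<Longrightarrow> s < n \<Longrightarrow> (adj W * W) $$ (r,s) = (\<Sum>l<N. of_real (lam l) * Pr l $$ (r,s))"
    and proj: "\<And>l. l < N \<Longrightarrow> adj (Pr l) * Pr l = Pr l"
    and one: "\<And>r s. r < n \<Longrightarrow> s < n \<Longrightarrow> (\<Sum>l<N. Pr l $$ (r,s)) = (if r = s then 1 else 0)"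
    and tr: "\<And>l. l < N \<Longrightarrow> (\<Sum>r<n. Pr l $$ (r,r)) = 1"
    and lam: "\<And>l. l < N \<Longrightarrow> 0 \<le> lam l"
  shows "(\<Sum>l<N. eta (lam l)) \<le> vn_entropy (adj W * W)"
proof -
  obtain U p where uU: "unitary_mat n U" and D: "adj W * W = U * diagr n p * adj U"
    and vn: "vn_entropy (adj W * W) = (\<Sum>i<n. eta (p i))"
    using psd_diagonalization[OF W] by blast
  note U = unitary_matD[OF uU]
  define Q where "Q M i = (\<Sum>r<n. \<Sum>s<n. cnj (U $$ (r,i)) * M $$ (r,s) * U $$ (s,i))" for M :: "complex mat" and i
  have Q: "(adj U * M * U) $$ (i,i) = Q M i" if M: "M \<in> carrier_mat n n" and i: "i < n" for M i
  proof -
    have "(adj U * M * U) $$ (i,i) = (\<Sum>s<n. \<Sum>r<n. cnj (U $$ (r,i)) * M $$ (r,s) * U $$ (s,i))"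
      using M U(1) i adj_carrier[OF U(1)]
      by (simp add: mult_mat_index[of "adj U * M" n n U n] mult_mat_index[of "adj U" n n M n] adj_index[OF U(1)]
          sum_distrib_right del: assoc_mult_mat index_mult_mat)
    then show ?thesis unfolding Q_def by (subst sum.swap)
  qed
  have A: "adj W * W \<in> carrier_mat n n" unfolding D using U(1) by simp
  have Qtr: "(\<Sum>i<n. Q M i) = (\<Sum>r<n. M $$ (r,r))" if M: "M \<in> carrier_mat n n" for M
  proof -
    have UU: "(\<Sum>i<n. U $$ (s,i) * cnj (U $$ (r,i))) = (if s = r then 1 else 0)" if "r < n" "s < n" for r s
    proof -
      have "(U * adj U) $$ (s,r) = (\<Sum>i<n. U $$ (s,i) * cnj (U $$ (r,i)))"
        unfolding mult_mat_index[OF U(1) adj_carrier[OF U(1)] that(2) that(1)]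
        using that by (simp add: adj_index[OF U(1)])
      then show ?thesis unfolding U(3) using that by simp
    qed
    have "(\<Sum>i<n. Q M i) = (\<Sum>r<n. \<Sum>s<n. M $$ (r,s) * (\<Sum>i<n. U $$ (s,i) * cnj (U $$ (r,i))))"
      unfolding Q_def sum_distrib_left
      by (subst sum.swap, rule sum.cong[OF refl], subst sum.swap) (simp add: mult_ac)
    also have "\<dots> = (\<Sum>r<n. \<Sum>s<n. M $$ (r,s) * (if s = r then 1 else 0))"
      by (intro sum.cong refl) (simp add: UU)
    finally show ?thesis by (simp add: if_distrib[of "\<lambda>x. _ * x"] cong: if_cong)
  qed
  \<comment> \<open>The overlap of eigenvector \<open>i\<close> with projection \<open>l\<close>. It
    is doubly stochastic: the projections sum to the identity and each has trace 1.\<close>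
  define d where "d i l = Re (Q (Pr l) i)" for i l
  have dQ: "Q (Pr l) i = of_real (d i l) \<and> 0 \<le> d i l" if l: "l < N" and i: "i < n" for l i
  proof -
    have PU: "Pr l * U \<in> carrier_mat n n" using Pr[OF l] U(1) by simp
    have "adj (Pr l * U) * (Pr l * U) = adj U * (adj (Pr l) * Pr l) * U"
      unfolding adj_mult[OF Pr[OF l] U(1)] using Pr[OF l] U(1) by (simp add: assoc_mult_mat[of _ n n _ n _ n])
    then have "Q (Pr l) i = (adj (Pr l * U) * (Pr l * U)) $$ (i,i)"
      unfolding proj[OF l] using Q[OF Pr[OF l] i] by simp
    also have "\<dots> = of_real (\<Sum>k<n. (cmod ((Pr l * U) $$ (k,i)))\<^sup>2)"
      by (rule gram_diag_index[OF PU i])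
    finally have "Q (Pr l) i = of_real (\<Sum>k<n. (cmod ((Pr l * U) $$ (k,i)))\<^sup>2)" .
    then show ?thesis unfolding d_def by (simp add: sum_nonneg del: index_mult_mat)
  qed
  have d1: "(\<Sum>l<N. d i l) = 1" if i: "i < n" for i
  proof -
    have "(\<Sum>l<N. Q (Pr l) i) = (\<Sum>r<n. \<Sum>s<n. cnj (U $$ (r,i)) * (\<Sum>l<N. Pr l $$ (r,s)) * U $$ (s,i))"
      unfolding Q_def sum_distrib_left sum_distrib_right
      by (subst sum.swap, rule sum.cong[OF refl], subst sum.swap) simp
    also have "\<dots> = (\<Sum>r<n. \<Sum>s<n. if r = s then cnj (U $$ (r,i)) * U $$ (s,i) else 0)"
      by (intro sum.cong refl) (simp add: one)
    also have "\<dots> = of_real (\<Sum>r<n. (cmod (U $$ (r,i)))\<^sup>2)"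
      unfolding of_real_sum complex_norm_square by (simp add: mult.commute)
    also have "\<dots> = 1" unfolding unitary_mat_col_norm[OF uU i] by simp
    finally show ?thesis unfolding d_def by (simp flip: Re_sum)
  qed
  have d2: "(\<Sum>i<n. d i l) = 1" if l: "l < N" for l
    using Qtr[OF Pr[OF l]] tr[OF l] unfolding d_def by (simp flip: Re_sum)
  have p: "p i = (\<Sum>l<N. d i l * lam l)" if i: "i < n" for i
  proof -
    have "complex_of_real (p i) = Q (adj W * W) i"
      unfolding Q[OF A i, symmetric] unitary_conj_diag[OF uU D] using i by (simp add: diagr_def)
    also have "\<dots> = (\<Sum>r<n. \<Sum>s<n. \<Sum>l<N. of_real (lam l) * (cnj (U $$ (r,i)) * Pr l $$ (r,s) * U $$ (s,i)))"
      unfolding Q_def by (intro sum.cong refl) (simp add: dec sum_distrib_left sum_distrib_right mult_ac del: index_mult_mat)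
    also have "\<dots> = (\<Sum>l<N. of_real (lam l) * Q (Pr l) i)"
    proof -
      have "(\<Sum>r<n. \<Sum>s<n. \<Sum>l<N. f r s l) = (\<Sum>l<N. \<Sum>r<n. \<Sum>s<n. f r s l)" for f :: "nat \<Rightarrow> nat \<Rightarrow> nat \<Rightarrow> complex"
      proof -
        have "(\<Sum>r<n. \<Sum>s<n. \<Sum>l<N. f r s l) = (\<Sum>r<n. \<Sum>l<N. \<Sum>s<n. f r s l)"
          by (intro sum.cong refl sum.swap)
        then show ?thesis by (simp add: sum.swap[of _ "{..<N}"])
      qed
      then show ?thesis unfolding Q_def sum_distrib_left .
    qed
    also have "\<dots> = of_real (\<Sum>l<N. d i l * lam l)"
      using i dQ unfolding of_real_sum by (intro sum.cong refl) (simp add: mult.commute)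
    finally show ?thesis by (simp only: of_real_eq_iff)
  qed
  have "(\<Sum>l<N. eta (lam l)) = (\<Sum>l<N. (\<Sum>i<n. d i l) * eta (lam l))"
    by (intro sum.cong refl) (simp add: d2)
  also have "\<dots> = (\<Sum>i<n. \<Sum>l<N. d i l * eta (lam l))"
    unfolding sum_distrib_right by (rule sum.swap)
  also have "\<dots> \<le> (\<Sum>i<n. eta (\<Sum>l<N. d i l * lam l))"
    using dQ d1 lam by (intro sum_mono eta_jensen) auto
  also have "\<dots> = vn_entropy (adj W * W)" unfolding vn by (intro sum.cong refl) (simp add: p)
  finally show ?thesis .
qed

lemma adj_block_diag:
  assumes "A \<in> carrier_mat n n" "D \<in> carrier_mat m m"
  shows "adj (four_block_mat A (0\<^sub>m n m) (0\<^sub>m m n) D) = four_block_mat (adj A) (0\<^sub>m n m) (0\<^sub>m m n) (adj D)"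
  using assms by (intro eq_matI) (auto simp: adj_def)

lemma block_diag_conj:
  assumes V: "V0 \<in> carrier_mat 2 2" "V1 \<in> carrier_mat 2 2"
    and A: "A \<in> carrier_mat 2 2" "B \<in> carrier_mat 2 2" "C \<in> carrier_mat 2 2" "D \<in> carrier_mat 2 2"
  defines "V \<equiv> four_block_mat V0 (0\<^sub>m 2 2) (0\<^sub>m 2 2) V1"
  shows "adj V * four_block_mat A B C D * V
    = four_block_mat (adj V0 * A * V0) (adj V0 * B * V1) (adj V1 * C * V0) (adj V1 * D * V1)"
proof -
  note z = left_mult_zero_mat[of _ 2 2] right_mult_zero_mat[of _ 2 2]
  have "adj V * four_block_mat A B C D = four_block_mat (adj V0 * A) (adj V0 * B) (adj V1 * C) (adj V1 * D)"
    unfolding V_def adj_block_diag[OF V] using V A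
    by (subst mult_four_block_mat[of _ 2 2 _ 2 _ 2 _ _ 2 _ 2]) (auto simp: z)
  then show ?thesis unfolding V_def using V A
    by (simp only:) (subst mult_four_block_mat[of _ 2 2 _ 2 _ 2 _ _ 2 _ 2]; simp add: z)
qed

text \<open>The basis \<open>V\<close> diagonalizes both diagonal blocks of the Choi state, so
  \<open>q\<close> lists the pinched spectrum. Since \<open>G\<close> exchanges the two inputs, its
  diagonal vanishes in every block diagonal basis.\<close>

lemma conditional_entropy_lower_bound:
  assumes ch: "qubit_channel R t" and w: "wz\<^sup>2 + wx\<^sup>2 = 1"
  shows "1 - hbin (wz * R $$ (0,1) + wx * R $$ (1,1))
    \<le> vn_entropy (choi_block R t 0) + vn_entropy (choi_block R t 1) - vn_entropy (choi R t)"
proof -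
  obtain Ks where kr: "kraus_rep R t Ks" using ch by (auto simp: qubit_channel_def)
  obtain U p where uU: "unitary_mat 4 U" and rho: "choi R t = U * diagr 4 p * adj U"
    and p: "\<And>i. i < 4 \<Longrightarrow> 0 \<le> p i" and vn: "vn_entropy (choi R t) = (\<Sum>i<4. eta (p i))"
    using psd_diagonalization[OF kraus_stack_carrier[of Ks]] unfolding kraus_stack_gram[OF kr] by blast
  have "\<exists>V q. unitary_mat 2 V \<and> choi_block R t x = V * diagr 2 q * adj V
     \<and> vn_entropy (choi_block R t x) = (\<Sum>i<2. eta (q i))" if "x < 2" for x
    using psd_diagonalization[OF kraus_block_carrier[of Ks x]] unfolding kraus_block_gram[OF kr that] by blast
  from this[of 0] this[of 1] obtain V0 q0 V1 q1 where
    uV0: "unitary_mat 2 V0" and b0: "choi_block R t 0 = V0 * diagr 2 q0 * adj V0"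
    and vn0: "vn_entropy (choi_block R t 0) = (\<Sum>i<2. eta (q0 i))"
    and uV1: "unitary_mat 2 V1" and b1: "choi_block R t 1 = V1 * diagr 2 q1 * adj V1"
    and vn1: "vn_entropy (choi_block R t 1) = (\<Sum>i<2. eta (q1 i))" by auto
  note V0 = unitary_matD[OF uV0] and V1 = unitary_matD[OF uV1]
  define V where "V = four_block_mat V0 (0\<^sub>m 2 2) (0\<^sub>m 2 2) V1"
  have uV: "unitary_mat 4 V" using unitary_mat_block[OF uV0 uV1] by (simp add: V_def)
  define q where "q j = (if j < 2 then q0 j else q1 (j - 2))" for j
  \<comment> \<open>The output observable with direction \<open>(wz, wx)\<close>. It has real
    entries, so the complex conjugation in \<open>choi\<close> does not affect it.\<close>
  define Wm :: "complex mat" where "Wm = mat 2 2 (\<lambda>(i,j). if i = j then (if i = 0 then wz else - wz) else wx)"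
  have Wm: "Wm \<in> carrier_mat 2 2" by (simp add: Wm_def)
  define G where "G = four_block_mat (0\<^sub>m 2 2) Wm Wm (0\<^sub>m 2 2)"
  have w': "complex_of_real wz * complex_of_real wz + complex_of_real wx * complex_of_real wx = 1"
    using w unfolding power2_eq_square by (simp flip: of_real_mult of_real_add)
  have WW: "Wm * Wm = 1\<^sub>m 2"
  proof (rule eq_matI)
    fix i j assume "i < dim_row (1\<^sub>m 2 :: complex mat)" "j < dim_col (1\<^sub>m 2 :: complex mat)"
    then have ij: "i < 2" "j < 2" by auto
    show "(Wm * Wm) $$ (i,j) = 1\<^sub>m 2 $$ (i,j)"
      unfolding mult_mat_index[OF Wm Wm ij] sum_lessThan_2
      using less_2_cases_nat[OF ij(1)] less_2_cases_nat[OF ij(2)] w'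
      by (elim disjE) (simp_all add: Wm_def add.commute)
  qed (use Wm in auto)
  have aW: "adj Wm = Wm" by (rule eq_matI) (auto simp: Wm_def adj_def)
  have aG: "adj G = G"
  proof -
    have "adj G = four_block_mat (0\<^sub>m 2 2) (adj Wm) (adj Wm) (0\<^sub>m 2 2)"
      unfolding G_def using Wm by (intro eq_matI) (auto simp: adj_def)
    then show ?thesis by (simp add: aW G_def)
  qed
  have "G * G = 1\<^sub>m 4" unfolding G_def using Wm WW
    by (subst mult_four_block_mat[of _ 2 2 _ 2 _ 2 _ _ 2 _ 2]) (auto simp: left_mult_zero_mat[of _ 2 2])
  moreover have "G \<in> carrier_mat 4 4" unfolding G_def using four_block_carrier_mat[of "0\<^sub>m 2 2" 2 2 "0\<^sub>m 2 2" 2 2 Wm Wm] by simp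
  ultimately have uG: "unitary_mat 4 G" by (simp add: unitary_mat_def aG)
  define C where "C = mat 2 2 (\<lambda>(i,j). choi R t $$ (i, 2 + j))"
  define C' where "C' = mat 2 2 (\<lambda>(i,j). choi R t $$ (2 + i, j))"
  have blk: "choi R t = four_block_mat (choi_block R t 0) C C' (choi_block R t 1)"
    proof -
    have "i div 2 = 1" "i mod 2 = i - 2" if "\<not> i < 2" "i < 4" for i :: nat using that by presburger+
    then show ?thesis by (intro eq_matI) (auto simp: choi_block_def C_def C'_def choi_def)
  qed
  have pin: "adj V * choi R t * V = four_block_mat (diagr 2 q0) (adj V0 * C * V1) (adj V1 * C' * V0) (diagr 2 q1)"
    unfolding blk V_def
    by (subst block_diag_conj) (use V0 V1 in \<open>simp_all add: C_def C'_def unitary_conj_diag[OF uV0 b0] unitary_conj_diag[OF uV1 b1, unfolded One_nat_def]\<close>)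
  have pinG: "adj V * G * V = four_block_mat (0\<^sub>m 2 2) (adj V0 * Wm * V1) (adj V1 * Wm * V0) (0\<^sub>m 2 2)"
    unfolding G_def V_def
    by (subst block_diag_conj) (use V0(1) V1(1) Wm in \<open>simp_all add: right_mult_zero_mat[of _ 2 2] left_mult_zero_mat[of _ 2 2]\<close>)
  have "(\<Sum>i<4. eta (p i)) \<le> (\<Sum>j<4. eta (q j)) - (1 - hbin (wz * R $$ (0,1) + wx * R $$ (1,1)))"
  proof (rule pinched_entropy_bound_mat[OF uU uV uG p _ rho])
    have "complex_of_real (\<Sum>i<4. p i) = (\<Sum>i<4. choi R t $$ (i,i))"
      unfolding rho unitary_diag_trace[OF uU] ..
    also have "\<dots> = complex_of_real 1"
      unfolding sum_lessThan_4 choi_index by (simp add: field_simps)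
    finally show "(\<Sum>i<4. p i) = 1" by (simp only: of_real_eq_iff)
  next
    fix j :: nat assume "j < 4"
    then show "(adj V * choi R t * V) $$ (j,j) = complex_of_real (q j)"
      unfolding pin by (auto simp: q_def diagr_def)
    show "(adj V * G * V) $$ (j,j) = 0" using \<open>j < 4\<close> unfolding pinG by auto
  next
    show "wz * R $$ (0,1) + wx * R $$ (1,1) = Re (\<Sum>r<4. \<Sum>s<4. G $$ (r,s) * choi R t $$ (s,r))"
      unfolding sum_lessThan_4 choi_index
      by (simp add: G_def Wm_def) (simp add: choi_index[unfolded One_nat_def] field_simps)
  qed
  moreover have "(\<Sum>j<4. eta (q j)) = (\<Sum>i<2. eta (q0 i)) + (\<Sum>i<2. eta (q1 i))"
    by (simp add: sum_lessThan_2 sum_lessThan_4 q_def)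
  ultimately show ?thesis unfolding vn vn0 vn1 by simp
qed

section \<open>Bounds on the key rate\<close>

lemma choi_trace: "(\<Sum>i<4. choi R t $$ (i,i)) = 1"
  unfolding sum_lessThan_4 choi_index by (simp add: field_simps)

lemma choi_psd:
  assumes "qubit_channel R t"
  obtains m W where "W \<in> carrier_mat m 4" "adj W * W = choi R t"
  using assms kraus_stack_gram unfolding qubit_channel_def by (metis kraus_stack_carrier)

lemma qubit_channel_of_choi:
  assumes R: "R \<in> carrier_mat 3 3" "t \<in> carrier_vec 3"
    and T: "T \<in> carrier_mat 4 4" "adj T * T = choi R t"
  shows "qubit_channel R t"
proof -
  \<comment> \<open>The Kraus operators are the rows of \<open>T\<close> read back as matrices;
    \<open>sqrt 2\<close> undoes the normalization of the Choi state.\<close>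
  define Ks where "Ks = map (\<lambda>k. mat 2 2 (\<lambda>(i,x). sqrt 2 * T $$ (k, 2 * x + i))) [0..<4]"
  have len: "length Ks = 4" by (simp add: Ks_def)
  have kv: "kvec (Ks ! k) r = sqrt 2 * T $$ (k,r)" if "k < 4" "r < 4" for k r
  proof -
    have "r mod 2 < 2" "r div 2 < 2" "2 * (r div 2) + r mod 2 = r" using that by auto
    then show ?thesis using that by (simp add: kvec_def Ks_def)
  qed
  have "kraus_rep R t Ks" unfolding kraus_rep_iff_choi
  proof (intro conjI allI impI)
    show "set Ks \<subseteq> carrier_mat 2 2" by (auto simp: Ks_def)
    fix r s :: nat assume rs: "r < 4" "s < 4"
    have "(\<Sum>k<length Ks. cnj (kvec (Ks ! k) r) * kvec (Ks ! k) s) = (\<Sum>k<4. 2 * (cnj (T $$ (k,r)) * T $$ (k,s)))"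
      unfolding len
    proof (intro sum.cong refl)
      fix k :: nat assume "k \<in> {..<4}"
      then show "cnj (kvec (Ks ! k) r) * kvec (Ks ! k) s = 2 * (cnj (T $$ (k,r)) * T $$ (k,s))"
        using rs by (simp add: kv) (simp add: sqrt2_sqrt2 mult_ac flip: mult.assoc[of "complex_of_real (sqrt 2)" "complex_of_real (sqrt 2)"])
    qed
    also have "\<dots> = 2 * (adj T * T) $$ (r,s)"
      unfolding mult_mat_index[OF adj_carrier[OF T(1)] T(1) rs] sum_distrib_left
      using rs by (intro sum.cong refl) (simp add: adj_index[OF T(1)])
    finally show "(\<Sum>k<length Ks. cnj (kvec (Ks ! k) r) * kvec (Ks ! k) s) = 2 * choi R t $$ (r,s)"
      unfolding T(2) .
  qed
  then show ?thesis using R unfolding qubit_channel_def by blast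
qed

section \<open>Tensor products of Pauli observables\<close>

definition kron2 :: "complex mat \<Rightarrow> complex mat \<Rightarrow> complex mat" where
  "kron2 A B = mat 4 4 (\<lambda>(r,s). A $$ (r div 2, s div 2) * B $$ (r mod 2, s mod 2))"

lemma kron2_carrier [simp]: "kron2 A B \<in> carrier_mat 4 4"
  by (simp add: kron2_def)

lemma kron2_mult:
  assumes AC: "A \<in> carrier_mat 2 2" "C \<in> carrier_mat 2 2" and BD: "B \<in> carrier_mat 2 2" "D \<in> carrier_mat 2 2"
  shows "kron2 A B * kron2 C D = kron2 (A * C) (B * D)"
proof (rule eq_matI)
  fix r s assume "r < dim_row (kron2 (A * C) (B * D))" "s < dim_col (kron2 (A * C) (B * D))"
  then have rs: "r < 4" "s < 4" by (auto simp: kron2_def)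
  have d: "r div 2 < 2" "s div 2 < 2" "r mod 2 < 2" "s mod 2 < 2" using rs by auto
  have "(kron2 A B * kron2 C D) $$ (r,s) = (A * C) $$ (r div 2, s div 2) * (B * D) $$ (r mod 2, s mod 2)"
    unfolding mult_mat_index[OF kron2_carrier kron2_carrier rs] mult_mat_index[OF AC d(1,2)]
      mult_mat_index[OF BD d(3,4)] sum_lessThan_2 sum_lessThan_4
    using rs by (simp add: kron2_def algebra_simps)
  then show "(kron2 A B * kron2 C D) $$ (r,s) = kron2 (A * C) (B * D) $$ (r,s)"
    using rs by (simp add: kron2_def)
qed (auto simp: kron2_def)

lemma kron2_adj:
  assumes A: "A \<in> carrier_mat 2 2" and B: "B \<in> carrier_mat 2 2"
  shows "adj (kron2 A B) = kron2 (adj A) (adj B)"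
proof (rule eq_matI)
  fix r s assume "r < dim_row (kron2 (adj A) (adj B))" "s < dim_col (kron2 (adj A) (adj B))"
  then have rs: "r < 4" "s < 4" by (auto simp: kron2_def)
  have d: "r div 2 < 2" "s div 2 < 2" "r mod 2 < 2" "s mod 2 < 2" using rs by auto
  show "adj (kron2 A B) $$ (r,s) = kron2 (adj A) (adj B) $$ (r,s)"
    unfolding adj_index[OF kron2_carrier rs]
    using rs by (simp add: kron2_def adj_index[OF A d(1,2)] adj_index[OF B d(3,4)])
qed (auto simp: kron2_def)

lemma kron2_one: "kron2 (1\<^sub>m 2) (1\<^sub>m 2) = 1\<^sub>m 4"
proof (rule eq_matI)
  fix r s assume "r < dim_row (1\<^sub>m 4 :: complex mat)" "s < dim_col (1\<^sub>m 4 :: complex mat)"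
  then have rs: "r < 4" "s < 4" by auto
  have d: "r div 2 < 2" "s div 2 < 2" "r mod 2 < 2" "s mod 2 < 2" using rs by auto
  have "r = s \<longleftrightarrow> r div 2 = s div 2 \<and> r mod 2 = s mod 2" by presburger
  then show "kron2 (1\<^sub>m 2) (1\<^sub>m 2) $$ (r,s) = 1\<^sub>m 4 $$ (r,s)"
    using rs by (auto simp: kron2_def d)
qed (auto simp: kron2_def)

text \<open>The observable of direction v, that is, v0 sigma_z + v1 sigma_x + v2 sigma_y.\<close>

definition psig :: "real \<Rightarrow> real \<Rightarrow> real \<Rightarrow> complex mat" where
  "psig v0 v1 v2 = mat 2 2 (\<lambda>(i,j). if i = j then (if i = 0 then v0 else - v0)
     else (if i = 0 then v1 - \<i> * v2 else v1 + \<i> * v2))"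

lemma psig_carrier [simp]: "psig v0 v1 v2 \<in> carrier_mat 2 2"
  by (simp add: psig_def)

lemma psig_index:
  "psig v0 v1 v2 $$ (0,0) = v0" "psig v0 v1 v2 $$ (0,1) = v1 - \<i> * v2"
  "psig v0 v1 v2 $$ (1,0) = v1 + \<i> * v2" "psig v0 v1 v2 $$ (1,1) = - v0"
  by (simp_all add: psig_def)

lemma psig_adj: "adj (psig v0 v1 v2) = psig v0 v1 v2"
  by (rule eq_matI) (auto simp: psig_def adj_def)

text \<open>Entrywise form of (v . sigma)(w . sigma) = v . w + i (v x w) . sigma, from which unit
  vectors give involutions and orthogonal vectors anticommute.\<close>

lemma psig_mult_index:
  "(psig v0 v1 v2 * psig w0 w1 w2) $$ (0,0) = of_real (v0 * w0 + v1 * w1 + v2 * w2) + \<i> * of_real (v1 * w2 - v2 * w1)"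
  "(psig v0 v1 v2 * psig w0 w1 w2) $$ (0,1) = of_real (v0 * w1 - v1 * w0) - \<i> * of_real (v0 * w2 - v2 * w0)"
  "(psig v0 v1 v2 * psig w0 w1 w2) $$ (1,0) = - of_real (v0 * w1 - v1 * w0) - \<i> * of_real (v0 * w2 - v2 * w0)"
  "(psig v0 v1 v2 * psig w0 w1 w2) $$ (1,1) = of_real (v0 * w0 + v1 * w1 + v2 * w2) - \<i> * of_real (v1 * w2 - v2 * w1)"
  by (subst mult_mat_index[OF psig_carrier psig_carrier]; (simp only: sum_lessThan_2 psig_index)?;
      simp add: complex_eq_iff algebra_simps)+

lemma psig_square:
  assumes "v0\<^sup>2 + v1\<^sup>2 + v2\<^sup>2 = 1"
  shows "psig v0 v1 v2 * psig v0 v1 v2 = 1\<^sub>m 2"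
proof (rule eq_matI)
  have v: "v0 * v0 + v1 * v1 + v2 * v2 = 1" using assms by (simp add: power2_eq_square)
  fix i j assume "i < dim_row (1\<^sub>m 2 :: complex mat)" "j < dim_col (1\<^sub>m 2 :: complex mat)"
  then have ij: "i < 2" "j < 2" by auto
  show "(psig v0 v1 v2 * psig v0 v1 v2) $$ (i,j) = 1\<^sub>m 2 $$ (i,j)"
    using less_2_cases_nat[OF ij(1)] less_2_cases_nat[OF ij(2)]
    by (elim disjE; hypsubst; simp only: psig_mult_index v; simp)
qed (auto simp: psig_def)

lemma psig_anticommute:
  assumes "v0 * w0 + v1 * w1 + v2 * w2 = 0"
  shows "psig v0 v1 v2 * psig w0 w1 w2 = - (psig w0 w1 w2 * psig v0 v1 v2)"
proof (rule eq_matI)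
  have w: "w0 * v0 + w1 * v1 + w2 * v2 = 0" using assms by (simp add: mult.commute)
  fix i j assume "i < dim_row (- (psig w0 w1 w2 * psig v0 v1 v2))" "j < dim_col (- (psig w0 w1 w2 * psig v0 v1 v2))"
  then have ij: "i < 2" "j < 2" by (auto simp: psig_def)
  have "(psig v0 v1 v2 * psig w0 w1 w2) $$ (i,j) = - ((psig w0 w1 w2 * psig v0 v1 v2) $$ (i,j))"
    using less_2_cases_nat[OF ij(1)] less_2_cases_nat[OF ij(2)]
    by (elim disjE; hypsubst; simp only: psig_mult_index w assms; simp add: algebra_simps)
  then show "(psig v0 v1 v2 * psig w0 w1 w2) $$ (i,j) = (- (psig w0 w1 w2 * psig v0 v1 v2)) $$ (i,j)"
    using ij by (simp add: psig_def del: index_mult_mat(1))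
qed (auto simp: psig_def)

lemma kron2_psig_square:
  assumes "v0\<^sup>2 + v1\<^sup>2 + v2\<^sup>2 = 1" "w0\<^sup>2 + w1\<^sup>2 + w2\<^sup>2 = 1"
  shows "kron2 (psig v0 v1 v2) (psig w0 w1 w2) * kron2 (psig v0 v1 v2) (psig w0 w1 w2) = 1\<^sub>m 4"
  by (simp add: kron2_mult psig_square[OF assms(1)] psig_square[OF assms(2)] kron2_one)

lemma kron2_psig_adj:
  "adj (kron2 (psig v0 v1 v2) (psig w0 w1 w2)) = kron2 (psig v0 v1 v2) (psig w0 w1 w2)"
  by (simp add: kron2_adj psig_adj)

text \<open>The matrix element of \<open>R\<close> between unit vectors is the mean of a product of
  two involutions in the Choi state, so \<open>R\<close> has norm at most 1.\<close>

lemma stokes_bilinear_bound: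
  assumes ch: "qubit_channel R t"
    and v: "v0\<^sup>2 + v1\<^sup>2 + v2\<^sup>2 = 1" and w: "w0\<^sup>2 + w1\<^sup>2 + w2\<^sup>2 = 1"
  shows "\<bar>w0 * (R $$ (0,0) * v0 + R $$ (0,1) * v1 + R $$ (0,2) * v2)
    + w1 * (R $$ (1,0) * v0 + R $$ (1,1) * v1 + R $$ (1,2) * v2)
    + w2 * (R $$ (2,0) * v0 + R $$ (2,1) * v1 + R $$ (2,2) * v2)\<bar> \<le> 1"
proof -
  \<comment> \<open>The conjugation in \<open>choi\<close> reverses sigma_y in the output factor,
    hence \<open>- w2\<close>. In the input factor it is compensated by the transposition inherent
    in the Choi state.\<close>
  define G where "G = kron2 (psig v0 v1 v2) (psig w0 w1 (- w2))"
  have uG: "unitary_mat 4 G"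
    unfolding unitary_mat_def G_def kron2_psig_adj using v w by (simp add: kron2_psig_square)
  obtain m W where W: "W \<in> carrier_mat m 4" "adj W * W = choi R t" using choi_psd[OF ch] .
  have "cmod (\<Sum>r<4. \<Sum>s<4. G $$ (r,s) * choi R t $$ (s,r)) \<le> 1"
    using psd_trace_unitary_bound[OF W(1) uG] choi_trace unfolding W(2) by blast
  moreover have "(\<Sum>r<4. \<Sum>s<4. G $$ (r,s) * choi R t $$ (s,r))
    = complex_of_real (w0 * (R $$ (0,0) * v0 + R $$ (0,1) * v1 + R $$ (0,2) * v2)
    + w1 * (R $$ (1,0) * v0 + R $$ (1,1) * v1 + R $$ (1,2) * v2)
    + w2 * (R $$ (2,0) * v0 + R $$ (2,1) * v1 + R $$ (2,2) * v2))"
  proof -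
    have Gi: "G $$ (r,s) = psig v0 v1 v2 $$ (r div 2, s div 2) * psig w0 w1 (- w2) $$ (r mod 2, s mod 2)"
      if "r < 4" "s < 4" for r s using that by (simp add: G_def kron2_def)
    show ?thesis
      unfolding sum_lessThan_4 choi_index
      by (simp add: Gi psig_index[unfolded One_nat_def] choi_index[unfolded One_nat_def])
         (simp add: complex_eq_iff field_simps)
  qed
  ultimately show ?thesis by (simp only: norm_of_real)
qed

section \<open>The classical conditional entropy\<close>

lemma P_XY_choi:
  "P_XY R t 0 0 = Re (choi R t $$ (0,0))" "P_XY R t 0 1 = Re (choi R t $$ (1,1))"
  "P_XY R t 1 0 = Re (choi R t $$ (2,2))" "P_XY R t 1 1 = Re (choi R t $$ (3,3))"
proof -
  have kb: "ketbra x = eunit x x" for x by (simp add: ketbra_def eunit_def)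
  show "P_XY R t 0 0 = Re (choi R t $$ (0,0))" "P_XY R t 0 1 = Re (choi R t $$ (1,1))"
    "P_XY R t 1 0 = Re (choi R t $$ (2,2))" "P_XY R t 1 1 = Re (choi R t $$ (3,3))"
    unfolding P_XY_def kb by (simp_all add: choi_def)
qed

text \<open>Given Y, knowing X amounts to knowing whether X and Y agree. Dropping the condition
  leaves the entropy of the agreement bit, whose bias is \<open>R $$ (0,0)\<close> whatever the
  shift.\<close>

lemma H_XY_le:
  assumes ch: "qubit_channel R t"
  shows "H_XY R t \<le> hbin (R $$ (0,0))"
proof -
  define P where "P = (\<lambda>r. Re (choi R t $$ (r,r)))"
  obtain m W where W: "W \<in> carrier_mat m 4" "adj W * W = choi R t" using choi_psd[OF ch] .
  have P0: "0 \<le> P r" if "r < 4" for r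
    using gram_diag_index[OF W(1) that] unfolding W(2) P_def by (simp add: sum_nonneg)
  have Pv: "P 0 = (1 + R $$ (0,0) + t $ 0) / 4" "P 1 = (1 - R $$ (0,0) - t $ 0) / 4"
    "P 2 = (1 - R $$ (0,0) + t $ 0) / 4" "P 3 = (1 + R $$ (0,0) - t $ 0) / 4"
    unfolding P_def choi_index by simp_all
  have PXY: "P_XY R t 0 0 = P 0" "P_XY R t 0 1 = P 1" "P_XY R t 1 0 = P 2" "P_XY R t 1 1 = P 3"
    unfolding P_def by (rule P_XY_choi)+
  \<comment> \<open>Gibbs' inequality relative to a product weight; \<open>x \<le> m\<close> and
    \<open>x \<le> d\<close> make \<open>x\<close> vanish whenever that weight does.\<close>
  have gibbs: "eta x \<le> - x * log 2 m - x * log 2 d + (m * d - x) / ln 2"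
    if "0 \<le> x" "x \<le> m" "x \<le> d" for x m d
  proof (cases "m = 0 \<or> d = 0")
    case True then show ?thesis using that by auto
  next
    case False
    then have "0 < m" "0 < d" using that by auto
    then show ?thesis using eta_tangent[of x "m * d"] that by (simp add: log_mult algebra_simps)
  qed
  \<comment> \<open>\<open>m0\<close>, \<open>m1\<close> is the distribution of Y, and
    \<open>d0\<close>, \<open>d1\<close> are the probabilities that X and Y agree and
    disagree.\<close>
  define m0 m1 d0 d1 where md: "m0 = P 0 + P 2" "m1 = P 1 + P 3" "d0 = P 0 + P 3" "d1 = P 1 + P 2"
  have s1: "m0 + m1 = 1" "d0 + d1 = 1" unfolding md Pv by (simp_all add: field_simps)
  have "eta (P 0) \<le> - P 0 * log 2 m0 - P 0 * log 2 d0 + (m0 * d0 - P 0) / ln 2"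
    "eta (P 1) \<le> - P 1 * log 2 m1 - P 1 * log 2 d1 + (m1 * d1 - P 1) / ln 2"
    "eta (P 2) \<le> - P 2 * log 2 m0 - P 2 * log 2 d1 + (m0 * d1 - P 2) / ln 2"
    "eta (P 3) \<le> - P 3 * log 2 m1 - P 3 * log 2 d0 + (m1 * d0 - P 3) / ln 2"
    using P0 by (intro gibbs; simp add: md)+
  moreover have "(m0 * d0 - P 0) / ln 2 + (m1 * d1 - P 1) / ln 2 + (m0 * d1 - P 2) / ln 2 + (m1 * d0 - P 3) / ln 2
     = ((m0 + m1) * (d0 + d1) - (m0 + m1)) / ln 2"
    unfolding md by (simp add: field_simps)
  moreover have "\<dots> = 0" unfolding s1 by simp
  moreover have "eta m0 = - P 0 * log 2 m0 - P 2 * log 2 m0" "eta m1 = - P 1 * log 2 m1 - P 3 * log 2 m1"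
    "eta d0 = - P 0 * log 2 d0 - P 3 * log 2 d0" "eta d1 = - P 1 * log 2 d1 - P 2 * log 2 d1"
    unfolding eta_def md by (simp_all add: algebra_simps)
  ultimately have "eta (P 0) + eta (P 1) + eta (P 2) + eta (P 3) \<le> eta m0 + eta m1 + (eta d0 + eta d1)"
    by linarith
  moreover have "eta d0 + eta d1 = hbin (R $$ (0,0))"
  proof -
    have "d0 = (1 + R $$ (0,0)) / 2" "d1 = (1 - R $$ (0,0)) / 2" unfolding md Pv by (simp_all add: field_simps)
    then show ?thesis by (simp only: hbin_def)
  qed
  moreover have "H_XY R t = eta (P 0) + eta (P 1) + eta (P 2) + eta (P 3) - (eta m0 + eta m1)"
    unfolding H_XY_def sum_lessThan_2 PXY md by simp
  ultimately show ?thesis by simp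
qed

lemma hbin_quarter: "\<bar>x\<bar> \<le> 1 \<Longrightarrow> 2 * (eta ((1 + x) / 4) + eta ((1 - x) / 4)) = hbin x + 1"
  using eta_half[of "(1 + x) / 2"] eta_half[of "(1 - x) / 2"] unfolding hbin_def by simp (simp add: field_simps)

text \<open>Without a shift Y is uniform and independent of the agreement bit, so the general
  inequality becomes an equality.\<close>

lemma H_XY_unital:
  assumes "\<bar>R $$ (0,0)\<bar> \<le> 1"
  shows "H_XY R (0\<^sub>v 3) = hbin (R $$ (0,0))"
proof -
  have PXY: "P_XY R (0\<^sub>v 3) 0 0 = (1 + R $$ (0,0)) / 4" "P_XY R (0\<^sub>v 3) 0 1 = (1 - R $$ (0,0)) / 4"
    "P_XY R (0\<^sub>v 3) 1 0 = (1 - R $$ (0,0)) / 4" "P_XY R (0\<^sub>v 3) 1 1 = (1 + R $$ (0,0)) / 4"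
    unfolding P_XY_choi choi_index by simp_all
  have "(1 + x) / 4 + (1 - x) / 4 = 1 / 2" "(1 - x) / 4 + (1 + x) / 4 = 1 / 2" for x :: real by (simp_all add: field_simps)
  moreover have "eta (1 / 2) = 1 / 2" by (simp add: eta_def log_divide)
  ultimately show ?thesis
    unfolding H_XY_def sum_lessThan_2 PXY using hbin_quarter[OF assms] by (simp only:) simp
qed

lemma Kkey_lower_bound:
  assumes "qubit_channel R t" "wz\<^sup>2 + wx\<^sup>2 = 1"
  shows "1 - hbin (R $$ (0,0)) - hbin (wz * R $$ (0,1) + wx * R $$ (1,1)) \<le> Kkey R t"
  using conditional_entropy_lower_bound[OF assms] H_XY_le[OF assms(1)] unfolding Kkey_choi[OF assms(1)] by simp

section \<open>The algebra of two commuting involutions\<close>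

definition inv_alg :: "complex mat \<Rightarrow> complex mat \<Rightarrow> real \<Rightarrow> real \<Rightarrow> real \<Rightarrow> real \<Rightarrow> complex mat" where
  "inv_alg X Y a b c d = mat 4 4 (\<lambda>(r,s). a * 1\<^sub>m 4 $$ (r,s) + b * X $$ (r,s) + c * Y $$ (r,s) + d * (X * Y) $$ (r,s))"

lemma inv_alg_carrier [simp]: "inv_alg X Y a b c d \<in> carrier_mat 4 4"
  by (simp add: inv_alg_def)

text \<open>Multiplication in the group algebra of the Klein four-group. It makes square roots and
  projections a matter of four real coefficients.\<close>

lemma inv_alg_mult:
  assumes X: "X \<in> carrier_mat 4 4" and Y: "Y \<in> carrier_mat 4 4"
    and XX: "X * X = 1\<^sub>m 4" and YY: "Y * Y = 1\<^sub>m 4" and XY: "Y * X = X * Y"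
  shows "inv_alg X Y a b c d * inv_alg X Y a' b' c' d'
    = inv_alg X Y (a * a' + b * b' + c * c' + d * d') (a * b' + b * a' + c * d' + d * c')
        (a * c' + c * a' + b * d' + d * b') (a * d' + d * a' + b * c' + c * b')" (is "_ = ?M")
proof -
  define E where "E g = [1\<^sub>m 4, X, Y, X * Y] ! g" for g :: nat
  have Es: "E 0 = 1\<^sub>m 4" "E 1 = X" "E 2 = Y" "E 3 = X * Y" by (simp_all add: E_def)
  have E: "E g \<in> carrier_mat 4 4" if "g < 4" for g
    using less_4_cases[OF that] X Y Es by (elim disjE) simp_all
  note as = assoc_mult_mat[of _ 4 4 _ 4 _ 4]
  have XXY: "X * (X * Y) = Y" using X Y XX by (simp flip: as)
  have YXY: "Y * (X * Y) = X" using X Y YY XX XY by (metis XXY assoc_mult_mat right_mult_one_mat)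
  have XYX: "X * Y * X = Y" using X Y XXY XY by (simp add: as)
  have XYY: "X * Y * Y = X" using X Y YY by (simp add: as)
  have XYXY: "X * Y * (X * Y) = 1\<^sub>m 4" using X Y YXY XX by (simp add: as)
  note tab = XX YY XY XXY YXY XYX XYY XYXY
  define w where "w g = [a,b,c,d] ! g" for g :: nat
  define w' where "w' g = [a',b',c',d'] ! g" for g :: nat
  have ws: "w 0 = a" "w 1 = b" "w 2 = c" "w 3 = d" "w' 0 = a'" "w' 1 = b'" "w' 2 = c'" "w' 3 = d'"
    by (simp_all add: w_def w'_def)
  have L: "inv_alg X Y a b c d $$ (r,s) = (\<Sum>g<4. w g * E g $$ (r,s))"
    and L': "inv_alg X Y a' b' c' d' $$ (r,s) = (\<Sum>g<4. w' g * E g $$ (r,s))" if "r < 4" "s < 4" for r s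
    using that unfolding sum_lessThan_4 Es ws by (simp_all add: inv_alg_def del: index_mult_mat(1))
  show ?thesis
  proof (rule eq_matI)
    fix r s assume "r < dim_row (?M)"
      "s < dim_col (?M)"
    then have rs: "r < 4" "s < 4" by (auto simp: inv_alg_def)
    have "(inv_alg X Y a b c d * inv_alg X Y a' b' c' d') $$ (r,s)
       = (\<Sum>k<4. (\<Sum>g<4. w g * E g $$ (r,k)) * (\<Sum>h<4. w' h * E h $$ (k,s)))"
      unfolding mult_mat_index[OF inv_alg_carrier inv_alg_carrier rs]
      by (intro sum.cong refl) (simp add: L L' rs)
    also have "\<dots> = (\<Sum>k<4. \<Sum>g<4. \<Sum>h<4. w g * w' h * (E g $$ (r,k) * E h $$ (k,s)))"
      unfolding sum_product by (intro sum.cong refl) (simp add: mult_ac)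
    also have "\<dots> = (\<Sum>g<4. \<Sum>h<4. \<Sum>k<4. w g * w' h * (E g $$ (r,k) * E h $$ (k,s)))"
      by (subst sum.swap, rule sum.cong[OF refl], subst sum.swap) simp
    also have "\<dots> = (\<Sum>g<4. \<Sum>h<4. w g * w' h * (E g * E h) $$ (r,s))"
      by (intro sum.cong refl) (simp add: mult_mat_index[OF E E rs] sum_distrib_left del: index_mult_mat(1))
    also have "\<dots> = ?M $$ (r,s)"
    proof -
      have o: "1\<^sub>m 4 * 1\<^sub>m 4 = (1\<^sub>m 4 :: complex mat)" "1\<^sub>m 4 * X = X" "X * 1\<^sub>m 4 = X" "1\<^sub>m 4 * Y = Y" "Y * 1\<^sub>m 4 = Y"
        "1\<^sub>m 4 * (X * Y) = X * Y" "X * Y * 1\<^sub>m 4 = X * Y" using X Y by simp_all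
      define x y z u where "x = X $$ (r,s)" "y = Y $$ (r,s)" "z = (X * Y) $$ (r,s)" "u = (1\<^sub>m 4 :: complex mat) $$ (r,s)"
      note xyz = this
      have i: "inv_alg X Y p q p' q' $$ (r,s) = p * u + q * x + p' * y + q' * z" for p q p' q'
        using rs unfolding xyz by (simp add: inv_alg_def del: index_mult_mat(1) index_one_mat(1))
      show ?thesis unfolding i unfolding sum_lessThan_4 Es ws tab o xyz[symmetric] by (simp add: algebra_simps)
    qed
    finally show "(inv_alg X Y a b c d * inv_alg X Y a' b' c' d') $$ (r,s) = \<dots>" .
  qed (auto simp: inv_alg_def)
qed

lemma inv_alg_adj:
  assumes X: "X \<in> carrier_mat 4 4" and Y: "Y \<in> carrier_mat 4 4"
    and aX: "adj X = X" and aY: "adj Y = Y" and XY: "Y * X = X * Y"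
  shows "adj (inv_alg X Y a b c d) = inv_alg X Y a b c d"
proof (rule eq_matI)
  have XYc: "X * Y \<in> carrier_mat 4 4" using X Y by simp
  have aXY: "adj (X * Y) = X * Y" using adj_mult[OF X Y] aX aY XY by simp
  fix r s assume "r < dim_row (inv_alg X Y a b c d)" "s < dim_col (inv_alg X Y a b c d)"
  then have rs: "r < 4" "s < 4" by (auto simp: inv_alg_def)
  have "cnj (X $$ (s,r)) = X $$ (r,s)" "cnj (Y $$ (s,r)) = Y $$ (r,s)" "cnj ((X * Y) $$ (s,r)) = (X * Y) $$ (r,s)"
    using adj_index[OF X rs] adj_index[OF Y rs] adj_index[OF XYc rs] unfolding aX aY aXY by simp_all
  then show "adj (inv_alg X Y a b c d) $$ (r,s) = inv_alg X Y a b c d $$ (r,s)"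
    unfolding adj_index[OF inv_alg_carrier rs] using rs
    by (auto simp: inv_alg_def simp del: index_mult_mat(1))
qed (auto simp: inv_alg_def)

lemma eta_mult: "0 \<le> x \<Longrightarrow> 0 \<le> y \<Longrightarrow> eta (x * y) = x * eta y + y * eta x"
  by (cases "x = 0 \<or> y = 0") (auto simp: eta_def log_mult algebra_simps)

lemma hbin_product:
  assumes "\<bar>a\<bar> \<le> 1" "\<bar>b\<bar> \<le> 1"
  shows "eta ((1 + a) * (1 + b) / 4) + eta ((1 + a) * (1 - b) / 4) + eta ((1 - a) * (1 + b) / 4) + eta ((1 - a) * (1 - b) / 4)
    = hbin a + hbin b"
proof -
  have e: "(1 + a) * (1 + b) / 4 = ((1 + a) / 2) * ((1 + b) / 2)" "(1 + a) * (1 - b) / 4 = ((1 + a) / 2) * ((1 - b) / 2)"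
    "(1 - a) * (1 + b) / 4 = ((1 - a) / 2) * ((1 + b) / 2)" "(1 - a) * (1 - b) / 4 = ((1 - a) / 2) * ((1 - b) / 2)"
    by simp_all
  have n: "0 \<le> (1 + a) / 2" "0 \<le> (1 - a) / 2" "0 \<le> (1 + b) / 2" "0 \<le> (1 - b) / 2" using assms by auto
  show ?thesis unfolding e eta_mult[OF n(1) n(3)] eta_mult[OF n(1) n(4)] eta_mult[OF n(2) n(3)] eta_mult[OF n(2) n(4)] hbin_def
    by (simp add: field_simps)
qed

text \<open>An explicit square root proves that the Choi state belongs to a channel, and explicit
  eigenprojections bound its entropy from below.\<close>

lemma commuting_involutions_channel:
  assumes X: "X \<in> carrier_mat 4 4" and Y: "Y \<in> carrier_mat 4 4"
    and XX: "X * X = 1\<^sub>m 4" and YY: "Y * Y = 1\<^sub>m 4" and XY: "Y * X = X * Y"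
    and aX: "adj X = X" and aY: "adj Y = Y"
    and tX: "(\<Sum>r<4. X $$ (r,r)) = 0" and tY: "(\<Sum>r<4. Y $$ (r,r)) = 0" and tXY: "(\<Sum>r<4. (X * Y) $$ (r,r)) = 0"
    and a: "\<bar>a\<bar> \<le> 1" and b: "\<bar>b\<bar> \<le> 1" and S: "S \<in> carrier_mat 3 3"
    and choi: "choi S (0\<^sub>v 3) = inv_alg X Y (1/4) (a/4) (b/4) (a*b/4)"
  shows "qubit_channel S (0\<^sub>v 3) \<and> Kkey S (0\<^sub>v 3) \<le> 1 - hbin a - hbin b"
proof -
  note im = inv_alg_mult[OF X Y XX YY XY] and ia = inv_alg_adj[OF X Y aX aY XY]
  \<comment> \<open>For an involution Z, \<open>c0 x\<close> and \<open>c1 x\<close> are the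
    coefficients of the square root of (1 + x Z)/2, whose eigenvalues are
    \<open>sqrt ((1 + x) / 2)\<close> and \<open>sqrt ((1 - x) / 2)\<close>. Their products over
    \<open>a\<close> and \<open>b\<close> give the root \<open>T\<close>.\<close>
  define c0 where "c0 x = (sqrt ((1 + x) / 2) + sqrt ((1 - x) / 2)) / 2" for x :: real
  define c1 where "c1 x = (sqrt ((1 + x) / 2) - sqrt ((1 - x) / 2)) / 2" for x :: real
  have c: "c0 x * c0 x + c1 x * c1 x = 1 / 2" "c0 x * c1 x = x / 4" if "\<bar>x\<bar> \<le> 1" for x
  proof -
    have q: "sqrt ((1 + x) / 2) * sqrt ((1 + x) / 2) = (1 + x) / 2" "sqrt ((1 - x) / 2) * sqrt ((1 - x) / 2) = (1 - x) / 2"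
      using that by auto
    define s t where "s = sqrt ((1 + x) / 2)" and "t = sqrt ((1 - x) / 2)"
    have "c0 x * c0 x + c1 x * c1 x = (s * s + t * t) / 2" unfolding c0_def c1_def s_def[symmetric] t_def[symmetric]
      by (simp add: field_simps)
    then show "c0 x * c0 x + c1 x * c1 x = 1 / 2" unfolding s_def t_def q by (simp add: field_simps)
    have "c0 x * c1 x = (s * s - t * t) / 4" unfolding c0_def c1_def s_def[symmetric] t_def[symmetric]
      by (simp add: field_simps)
    then show "c0 x * c1 x = x / 4" unfolding s_def t_def q by (simp add: field_simps)
  qed
  define T where "T = inv_alg X Y (c0 a * c0 b) (c1 a * c0 b) (c0 a * c1 b) (c1 a * c1 b)"
  have T: "T \<in> carrier_mat 4 4" by (simp add: T_def)
  have TT: "adj T * T = choi S (0\<^sub>v 3)"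
  proof -
    have "c0 a * c0 b * (c0 a * c0 b) + c1 a * c0 b * (c1 a * c0 b) + c0 a * c1 b * (c0 a * c1 b) + c1 a * c1 b * (c1 a * c1 b)
       = (c0 a * c0 a + c1 a * c1 a) * (c0 b * c0 b + c1 b * c1 b)" by (simp add: algebra_simps)
    moreover have "c0 a * c0 b * (c1 a * c0 b) + c1 a * c0 b * (c0 a * c0 b) + c0 a * c1 b * (c1 a * c1 b) + c1 a * c1 b * (c0 a * c1 b)
       = 2 * (c0 a * c1 a) * (c0 b * c0 b + c1 b * c1 b)" by (simp add: algebra_simps)
    moreover have "c0 a * c0 b * (c0 a * c1 b) + c0 a * c1 b * (c0 a * c0 b) + c1 a * c0 b * (c1 a * c1 b) + c1 a * c1 b * (c1 a * c0 b)
       = (c0 a * c0 a + c1 a * c1 a) * (2 * (c0 b * c1 b))" by (simp add: algebra_simps)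
    moreover have "c0 a * c0 b * (c1 a * c1 b) + c1 a * c1 b * (c0 a * c0 b) + c1 a * c0 b * (c0 a * c1 b) + c0 a * c1 b * (c1 a * c0 b)
       = 4 * (c0 a * c1 a) * (c0 b * c1 b)" by (simp add: algebra_simps)
    ultimately show ?thesis unfolding T_def ia im choi using c[OF a] c[OF b] by (simp only:) simp
  qed
  have ch: "qubit_channel S (0\<^sub>v 3)" using qubit_channel_of_choi[OF S _ T TT] by simp
  \<comment> \<open>\<open>j\<close> and \<open>k\<close> run through the four sign patterns.
    \<open>Pr l\<close> is the joint eigenprojection (1 + j X)(1 + k Y)/4, of trace 1 because
    \<open>X\<close>, \<open>Y\<close> and \<open>X * Y\<close> are traceless, and
    \<open>lam l\<close> is its eigenvalue.\<close>
  define j where "j l = (if l < 2 then 1 else -1 :: real)" for l :: nat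
  define k where "k l = (if l = 0 \<or> l = 2 then 1 else -1 :: real)" for l :: nat
  define Pr where "Pr l = inv_alg X Y (1/4) (j l / 4) (k l / 4) (j l * k l / 4)" for l
  define lam where "lam l = (1 + j l * a) * (1 + k l * b) / 4" for l
  have jk: "j 0 = 1" "j 1 = 1" "j 2 = -1" "j 3 = -1" "k 0 = 1" "k 1 = -1" "k 2 = 1" "k 3 = -1"
    by (simp_all add: j_def k_def)
  have "(\<Sum>l<4. eta (lam l)) \<le> vn_entropy (adj T * T)"
  proof (rule psd_entropy_ge_projections[OF T, where Pr = Pr])
    show "Pr l \<in> carrier_mat 4 4" for l by (simp add: Pr_def)
    show "0 \<le> lam l" for l
      using a b unfolding lam_def j_def k_def by (auto intro!: divide_nonneg_nonneg mult_nonneg_nonneg)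
    show "adj (Pr l) * Pr l = Pr l" for l
    proof -
      have "1/4 * (1/4) + j l / 4 * (j l / 4) + k l / 4 * (k l / 4) + j l * k l / 4 * (j l * k l / 4) = 1 / 4"
        "1/4 * (j l / 4) + j l / 4 * (1/4) + k l / 4 * (j l * k l / 4) + j l * k l / 4 * (k l / 4) = j l / 4"
        "1/4 * (k l / 4) + k l / 4 * (1/4) + j l / 4 * (j l * k l / 4) + j l * k l / 4 * (j l / 4) = k l / 4"
        "1/4 * (j l * k l / 4) + j l * k l / 4 * (1/4) + j l / 4 * (k l / 4) + k l / 4 * (j l / 4) = j l * k l / 4"
        by (auto simp: j_def k_def)
      then show ?thesis unfolding Pr_def ia im by (simp only:)
    qed
    fix r s :: nat assume rs: "r < 4" "s < 4"
    show "(adj T * T) $$ (r,s) = (\<Sum>l<4. complex_of_real (lam l) * Pr l $$ (r,s))"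
      unfolding TT choi sum_lessThan_4 lam_def Pr_def jk using rs
      by (simp add: inv_alg_def field_simps del: index_mult_mat(1))
    show "(\<Sum>l<4. Pr l $$ (r,s)) = (if r = s then 1 else 0)"
      unfolding sum_lessThan_4 Pr_def jk using rs
      by (simp add: inv_alg_def field_simps del: index_mult_mat(1))
  next
    fix l :: nat
    have "(\<Sum>r<4. Pr l $$ (r,r)) = (\<Sum>r<4. 1 / 4 + of_real (j l / 4) * X $$ (r,r) + of_real (k l / 4) * Y $$ (r,r) + of_real (j l * k l / 4) * (X * Y) $$ (r,r))"
      unfolding Pr_def by (intro sum.cong refl) (simp add: inv_alg_def del: index_mult_mat(1))
    also have "\<dots> = 1" unfolding sum.distrib sum_distrib_left[symmetric] tX tY tXY by simp
    finally show "(\<Sum>r<4. Pr l $$ (r,r)) = 1" .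
  qed
  moreover have "(\<Sum>l<4. eta (lam l)) = hbin a + hbin b"
    unfolding hbin_product[OF a b, symmetric] sum_lessThan_4 lam_def jk by simp
  ultimately have low: "hbin a + hbin b \<le> vn_entropy (choi S (0\<^sub>v 3))" unfolding TT by simp
  obtain Ks where kr: "kraus_rep S (0\<^sub>v 3) Ks" using ch unfolding qubit_channel_def by blast
  have blk: "vn_entropy (choi_block S (0\<^sub>v 3) x) \<le> (\<Sum>i<2. eta (Re (choi S (0\<^sub>v 3) $$ (2 * x + i, 2 * x + i))))" if "x < 2" for x
    using psd_entropy_le_diag[OF kraus_block_carrier[of Ks x]] unfolding kraus_block_gram[OF kr that]
    by (simp add: choi_block_def)
  have S00: "\<bar>S $$ (0,0)\<bar> \<le> 1" using stokes_bilinear_bound[OF ch, of 1 0 0 1 0 0] by simp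
  \<comment> \<open>The block entropies are replaced by those of their diagonals; the resulting
    \<open>hbin (S $$ (0,0))\<close> then cancels against \<open>H_XY\<close>.\<close>
  have "vn_entropy (choi_block S (0\<^sub>v 3) 0) + vn_entropy (choi_block S (0\<^sub>v 3) 1) \<le> hbin (S $$ (0,0)) + 1"
  proof -
    have "vn_entropy (choi_block S (0\<^sub>v 3) 0) \<le> eta ((1 + S $$ (0,0)) / 4) + eta ((1 - S $$ (0,0)) / 4)"
      using blk[of 0] unfolding sum_lessThan_2 by (simp add: choi_index[unfolded One_nat_def])
    moreover have "vn_entropy (choi_block S (0\<^sub>v 3) 1) \<le> eta ((1 - S $$ (0,0)) / 4) + eta ((1 + S $$ (0,0)) / 4)"
      using blk[of 1] unfolding sum_lessThan_2
      by (simp add: choi_index[unfolded One_nat_def] numeral_3_eq_3[symmetric] numeral_2_eq_2[symmetric])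
    ultimately show ?thesis using hbin_quarter[OF S00] by simp
  qed
  then show ?thesis using ch low unfolding Kkey_choi[OF ch] H_XY_unital[OF S00] by simp
qed

text \<open>The matrix has the singular value decomposition \<open>a \<alpha> n\<^sup>T + b \<beta> m\<^sup>T + a b (\<alpha> \<times> \<beta>) e\<^sub>y\<^sup>T\<close> with
  \<open>n = (c, s, 0)\<close> and \<open>m = (- s, c, 0)\<close>. The choice of the third singular value turns the Choi state into
  \<open>(1 + a X) (1 + b Y) / 4\<close> for commuting involutions \<open>X\<close> and \<open>Y\<close>.\<close>

lemma product_channel:
  fixes al be :: "nat \<Rightarrow> real"
  assumes al: "(al 0)\<^sup>2 + (al 1)\<^sup>2 + (al 2)\<^sup>2 = 1" and be: "(be 0)\<^sup>2 + (be 1)\<^sup>2 + (be 2)\<^sup>2 = 1"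
    and orth: "al 0 * be 0 + al 1 * be 1 + al 2 * be 2 = 0"
    and cs: "c\<^sup>2 + s\<^sup>2 = 1" and a: "\<bar>a\<bar> \<le> 1" and b: "\<bar>b\<bar> \<le> 1"
    and S: "S \<in> carrier_mat 3 3"
    and S0: "\<And>i. i < 3 \<Longrightarrow> S $$ (i,0) = a * al i * c - b * be i * s"
    and S1: "\<And>i. i < 3 \<Longrightarrow> S $$ (i,1) = a * al i * s + b * be i * c"
    and S2: "S $$ (0,2) = a * b * (al 1 * be 2 - al 2 * be 1)" "S $$ (1,2) = a * b * (al 2 * be 0 - al 0 * be 2)"
      "S $$ (2,2) = a * b * (al 0 * be 1 - al 1 * be 0)"
  shows "qubit_channel S (0\<^sub>v 3) \<and> Kkey S (0\<^sub>v 3) \<le> 1 - hbin a - hbin b"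
proof -
  define N where "N = psig c s 0"
  define M where "M = psig (- s) c 0"
  \<comment> \<open>The third component is negated because the output factor of \<open>choi\<close>
    is conjugated.\<close>
  define A where "A = psig (al 0) (al 1) (- al 2)"
  define B where "B = psig (be 0) (be 1) (- be 2)"
  have carr: "N \<in> carrier_mat 2 2" "M \<in> carrier_mat 2 2" "A \<in> carrier_mat 2 2" "B \<in> carrier_mat 2 2"
    by (simp_all add: N_def M_def A_def B_def)
  define X where "X = kron2 N A"
  define Y where "Y = kron2 M B"
  have X: "X \<in> carrier_mat 4 4" and Y: "Y \<in> carrier_mat 4 4" by (simp_all add: X_def Y_def)
  have XX: "X * X = 1\<^sub>m 4" unfolding X_def N_def A_def using cs al by (intro kron2_psig_square) auto
  have YY: "Y * Y = 1\<^sub>m 4" unfolding Y_def M_def B_def using cs be by (intro kron2_psig_square) (auto simp: add.commute)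
  have NM: "M * N = - (N * M)" unfolding M_def N_def by (rule psig_anticommute) simp
  have AB: "B * A = - (A * B)" unfolding A_def B_def using orth by (intro psig_anticommute) (simp add: mult.commute)
  have XYk: "X * Y = kron2 (N * M) (A * B)" unfolding X_def Y_def by (rule kron2_mult) (use carr in auto)
  have YXk: "Y * X = kron2 (M * N) (B * A)" unfolding X_def Y_def by (rule kron2_mult) (use carr in auto)
  have NMc: "N * M \<in> carrier_mat 2 2" "A * B \<in> carrier_mat 2 2" using carr by auto
  \<comment> \<open>Both tensor factors anticommute, and the two signs cancel.\<close>
  have XY: "Y * X = X * Y"
  proof (rule eq_matI)
    fix r s assume "r < dim_row (X * Y)" "s < dim_col (X * Y)"
    then have rs: "r < 4" "s < 4" using X Y by auto
    have d: "r div 2 < 2" "s div 2 < 2" "r mod 2 < 2" "s mod 2 < 2" using rs by auto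
    show "(Y * X) $$ (r,s) = (X * Y) $$ (r,s)" unfolding XYk YXk NM AB
      using rs d NMc carr by (simp add: kron2_def del: index_mult_mat(1))
  qed (use X Y in auto)
  have aX: "adj X = X" "adj Y = Y" by (simp_all add: X_def Y_def N_def A_def M_def B_def kron2_psig_adj)
  have cs': "c * c + s * s = 1" using cs by (simp add: power2_eq_square)
  have e: "c * c - s * (- s) = 1" "c * (- s) + s * c + 0 * 0 = 0" using cs' by simp_all
  \<comment> \<open>For every angle \<open>N * M\<close> is i times sigma_y, so the term with
    \<open>X * Y\<close> fills only the third column of the Stokes matrix.\<close>
  have NMi: "(N * M) $$ (0,0) = 0" "(N * M) $$ (0,1) = 1" "(N * M) $$ (1,0) = -1" "(N * M) $$ (1,1) = 0"
    unfolding N_def M_def psig_mult_index e by simp_all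
  have e: "al 0 * be 0 + al 1 * be 1 + - al 2 * - be 2 = 0" using orth by simp
  have ABi: "(A * B) $$ (0,0) = - \<i> * of_real (al 1 * be 2 - al 2 * be 1)"
    "(A * B) $$ (0,1) = of_real (al 0 * be 1 - al 1 * be 0) - \<i> * of_real (al 2 * be 0 - al 0 * be 2)"
    "(A * B) $$ (1,0) = - of_real (al 0 * be 1 - al 1 * be 0) - \<i> * of_real (al 2 * be 0 - al 0 * be 2)"
    "(A * B) $$ (1,1) = \<i> * of_real (al 1 * be 2 - al 2 * be 1)"
    unfolding A_def B_def psig_mult_index e by (simp_all add: complex_eq_iff)
  have Xi: "X $$ (r,s) = N $$ (r div 2, s div 2) * A $$ (r mod 2, s mod 2)"
    and Yi: "Y $$ (r,s) = M $$ (r div 2, s div 2) * B $$ (r mod 2, s mod 2)"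
    and XYi: "(X * Y) $$ (r,s) = (N * M) $$ (r div 2, s div 2) * (A * B) $$ (r mod 2, s mod 2)" if "r < 4" "s < 4" for r s
    unfolding XYk unfolding X_def Y_def kron2_def using that by (simp_all del: index_mult_mat(1))
  note Ni = psig_index[of c s 0, folded N_def] and Mi = psig_index[of "- s" c 0, folded M_def]
    and Ai = psig_index[of "al 0" "al 1" "- al 2", folded A_def] and Bi = psig_index[of "be 0" "be 1" "- be 2", folded B_def]
  have tX: "(\<Sum>r<4. X $$ (r,r)) = 0" and tY: "(\<Sum>r<4. Y $$ (r,r)) = 0" and tXY: "(\<Sum>r<4. (X * Y) $$ (r,r)) = 0"
    unfolding sum_lessThan_4
    by (simp_all add: Xi Yi XYi Ni Mi Ai Bi NMi ABi Ni[unfolded One_nat_def] Mi[unfolded One_nat_def] Ai[unfolded One_nat_def]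
        Bi[unfolded One_nat_def] NMi[unfolded One_nat_def] ABi[unfolded One_nat_def] del: index_mult_mat(1))
  have S0': "S $$ (0,0) = a * al 0 * c - b * be 0 * s" "S $$ (1,0) = a * al 1 * c - b * be 1 * s" "S $$ (2,0) = a * al 2 * c - b * be 2 * s"
    by (rule S0, simp)+
  have S1': "S $$ (0,1) = a * al 0 * s + b * be 0 * c" "S $$ (1,1) = a * al 1 * s + b * be 1 * c" "S $$ (2,1) = a * al 2 * s + b * be 2 * c"
    by (rule S1, simp)+
  have "choi S (0\<^sub>v 3) = inv_alg X Y (1/4) (a/4) (b/4) (a*b/4)"
  proof (rule eq_matI)
    fix i j assume "i < dim_row (inv_alg X Y (1/4) (a/4) (b/4) (a*b/4))" "j < dim_col (inv_alg X Y (1/4) (a/4) (b/4) (a*b/4))"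
    then have ij: "i < 4" "j < 4" by (auto simp: inv_alg_def)
    have "inv_alg X Y (1/4) (a/4) (b/4) (a*b/4) $$ (i,j) = (1/4) * 1\<^sub>m 4 $$ (i,j)
      + (a/4) * (N $$ (i div 2, j div 2) * A $$ (i mod 2, j mod 2)) + (b/4) * (M $$ (i div 2, j div 2) * B $$ (i mod 2, j mod 2))
      + (a*b/4) * ((N * M) $$ (i div 2, j div 2) * (A * B) $$ (i mod 2, j mod 2))"
      unfolding Xi[OF ij, symmetric] Yi[OF ij, symmetric] XYi[OF ij, symmetric] using ij
      by (simp add: inv_alg_def del: index_mult_mat(1))
    moreover have "choi S (0\<^sub>v 3) $$ (i,j) = \<dots>"
      using less_4_cases[OF ij(1)] less_4_cases[OF ij(2)]
      by (elim disjE; hypsubst; simp only: choi_index S0' S1' S2;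
        simp add: Ni[unfolded One_nat_def] Mi[unfolded One_nat_def] Ai[unfolded One_nat_def]
        Bi[unfolded One_nat_def] NMi[unfolded One_nat_def] ABi[unfolded One_nat_def] del: index_mult_mat(1);
        simp add: complex_eq_iff field_simps)
    ultimately show "choi S (0\<^sub>v 3) $$ (i,j) = inv_alg X Y (1/4) (a/4) (b/4) (a*b/4) $$ (i,j)" by simp
  qed (auto simp: inv_alg_def choi_def)
  from commuting_involutions_channel[OF X Y XX YY XY aX tX tY tXY a b S this] show ?thesis .
qed

section \<open>Rotations\<close>

text \<open>Vectors are functions on \<open>nat\<close> of which only the values at 0, 1, 2 count;
  this is why many vector equations carry the guard \<open>i < 3\<close>.\<close>

definition dot3 :: "(nat \<Rightarrow> real) \<Rightarrow> (nat \<Rightarrow> real) \<Rightarrow> real" where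
  "dot3 f g = f 0 * g 0 + f 1 * g 1 + f 2 * g 2"

lemma dot3_commute: "dot3 f g = dot3 g f"
  by (simp add: dot3_def mult.commute)

lemma dot3_add: "dot3 f (\<lambda>i. x * g i + y * h i) = x * dot3 f g + y * dot3 f h"
  by (simp add: dot3_def algebra_simps)

lemma dot3_scale: "dot3 f (\<lambda>i. x * g i) = x * dot3 f g"
  by (simp add: dot3_def algebra_simps)

lemma dot3_self_nonneg [simp]: "0 \<le> dot3 f f"
  by (simp add: dot3_def)

lemma dot3_self_zero: "dot3 f f = 0 \<Longrightarrow> i < 3 \<Longrightarrow> f i = 0"
proof -
  assume z: "dot3 f f = 0" and i: "i < 3"
  have "(f 0)\<^sup>2 + (f 1)\<^sup>2 + (f 2)\<^sup>2 = 0" using z by (simp add: dot3_def power2_eq_square)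
  moreover have "0 \<le> (f 0)\<^sup>2" "0 \<le> (f 1)\<^sup>2" "0 \<le> (f 2)\<^sup>2" by simp_all
  ultimately have "(f 0)\<^sup>2 = 0" "(f 1)\<^sup>2 = 0" "(f 2)\<^sup>2 = 0" by linarith+
  then have "f 0 = 0" "f 1 = 0" "f 2 = 0" by simp_all
  moreover have "i = 0 \<or> i = 1 \<or> i = 2" using i by auto
  ultimately show "f i = 0" by auto
qed

lemma dot3_bessel:
  assumes "dot3 u u = 1" "dot3 v v = 1" "dot3 u v = 0"
  shows "(dot3 u f)\<^sup>2 + (dot3 v f)\<^sup>2 \<le> dot3 f f"
proof -
  define x y where "x = dot3 u f" and "y = dot3 v f"
  define g where "g i = f i - x * u i - y * v i" for i
  have "dot3 g g = dot3 f f - 2 * x * dot3 u f - 2 * y * dot3 v f + x\<^sup>2 * dot3 u u + y\<^sup>2 * dot3 v v + 2 * x * y * dot3 u v"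
    unfolding dot3_def g_def by (simp add: algebra_simps power2_eq_square)
  then show ?thesis using dot3_self_nonneg[of g] assms by (simp add: power2_eq_square flip: x_def y_def)
qed

lemma dot3_cauchy_unit:
  assumes "dot3 u u = 1"
  shows "(dot3 u f)\<^sup>2 \<le> dot3 f f"
proof -
  define x where "x = dot3 u f"
  define g where "g i = f i - x * u i" for i
  have "dot3 g g = dot3 f f - 2 * x * dot3 u f + x\<^sup>2 * dot3 u u"
    unfolding dot3_def g_def by (simp add: algebra_simps power2_eq_square)
  then show ?thesis using dot3_self_nonneg[of g] assms by (simp add: power2_eq_square flip: x_def)
qed

lemma normalize3:
  assumes "dot3 f f \<noteq> 0"
  shows "\<exists>u. dot3 u u = 1 \<and> f = (\<lambda>i. sqrt (dot3 f f) * u i) \<and> dot3 u f = sqrt (dot3 f f)"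
proof -
  have p: "sqrt (dot3 f f) > 0" using assms dot3_self_nonneg[of f] by (simp add: less_le)
  define u where "u i = f i / sqrt (dot3 f f)" for i
  have f: "f = (\<lambda>i. sqrt (dot3 f f) * u i)" using p by (auto simp: u_def)
  have "dot3 (\<lambda>i. f i / k) (\<lambda>i. f i / k) = dot3 f f / (k * k)" for k
    by (simp add: dot3_def add_divide_distrib)
  then have "dot3 u u = dot3 f f / (sqrt (dot3 f f) * sqrt (dot3 f f))"
    unfolding u_def by (simp only:)
  then have u: "dot3 u u = 1" using assms by simp
  have "dot3 u f = sqrt (dot3 f f) * dot3 u u" by (subst f) (rule dot3_scale)
  then show ?thesis using f u by auto
qed

lemma orthogonal_unit_exists:
  assumes "dot3 u u = 1"
  shows "\<exists>v. dot3 v v = 1 \<and> dot3 u v = 0"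
proof (cases "(u 0)\<^sup>2 + (u 1)\<^sup>2 = 0")
  case True
  then have "u 0 = 0" by (simp add: sum_power2_eq_zero_iff)
  then show ?thesis by (intro exI[of _ "\<lambda>i. if i = 0 then 1 else 0"]) (simp add: dot3_def)
next
  case False
  define f where "f i = (if i = 0 then - u 1 else if i = 1 then u 0 else 0)" for i :: nat
  have "dot3 f f \<noteq> 0" using False by (simp add: dot3_def f_def power2_eq_square add.commute)
  then obtain v where v: "dot3 v v = 1" "f = (\<lambda>i. sqrt (dot3 f f) * v i)" using normalize3 by blast
  have "dot3 u f = 0" by (simp add: dot3_def f_def)
  then have "sqrt (dot3 f f) * dot3 u v = 0" using v(2) dot3_scale[of u "sqrt (dot3 f f)" v] by simp
  then show ?thesis using v(1) \<open>dot3 f f \<noteq> 0\<close> by auto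
qed

text \<open>If \<open>f\<close> is parallel to \<open>u\<close>, any orthogonal unit vector serves
  as \<open>v\<close>, so that the coefficient \<open>dot3 v f\<close> is 0 and the formula remains
  uniform.\<close>

lemma gram_schmidt3:
  assumes u: "dot3 u u = 1"
  shows "\<exists>v. dot3 v v = 1 \<and> dot3 u v = 0 \<and> (\<forall>i<3. f i = dot3 u f * u i + dot3 v f * v i)"
proof -
  define g where "g i = f i - dot3 u f * u i" for i
  have ug: "dot3 u g = 0"
  proof -
    have "dot3 u (\<lambda>i. f i - x * u i) = dot3 u f - x * dot3 u u" for x unfolding dot3_def by (simp add: algebra_simps)
    then show ?thesis using u by (simp add: g_def[abs_def])
  qed
  show ?thesis
  proof (cases "dot3 g g = 0")
    case True
    obtain v where v: "dot3 v v = 1" "dot3 u v = 0" using orthogonal_unit_exists[OF u] by blast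
    have fi: "f i = dot3 u f * u i" if "i < 3" for i using dot3_self_zero[OF True that] by (simp add: g_def)
    have "dot3 v f = dot3 u f * dot3 u v"
      unfolding dot3_def[of v] fi[of 0, simplified] using fi[of 0] fi[of 1] fi[of 2] by (simp add: dot3_def[of u v] algebra_simps)
    then show ?thesis using v fi by auto
  next
    case False
    then obtain v where v: "dot3 v v = 1" "g = (\<lambda>i. sqrt (dot3 g g) * v i)" "dot3 v g = sqrt (dot3 g g)"
      using normalize3 by blast
    have "sqrt (dot3 g g) * dot3 u v = 0" using ug v(2) dot3_scale[of u "sqrt (dot3 g g)" v] by simp
    then have uv: "dot3 u v = 0" using False by simp
    have "f = (\<lambda>i. dot3 u f * u i + 1 * g i)" by (auto simp: g_def)
    then have "dot3 v f = dot3 u f * dot3 v u + 1 * dot3 v g" using dot3_add[of v "dot3 u f" u 1 g] by simp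
    then have "dot3 v f = sqrt (dot3 g g)" using uv v(3) by (simp add: dot3_commute)
    then have "f i = dot3 u f * u i + dot3 v f * v i" for i
      using fun_cong[OF v(2), of i] by (simp add: g_def)
    then show ?thesis using v(1) uv by auto
  qed
qed

text \<open>A singular value decomposition of two orthogonal columns. The case distinctions provide
  unit directions when a column vanishes.\<close>

lemma orthogonal_pair_decomp:
  assumes "dot3 f g = 0"
  shows "\<exists>u v a b. dot3 u u = 1 \<and> dot3 v v = 1 \<and> dot3 u v = 0 \<and> (\<forall>i<3. f i = a * u i \<and> g i = b * v i)"
proof (cases "dot3 f f = 0")
  case False
  then obtain u where u: "dot3 u u = 1" "f = (\<lambda>i. sqrt (dot3 f f) * u i)" using normalize3 by blast
  have "sqrt (dot3 f f) * dot3 g u = 0" using assms u(2) dot3_scale[of g "sqrt (dot3 f f)" u] by (simp add: dot3_commute)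
  then have "dot3 u g = 0" using False by (simp add: dot3_commute)
  moreover obtain v where "dot3 v v = 1" "dot3 u v = 0" "\<forall>i<3. g i = dot3 u g * u i + dot3 v g * v i"
    using gram_schmidt3[OF u(1)] by blast
  ultimately show ?thesis using u fun_cong[OF u(2)] by (metis add_0 mult_zero_left)
next
  case f0: True
  have fz: "f i = 0 * u i" if "i < 3" for i and u :: "nat \<Rightarrow> real" using dot3_self_zero[OF f0 that] by simp
  have "\<exists>v b. dot3 v v = 1 \<and> (\<forall>i<3. g i = b * v i)"
  proof (cases "dot3 g g = 0")
    case True
    then show ?thesis using dot3_self_zero[OF True]
      by (intro exI[of _ "\<lambda>i. if i = 0 then 1 else 0"] exI[of _ 0]) (auto simp: dot3_def)
  next
    case False
    then show ?thesis using normalize3[OF False] by metis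
  qed
  then obtain v b where v: "dot3 v v = 1" "\<forall>i<3. g i = b * v i" by blast
  obtain u where "dot3 u u = 1" "dot3 v u = 0" using orthogonal_unit_exists[OF v(1)] by blast
  then show ?thesis using v fz by (metis dot3_commute)
qed

text \<open>Split \<open>g\<close> along \<open>v\<close>. The part along \<open>v\<close>
  contributes through \<open>dot3 v f\<close>, which Bessel's inequality makes small when
  \<open>f\<close> is close to \<open>u\<close>; the remainder is small when \<open>g\<close> is
  close to \<open>v\<close>. Orthonormal vectors thus align with both \<open>f\<close> and
  \<open>g\<close> only if these are nearly orthogonal.\<close>

lemma nonorthogonal_alignment:
  assumes u: "dot3 u u = 1" "dot3 v v = 1" "dot3 u v = 0" and f: "dot3 f f = 1" "dot3 g g = 1"
  shows "(dot3 f g)\<^sup>2 \<le> 2 * (1 - (dot3 u f)\<^sup>2) + 2 * (1 - (dot3 v g)\<^sup>2)"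
proof -
  define q where "q = dot3 v g"
  define h where "h i = g i - q * v i" for i
  have hh: "dot3 h h = 1 - q\<^sup>2"
  proof -
    have "dot3 h h = dot3 g g - 2 * q * dot3 v g + q\<^sup>2 * dot3 v v"
      unfolding h_def dot3_def by (simp add: algebra_simps power2_eq_square)
    then show ?thesis using u f by (simp add: q_def power2_eq_square)
  qed
  have "dot3 f g = q * dot3 v f + dot3 f h" unfolding h_def dot3_def by (simp add: algebra_simps)
  then have "(dot3 f g)\<^sup>2 \<le> 2 * (q * dot3 v f)\<^sup>2 + 2 * (dot3 f h)\<^sup>2"
    using sum_squares_bound[of "q * dot3 v f" "dot3 f h"] by (simp add: power2_sum)
  moreover have "(dot3 f h)\<^sup>2 \<le> 1 - q\<^sup>2" using dot3_cauchy_unit[OF f(1), of h] hh by simp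
  moreover have "(q * dot3 v f)\<^sup>2 \<le> 1 - (dot3 u f)\<^sup>2"
  proof -
    have "q\<^sup>2 \<le> 1" using dot3_cauchy_unit[OF u(2), of g] f by (simp add: q_def)
    then have "(q * dot3 v f)\<^sup>2 \<le> (dot3 v f)\<^sup>2" by (simp add: power_mult_distrib mult_left_le_one_le)
    then show ?thesis using dot3_bessel[OF u, of f] f by simp
  qed
  ultimately have "(dot3 f g)\<^sup>2 \<le> 2 * (1 - (dot3 u f)\<^sup>2) + 2 * (1 - q\<^sup>2)" by argo
  then show ?thesis unfolding q_def .
qed

text \<open>A quarter turn replaces the pair by \<open>g\<close> and \<open>- f\<close> and reverses
  the sign of the inner product, so the intermediate value theorem yields an angle where it
  vanishes.\<close>

lemma rotation_orthogonalizes: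
  "\<exists>c s :: real. c\<^sup>2 + s\<^sup>2 = 1 \<and> dot3 (\<lambda>i. c * f i + s * g i) (\<lambda>i. - s * f i + c * g i) = 0"
proof -
  define F where "F x = dot3 (\<lambda>i. cos x * f i + sin x * g i) (\<lambda>i. - sin x * f i + cos x * g i)" for x
  have cont: "continuous_on A F" for A unfolding F_def dot3_def by (intro continuous_intros)
  have F0: "F 0 = dot3 f g" "F (pi / 2) = - dot3 f g" by (simp_all add: F_def dot3_def algebra_simps)
  have "\<exists>x. F x = 0"
  proof (cases "dot3 f g \<le> 0")
    case True
    then show ?thesis using IVT'[of F 0 0 "pi/2"] F0 cont by auto
  next
    case False
    then show ?thesis using IVT2'[of F "pi/2" 0 0] F0 cont by auto
  qed
  then show ?thesis unfolding F_def by (metis sin_cos_squared_add2)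
qed

section \<open>Rotation matrices through their rows and columns\<close>

definition mrow :: "real mat \<Rightarrow> nat \<Rightarrow> nat \<Rightarrow> real" where "mrow Q i = (\<lambda>k. Q $$ (i,k))"
definition mcol :: "real mat \<Rightarrow> nat \<Rightarrow> nat \<Rightarrow> real" where "mcol Q j = (\<lambda>k. Q $$ (k,j))"

lemma mult_index_dot3:
  assumes "A \<in> carrier_mat 3 3" "B \<in> carrier_mat 3 3" "i < 3" "j < 3"
  shows "(A * B) $$ (i,j) = dot3 (mrow A i) (mcol B j)"
  unfolding mult_mat_index[OF assms] sum_lessThan_3 dot3_def mrow_def mcol_def ..

lemma SO3_carrier: "Q \<in> SO3 \<Longrightarrow> Q \<in> carrier_mat 3 3"
  by (simp add: SO3_def)

lemma SO3_transpose_mult: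
  assumes "Q \<in> SO3" shows "transpose_mat Q * Q = 1\<^sub>m 3"
  using assms mat_mult_left_right_inverse[of Q 3 "transpose_mat Q"] by (auto simp: SO3_def)

lemma SO3_rows:
  assumes Q: "Q \<in> SO3" and ij: "i < 3" "j < 3"
  shows "dot3 (mrow Q i) (mrow Q j) = (if i = j then 1 else 0)"
proof -
  have c: "Q \<in> carrier_mat 3 3" "transpose_mat Q \<in> carrier_mat 3 3" using Q by (auto simp: SO3_def)
  have "(Q * transpose_mat Q) $$ (i,j) = dot3 (mrow Q i) (mrow Q j)"
    unfolding mult_index_dot3[OF c ij] using c ij by (simp add: dot3_def mrow_def mcol_def)
  then show ?thesis using Q ij by (simp add: SO3_def)
qed

lemma SO3_cols:
  assumes Q: "Q \<in> SO3" and ij: "i < 3" "j < 3"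
  shows "dot3 (mcol Q i) (mcol Q j) = (if i = j then 1 else 0)"
proof -
  have c: "Q \<in> carrier_mat 3 3" "transpose_mat Q \<in> carrier_mat 3 3" using Q by (auto simp: SO3_def)
  have "(transpose_mat Q * Q) $$ (i,j) = dot3 (mcol Q i) (mcol Q j)"
    unfolding mult_index_dot3[OF c(2) c(1) ij] using c ij by (simp add: dot3_def mrow_def mcol_def)
  then show ?thesis using ij unfolding SO3_transpose_mult[OF Q] by simp
qed

lemma SO3_one: "1\<^sub>m 3 \<in> SO3"
  by (simp add: SO3_def)

lemma SO3_mult:
  assumes "P \<in> SO3" "Q \<in> SO3" shows "P * Q \<in> SO3"
proof -
  have c: "P \<in> carrier_mat 3 3" "Q \<in> carrier_mat 3 3" "transpose_mat P \<in> carrier_mat 3 3" "transpose_mat Q \<in> carrier_mat 3 3"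
    using assms by (auto simp: SO3_def)
  have "P * Q * transpose_mat (P * Q) = P * (Q * transpose_mat Q) * transpose_mat P"
    using c by (simp add: transpose_mult[of P 3 3 Q 3] assoc_mult_mat[of _ 3 3 _ 3 _ 3])
  then show ?thesis using assms c det_mult[of P 3 Q] by (simp add: SO3_def)
qed

lemma SO3_transpose:
  assumes "Q \<in> SO3" shows "transpose_mat Q \<in> SO3"
  using assms SO3_transpose_mult[OF assms] det_transpose[of Q 3] by (simp add: SO3_def)

text \<open>The third row is the cross product up to a sign \<open>e\<close>. Both signs give
  orthogonal matrices and their determinants are opposite, so one of them is a rotation; no
  determinant has to be expanded.\<close>

lemma SO3_of_rows:
  assumes u: "dot3 u u = 1" "dot3 v v = 1" "dot3 u v = 0"
  shows "\<exists>Q \<in> SO3. \<forall>j<3. mrow Q 0 j = u j \<and> mrow Q 1 j = v j"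
proof -
  define w where "w = (\<lambda>i :: nat. if i = 0 then u 1 * v 2 - u 2 * v 1 else if i = 1 then u 2 * v 0 - u 0 * v 2
    else u 0 * v 1 - u 1 * v 0)"
  have w: "dot3 u w = 0" "dot3 v w = 0" by (simp_all add: dot3_def w_def algebra_simps)
  have "dot3 w w = dot3 u u * dot3 v v - (dot3 u v)\<^sup>2"
    by (simp add: dot3_def w_def algebra_simps power2_eq_square)
  then have ww: "dot3 w w = 1" using u by simp
  define Q where "Q e = mat 3 3 (\<lambda>(i,j). if i = 0 then u j else if i = 1 then v j else e * w j)" for e :: real
  have Qc: "Q e \<in> carrier_mat 3 3" for e by (simp add: Q_def)
  have QQ: "Q e * transpose_mat (Q e) = 1\<^sub>m 3" if e: "e * e = 1" for e
  proof (rule eq_matI)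
    fix i j assume "i < dim_row (1\<^sub>m 3 :: real mat)" "j < dim_col (1\<^sub>m 3 :: real mat)"
    then have ij: "i < 3" "j < 3" by auto
    have r: "mrow (Q e) 0 0 = u 0" "mrow (Q e) 0 1 = u 1" "mrow (Q e) 0 2 = u 2"
      "mrow (Q e) 1 0 = v 0" "mrow (Q e) 1 1 = v 1" "mrow (Q e) 1 2 = v 2"
      "mrow (Q e) 2 0 = e * w 0" "mrow (Q e) 2 1 = e * w 1" "mrow (Q e) 2 2 = e * w 2"
      by (simp_all add: mrow_def Q_def)
    have ee: "e * x * (e * y) = x * y" for x y using e by (metis mult.assoc mult.commute mult.left_neutral)
    have ew: "e * w 0 * (e * w 0) + e * w 1 * (e * w 1) + e * w 2 * (e * w 2) = 1" unfolding ee using ww by (simp add: dot3_def)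
    have "(Q e * transpose_mat (Q e)) $$ (i,j) = dot3 (mrow (Q e) i) (mrow (Q e) j)"
      unfolding mult_index_dot3[OF Qc transpose_carrier_mat[THEN iffD2, OF Qc] ij]
      using Qc[of e] ij by (simp add: dot3_def mrow_def mcol_def)
    also have "\<dots> = (if i = j then 1 else 0)"
    proof -
      have o: "u 0 * v 0 + u 1 * v 1 + u 2 * v 2 = 0" "u 0 * w 0 + u 1 * w 1 + u 2 * w 2 = 0" "v 0 * w 0 + v 1 * w 1 + v 2 * w 2 = 0"
        using u w by (simp_all add: dot3_def)
      have o': "x 0 * (e * w 0) + x 1 * (e * w 1) + x 2 * (e * w 2) = e * (x 0 * w 0 + x 1 * w 1 + x 2 * w 2)"
         "e * w 0 * x 0 + e * w 1 * x 1 + e * w 2 * x 2 = e * (x 0 * w 0 + x 1 * w 1 + x 2 * w 2)" for x :: "nat \<Rightarrow> real"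
        by (simp_all add: algebra_simps)
      have "i = 0 \<or> i = 1 \<or> i = 2" "j = 0 \<or> j = 1 \<or> j = 2" using ij by auto
      moreover have "u 0 * u 0 + u 1 * u 1 + u 2 * u 2 = 1" "v 0 * v 0 + v 1 * v 1 + v 2 * v 2 = 1"
        "v 0 * u 0 + v 1 * u 1 + v 2 * u 2 = 0"
        using u o by (simp_all add: dot3_def mult.commute)
      ultimately show ?thesis
        by (elim disjE; hypsubst; simp only: dot3_def; simp only: r o o' ew; simp)
    qed
    finally show "(Q e * transpose_mat (Q e)) $$ (i,j) = 1\<^sub>m 3 $$ (i,j)" using ij by simp
  qed (auto simp: Q_def)
  have neg: "Q (-1) = multrow 2 (-1) (Q 1)" by (rule eq_matI) (auto simp: Q_def)
  have "det (Q 1) * det (Q 1) = 1"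
    using det_mult[OF Qc transpose_carrier_mat[THEN iffD2, OF Qc], of 1 1] QQ[of 1] det_transpose[OF Qc, of 1] by simp
  then have "det (Q 1) = 1 \<or> det (Q (-1)) = 1"
    unfolding neg using det_multrow[of 2 3 "Q 1" "-1"] Qc[of 1] by (auto simp: square_eq_1_iff)
  then have "Q 1 \<in> SO3 \<or> Q (-1) \<in> SO3" using QQ[of 1] QQ[of "-1"] Qc by (auto simp: SO3_def)
  moreover have "\<forall>j<3. mrow (Q e) 0 j = u j \<and> mrow (Q e) 1 j = v j" for e by (simp add: mrow_def Q_def)
  ultimately show ?thesis by blast
qed

section \<open>Minimal key rates\<close>

text \<open>The consequence of complete positivity on which the minima are built. It passes to
  rotated matrices by orthogonality alone, without Kraus operators for the rotations.\<close>

definition stokes_contraction :: "real mat \<Rightarrow> bool" where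
  "stokes_contraction S \<longleftrightarrow> S \<in> carrier_mat 3 3 \<and>
     (\<forall>u v. dot3 u u = 1 \<longrightarrow> dot3 v v = 1 \<longrightarrow> \<bar>dot3 u (\<lambda>i. dot3 (mrow S i) v)\<bar> \<le> 1)"

lemma stokes_contractionD:
  assumes "stokes_contraction S"
  shows "S \<in> carrier_mat 3 3" "dot3 u u = 1 \<Longrightarrow> dot3 v v = 1 \<Longrightarrow> \<bar>dot3 u (\<lambda>i. dot3 (mrow S i) v)\<bar> \<le> 1"
  using assms by (auto simp: stokes_contraction_def)

lemma qubit_channel_contraction:
  assumes "qubit_channel R t"
  shows "stokes_contraction R"
  unfolding stokes_contraction_def
proof (intro conjI allI impI)
  show "R \<in> carrier_mat 3 3" using assms by (simp add: qubit_channel_def)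
  fix u v assume u: "dot3 u u = 1" and v: "dot3 v v = 1"
  have "(v 0)\<^sup>2 + (v 1)\<^sup>2 + (v 2)\<^sup>2 = 1" "(u 0)\<^sup>2 + (u 1)\<^sup>2 + (u 2)\<^sup>2 = 1"
    using u v by (simp_all add: dot3_def power2_eq_square)
  from stokes_bilinear_bound[OF assms this]
  show "\<bar>dot3 u (\<lambda>i. dot3 (mrow R i) v)\<bar> \<le> 1" by (simp add: dot3_def mrow_def)
qed

lemma SO3_preserves_dot3:
  assumes Q: "Q \<in> SO3"
  shows "dot3 (\<lambda>i. dot3 (mrow Q i) f) (\<lambda>i. dot3 (mrow Q i) g) = dot3 f g"
proof -
  have "dot3 (\<lambda>i. dot3 (mrow Q i) f) (\<lambda>i. dot3 (mrow Q i) g)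
     = f 0 * g 0 * dot3 (mcol Q 0) (mcol Q 0) + f 1 * g 1 * dot3 (mcol Q 1) (mcol Q 1) + f 2 * g 2 * dot3 (mcol Q 2) (mcol Q 2)
     + (f 0 * g 1 + f 1 * g 0) * dot3 (mcol Q 0) (mcol Q 1) + (f 0 * g 2 + f 2 * g 0) * dot3 (mcol Q 0) (mcol Q 2)
     + (f 1 * g 2 + f 2 * g 1) * dot3 (mcol Q 1) (mcol Q 2)"
    unfolding dot3_def mrow_def mcol_def by (simp add: algebra_simps)
  also have "\<dots> = dot3 f g" by (simp add: SO3_cols[OF Q] dot3_def[of f g])
  finally show ?thesis .
qed

lemma SO3_preserves_dot3_transpose:
  assumes Q: "Q \<in> SO3"
  shows "dot3 (\<lambda>k. dot3 u (mcol Q k)) (\<lambda>k. dot3 u (mcol Q k)) = dot3 u u"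
proof -
  have "dot3 (mrow (transpose_mat Q) k) u = dot3 u (mcol Q k)" if "k < 3" for k
    using SO3_carrier[OF Q] that by (simp add: dot3_def mrow_def mcol_def)
  then have "dot3 (\<lambda>k. dot3 u (mcol Q k)) (\<lambda>k. dot3 u (mcol Q k))
     = dot3 (\<lambda>k. dot3 (mrow (transpose_mat Q) k) u) (\<lambda>k. dot3 (mrow (transpose_mat Q) k) u)"
    unfolding dot3_def[of "\<lambda>k. dot3 u (mcol Q k)"] dot3_def[of "\<lambda>k. dot3 (mrow (transpose_mat Q) k) u"] by simp
  then show ?thesis using SO3_preserves_dot3[OF SO3_transpose[OF Q]] by simp
qed

lemma stokes_contraction_left:
  assumes Q: "Q \<in> SO3" and S: "stokes_contraction S"
  shows "stokes_contraction (Q * S)"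
  unfolding stokes_contraction_def
proof (intro conjI allI impI)
  note c = SO3_carrier[OF Q] stokes_contractionD(1)[OF S]
  show "Q * S \<in> carrier_mat 3 3" using c by simp
  fix u v assume u: "dot3 u u = 1" and v: "dot3 v v = 1"
  have "mrow (Q * S) i k = dot3 (mrow Q i) (mcol S k)" if "i < 3" "k < 3" for i k
    using mult_index_dot3[OF c that] by (simp add: mrow_def del: index_mult_mat(1))
  then have "dot3 u (\<lambda>i. dot3 (mrow (Q * S) i) v) = dot3 (\<lambda>k. dot3 u (mcol Q k)) (\<lambda>k. dot3 (mrow S k) v)"
    unfolding dot3_def[of u "\<lambda>i. dot3 (mrow (Q * S) i) v"] dot3_def[of "mrow (Q * S) _" v]
    by (simp add: dot3_def mrow_def mcol_def algebra_simps del: index_mult_mat(1))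
  then show "\<bar>dot3 u (\<lambda>i. dot3 (mrow (Q * S) i) v)\<bar> \<le> 1"
    using stokes_contractionD(2)[OF S _ v, of "\<lambda>k. dot3 u (mcol Q k)"] SO3_preserves_dot3_transpose[OF Q, of u] u by simp
qed

lemma stokes_contraction_right:
  assumes Q: "Q \<in> SO3" and S: "stokes_contraction S"
  shows "stokes_contraction (S * Q)"
  unfolding stokes_contraction_def
proof (intro conjI allI impI)
  note c = stokes_contractionD(1)[OF S] SO3_carrier[OF Q]
  show "S * Q \<in> carrier_mat 3 3" using c by simp
  fix u v assume u: "dot3 u u = 1" and v: "dot3 v v = 1"
  have "mrow (S * Q) i k = dot3 (mrow S i) (mcol Q k)" if "i < 3" "k < 3" for i k
    using mult_index_dot3[OF c that] by (simp add: mrow_def del: index_mult_mat(1))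
  then have "dot3 u (\<lambda>i. dot3 (mrow (S * Q) i) v) = dot3 u (\<lambda>i. dot3 (mrow S i) (\<lambda>k. dot3 (mrow Q k) v))"
    unfolding dot3_def[of u "\<lambda>i. dot3 (mrow (S * Q) i) v"] dot3_def[of "mrow (S * Q) _" v]
    by (simp add: dot3_def mrow_def mcol_def algebra_simps del: index_mult_mat(1))
  then show "\<bar>dot3 u (\<lambda>i. dot3 (mrow (S * Q) i) v)\<bar> \<le> 1"
    using stokes_contractionD(2)[OF S u, of "\<lambda>k. dot3 (mrow Q k) v"] SO3_preserves_dot3[OF Q, of v v] v by simp
qed

lemma stokes_contraction_diag:
  assumes "stokes_contraction S"
  shows "\<bar>S $$ (0,0)\<bar> \<le> 1" "\<bar>S $$ (1,1)\<bar> \<le> 1"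
  using stokes_contractionD(2)[OF assms, of "\<lambda>i. if i = 0 then 1 else 0" "\<lambda>i. if i = 0 then 1 else 0"]
    stokes_contractionD(2)[OF assms, of "\<lambda>i. if i = 1 then 1 else 0" "\<lambda>i. if i = 1 then 1 else 0"]
  by (simp_all add: dot3_def mrow_def)

lemma stokes_contraction_col:
  assumes S: "stokes_contraction S" and j: "j < 3"
  shows "dot3 (mcol S j) (mcol S j) \<le> 1"
proof (cases "dot3 (mcol S j) (mcol S j) = 0")
  case False
  then obtain u where u: "dot3 u u = 1" "dot3 u (mcol S j) = sqrt (dot3 (mcol S j) (mcol S j))"
    using normalize3 by blast
  define e where "e i = (if i = j then 1 else 0 :: real)" for i
  have "j = 0 \<or> j = 1 \<or> j = 2" using j by auto
  then have "dot3 e e = 1" "\<And>i. dot3 (mrow S i) e = mcol S j i" by (auto simp: e_def dot3_def mrow_def mcol_def)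
  then have "\<bar>dot3 u (mcol S j)\<bar> \<le> 1"
    using stokes_contractionD(2)[OF S u(1), of e] by simp
  then show ?thesis unfolding u(2) by simp
qed simp

section \<open>Minima over the two parameter sets\<close>

lemma P_bc_lower:
  assumes "F \<in> P_bc (mu_bc S)"
  shows "1 - hbin (S $$ (0,0)) - hbin (S $$ (1,1)) \<le> Kkey (fst F) (snd F)"
  using assms Kkey_lower_bound[of "fst F" "snd F" 0 1] by (auto simp: P_bc_def mu_bc_def)

lemma P_ba_lower:
  assumes "F \<in> P_ba (omega_ba S t)" "wz\<^sup>2 + wx\<^sup>2 = 1"
  shows "1 - hbin (S $$ (0,0)) - hbin (wz * S $$ (0,1) + wx * S $$ (1,1)) \<le> Kkey (fst F) (snd F)"
  using assms Kkey_lower_bound[of "fst F" "snd F" wz wx] by (auto simp: P_ba_def omega_ba_def)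

lemma minK_bc_eq:
  assumes "\<bar>S $$ (0,0)\<bar> \<le> 1" "\<bar>S $$ (1,1)\<bar> \<le> 1"
  shows "minK_bc S t = 1 - hbin (S $$ (0,0)) - hbin (S $$ (1,1))"
proof -
  \<comment> \<open>The minimizer is a Pauli channel; its third entry is the product required by
    \<open>product_channel\<close>.\<close>
  define D where "D = mat 3 3 (\<lambda>(i,j). if i = 0 \<and> j = 0 then S $$ (0,0) else if i = 1 \<and> j = 1 then S $$ (1,1)
    else if i = 2 \<and> j = 2 then S $$ (0,0) * S $$ (1,1) else 0)"
  have "qubit_channel D (0\<^sub>v 3) \<and> Kkey D (0\<^sub>v 3) \<le> 1 - hbin (S $$ (0,0)) - hbin (S $$ (1,1))"
    by (rule product_channel[where al = "\<lambda>i. if i = 0 then 1 else 0" and be = "\<lambda>i. if i = 1 then 1 else 0" and c = 1 and s = 0])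
       (use assms in \<open>auto simp: D_def\<close>)
  moreover have "mu_bc D = mu_bc S" by (simp add: mu_bc_def D_def)
  ultimately have D: "(D, 0\<^sub>v 3) \<in> P_bc (mu_bc S)" "Kkey D (0\<^sub>v 3) \<le> 1 - hbin (S $$ (0,0)) - hbin (S $$ (1,1))"
    by (auto simp: P_bc_def)
  have bdd: "bdd_below ((\<lambda>F. Kkey (fst F) (snd F)) ` P_bc (mu_bc S))"
    using P_bc_lower[of _ S] by (intro bdd_belowI2) auto
  show ?thesis unfolding minK_bc_def
  proof (rule antisym)
    show "(INF F\<in>P_bc (mu_bc S). Kkey (fst F) (snd F)) \<le> 1 - hbin (S $$ (0,0)) - hbin (S $$ (1,1))"
      using cINF_lower[OF bdd D(1)] D(2) by simp
    show "1 - hbin (S $$ (0,0)) - hbin (S $$ (1,1)) \<le> (INF F\<in>P_bc (mu_bc S). Kkey (fst F) (snd F))"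
      using D(1) P_bc_lower[of _ S] by (intro cINF_greatest) auto
  qed
qed

text \<open>An angle that makes the first two columns orthogonal exposes their singular values
  \<open>a\<close> and \<open>b\<close>. The witness also shows that the set is nonempty, without
  which its infimum would say nothing.\<close>

lemma minK_ba_upper_decomp:
  assumes S: "stokes_contraction S" and cs: "c\<^sup>2 + s\<^sup>2 = 1"
    and orth: "dot3 (\<lambda>i. c * S $$ (i,0) + s * S $$ (i,1)) (\<lambda>i. - s * S $$ (i,0) + c * S $$ (i,1)) = 0"
  shows "\<exists>u v a b. dot3 u u = 1 \<and> dot3 v v = 1 \<and> dot3 u v = 0 \<and> \<bar>a\<bar> \<le> 1 \<and> \<bar>b\<bar> \<le> 1 \<and>
    (\<forall>i<3. c * S $$ (i,0) + s * S $$ (i,1) = a * u i \<and> - s * S $$ (i,0) + c * S $$ (i,1) = b * v i) \<and>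
    minK_ba S (0\<^sub>v 3) \<le> 1 - hbin a - hbin b \<and> P_ba (omega_ba S (0\<^sub>v 3)) \<noteq> {}"
proof -
  obtain u v a b where u: "dot3 u u = 1" "dot3 v v = 1" "dot3 u v = 0"
    and ab: "\<forall>i<3. c * S $$ (i,0) + s * S $$ (i,1) = a * u i \<and> - s * S $$ (i,0) + c * S $$ (i,1) = b * v i"
    using orthogonal_pair_decomp[OF orth] by blast
  have cs': "c * c + s * s = 1" using cs by (simp add: power2_eq_square)
  \<comment> \<open>\<open>x\<close> is the matrix element of \<open>S\<close> between the unit
    input direction \<open>(z0, z1, 0)\<close> and the unit output direction
    \<open>y\<close>.\<close>
  have bound: "\<bar>x\<bar> \<le> 1" if y: "dot3 y y = 1" and z: "z0 * z0 + z1 * z1 = 1"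
    and x: "\<And>i. i < 3 \<Longrightarrow> z0 * S $$ (i,0) + z1 * S $$ (i,1) = x * y i" for x y z0 z1
  proof -
    define n where "n i = (if i = 0 then z0 else if i = 1 then z1 else 0)" for i :: nat
    have "dot3 n n = 1" using z by (simp add: dot3_def n_def)
    then have "\<bar>dot3 y (\<lambda>i. dot3 (mrow S i) n)\<bar> \<le> 1" using stokes_contractionD(2)[OF S y] by simp
    moreover have "dot3 (mrow S i) n = x * y i" if "i < 3" for i
      using x[OF that] by (simp add: dot3_def mrow_def n_def mult.commute)
    then have "dot3 y (\<lambda>i. dot3 (mrow S i) n) = x * dot3 y y"
      unfolding dot3_def[of y "\<lambda>i. dot3 (mrow S i) n"] by (simp add: dot3_def[of y y] algebra_simps)
    ultimately show ?thesis using y by simp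
  qed
  have a1: "\<bar>a\<bar> \<le> 1" using ab cs' by (intro bound[OF u(1)]) auto
  have b1: "\<bar>b\<bar> \<le> 1" using ab cs' by (intro bound[OF u(2), of "- s" c]) auto
  have S0: "S $$ (i,0) = a * u i * c - b * v i * s" and S1: "S $$ (i,1) = a * u i * s + b * v i * c" if "i < 3" for i
  proof -
    have e: "a * u i = c * S $$ (i,0) + s * S $$ (i,1)" "b * v i = - s * S $$ (i,0) + c * S $$ (i,1)" using ab that by auto
    have "a * u i * c - b * v i * s = (c * c + s * s) * S $$ (i,0)" unfolding e by (simp add: algebra_simps)
    then show "S $$ (i,0) = a * u i * c - b * v i * s" using cs' by simp
    have "a * u i * s + b * v i * c = (c * c + s * s) * S $$ (i,1)" unfolding e by (simp add: algebra_simps)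
    then show "S $$ (i,1) = a * u i * s + b * v i * c" using cs' by simp
  qed
  \<comment> \<open>Only the third column changes, and \<open>omega_ba\<close> does not see
    it.\<close>
  define C where "C = mat 3 3 (\<lambda>(i,j). if j < 2 then S $$ (i,j) else
     a * b * (if i = 0 then u 1 * v 2 - u 2 * v 1 else if i = 1 then u 2 * v 0 - u 0 * v 2 else u 0 * v 1 - u 1 * v 0))"
  have "qubit_channel C (0\<^sub>v 3) \<and> Kkey C (0\<^sub>v 3) \<le> 1 - hbin a - hbin b"
  proof (rule product_channel[where al = u and be = v and c = c and s = s])
    show "(u 0)\<^sup>2 + (u 1)\<^sup>2 + (u 2)\<^sup>2 = 1" "(v 0)\<^sup>2 + (v 1)\<^sup>2 + (v 2)\<^sup>2 = 1" "u 0 * v 0 + u 1 * v 1 + u 2 * v 2 = 0"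
      using u by (simp_all add: dot3_def power2_eq_square)
    show "C $$ (i,0) = a * u i * c - b * v i * s" if "i < 3" for i using S0[OF that] that by (simp add: C_def)
    show "C $$ (i,1) = a * u i * s + b * v i * c" if "i < 3" for i using S1[OF that] that by (simp add: C_def)
  qed (use cs a1 b1 in \<open>auto simp: C_def\<close>)
  moreover have "omega_ba C (0\<^sub>v 3) = omega_ba S (0\<^sub>v 3)" by (simp add: omega_ba_def C_def)
  ultimately have C: "(C, 0\<^sub>v 3) \<in> P_ba (omega_ba S (0\<^sub>v 3))" "Kkey C (0\<^sub>v 3) \<le> 1 - hbin a - hbin b"
    by (auto simp: P_ba_def)
  have "bdd_below ((\<lambda>F. Kkey (fst F) (snd F)) ` P_ba (omega_ba S (0\<^sub>v 3)))"
    using P_ba_lower[of _ S "0\<^sub>v 3" 0 1] by (intro bdd_belowI2) auto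
  from cINF_lower[OF this C(1)] C(2) have "minK_ba S (0\<^sub>v 3) \<le> 1 - hbin a - hbin b"
    unfolding minK_ba_def by simp
  then show ?thesis using u ab a1 b1 C(1) by blast
qed

text \<open>\<open>T\<close> turns the input within the z-x plane, and \<open>Q\<close> has the
  singular directions as its first two rows. The singular values thereby become diagonal entries,
  and the bound takes the form of a \<open>minK_bc\<close> value at a rotated matrix.\<close>

lemma minK_ba_upper:
  assumes S: "stokes_contraction S" and T: "T \<in> SO3"
    and Tp: "T $$ (2,0) = 0" "T $$ (2,1) = 0" "T $$ (0,1) = - T $$ (1,0)" "T $$ (1,1) = T $$ (0,0)"
    and orth: "dot3 (mcol (S * T) 0) (mcol (S * T) 1) = 0"
  shows "\<exists>Q \<in> SO3. minK_ba S (0\<^sub>v 3) \<le> 1 - hbin ((Q * (S * T)) $$ (0,0)) - hbin ((Q * (S * T)) $$ (1,1))"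
proof -
  define c where "c = T $$ (0,0)"
  define s where "s = T $$ (1,0)"
  note Sc = stokes_contractionD(1)[OF S] and Tc = SO3_carrier[OF T]
  have cs: "c\<^sup>2 + s\<^sup>2 = 1" using SO3_cols[OF T, of 0 0] Tp by (simp add: dot3_def mcol_def power2_eq_square c_def s_def)
  have ST: "mcol (S * T) 0 i = c * S $$ (i,0) + s * S $$ (i,1)" "mcol (S * T) 1 i = - s * S $$ (i,0) + c * S $$ (i,1)" if "i < 3" for i
    unfolding mcol_def mult_index_dot3[OF Sc Tc that] using Tp
    by (simp_all add: mult_index_dot3[OF Sc Tc that] dot3_def mrow_def mcol_def c_def s_def mult.commute del: index_mult_mat(1))
  have "dot3 (\<lambda>i. c * S $$ (i,0) + s * S $$ (i,1)) (\<lambda>i. - s * S $$ (i,0) + c * S $$ (i,1)) = 0"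
    using orth unfolding dot3_def by (simp only: ST numeral_less_iff) (simp add: ST[unfolded One_nat_def])
  from minK_ba_upper_decomp[OF S cs this] obtain u v a b where u: "dot3 u u = 1" "dot3 v v = 1" "dot3 u v = 0"
    and ab: "\<forall>i<3. c * S $$ (i,0) + s * S $$ (i,1) = a * u i \<and> - s * S $$ (i,0) + c * S $$ (i,1) = b * v i"
    and le: "minK_ba S (0\<^sub>v 3) \<le> 1 - hbin a - hbin b" by blast
  obtain Q where Q: "Q \<in> SO3" "\<forall>j<3. mrow Q 0 j = u j \<and> mrow Q 1 j = v j" using SO3_of_rows[OF u] by blast
  note Qc = SO3_carrier[OF Q(1)]
  have STc: "S * T \<in> carrier_mat 3 3" using Sc Tc by simp
  have m: "mcol (S * T) 0 i = a * u i" "mcol (S * T) 1 i = b * v i" if "i < 3" for i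
    using ST[OF that] ab that by auto
  have "(Q * (S * T)) $$ (0,0) = dot3 (mrow Q 0) (mcol (S * T) 0)" by (rule mult_index_dot3[OF Qc STc]) auto
  also have "\<dots> = a * dot3 u u" unfolding dot3_def using m(1) Q(2) by (simp add: algebra_simps)
  finally have q0: "(Q * (S * T)) $$ (0,0) = a" using u by simp
  have "(Q * (S * T)) $$ (1,1) = dot3 (mrow Q 1) (mcol (S * T) 1)" by (rule mult_index_dot3[OF Qc STc]) auto
  also have "\<dots> = b * dot3 v v" unfolding dot3_def using m(2) Q(2) by (simp add: algebra_simps)
  finally have q1: "(Q * (S * T)) $$ (1,1) = b" using u by simp
  show ?thesis using le Q(1) unfolding q0[symmetric] q1[symmetric] by blast
qed

lemma minK_ba_le_rotated:
  assumes S: "stokes_contraction S"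
  shows "\<exists>Q \<in> SO3. \<exists>T \<in> SO3. minK_ba S (0\<^sub>v 3) \<le> 1 - hbin ((Q * (S * T)) $$ (0,0)) - hbin ((Q * (S * T)) $$ (1,1))"
proof -
  obtain c s :: real where cs: "c\<^sup>2 + s\<^sup>2 = 1"
    and o: "dot3 (\<lambda>i. c * mcol S 0 i + s * mcol S 1 i) (\<lambda>i. - s * mcol S 0 i + c * mcol S 1 i) = 0"
    using rotation_orthogonalizes[of "mcol S 0" "mcol S 1"] by blast
  have cs': "c * c + s * s = 1" using cs by (simp add: power2_eq_square)
  define u where "u i = (if i = 0 then c else if i = 1 then - s else 0)" for i :: nat
  define v where "v i = (if i = 0 then s else if i = 1 then c else 0)" for i :: nat
  have "dot3 u u = 1" "dot3 v v = 1" "dot3 u v = 0" using cs' by (simp_all add: dot3_def u_def v_def add.commute)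
  then obtain T where T: "T \<in> SO3" "\<forall>j<3. mrow T 0 j = u j \<and> mrow T 1 j = v j" using SO3_of_rows by blast
  have Te: "T $$ (0,0) = c" "T $$ (0,1) = - s" "T $$ (1,0) = s" "T $$ (1,1) = c"
    using T(2) unfolding mrow_def u_def v_def by (simp_all)
  \<comment> \<open>The entries \<open>c\<close> and \<open>s\<close> already exhaust the unit norm
    of each column.\<close>
  have "T $$ (2,0) * T $$ (2,0) = 0" using SO3_cols[OF T(1), of 0 0] cs' Te by (simp add: dot3_def mcol_def)
  then have T20: "T $$ (2,0) = 0" by simp
  have "s * s + c * c + T $$ (2,1) * T $$ (2,1) = 1" using SO3_cols[OF T(1), of 1 1] Te by (simp add: dot3_def mcol_def)
  then have "T $$ (2,1) * T $$ (2,1) = 0" using cs' by linarith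
  then have T21: "T $$ (2,1) = 0" by simp
  note Sc = stokes_contractionD(1)[OF S] and Tc = SO3_carrier[OF T(1)]
  have ST: "mcol (S * T) 0 i = c * mcol S 0 i + s * mcol S 1 i" "mcol (S * T) 1 i = - s * mcol S 0 i + c * mcol S 1 i" if "i < 3" for i
  proof -
    have "mcol (S * T) 0 i = dot3 (mrow S i) (mcol T 0)" "mcol (S * T) 1 i = dot3 (mrow S i) (mcol T 1)"
      unfolding mcol_def[of "S * T"] by (rule mult_index_dot3[OF Sc Tc that], simp)+
    then show "mcol (S * T) 0 i = c * mcol S 0 i + s * mcol S 1 i" "mcol (S * T) 1 i = - s * mcol S 0 i + c * mcol S 1 i"
      using T20 T21 Te by (simp_all add: dot3_def mrow_def mcol_def mult.commute)
  qed
  have "dot3 (mcol (S * T) 0) (mcol (S * T) 1) = 0"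
    using o unfolding dot3_def[of "mcol (S * T) 0"] by (subst (1 2 3) ST; simp?)+ (simp add: dot3_def)
  from minK_ba_upper[OF S T(1) T20 T21 _ _ this] show ?thesis using T(1) Te by auto
qed

text \<open>\<open>S\<close> is only known to be a contraction here, so a member has to be
  constructed rather than taken to be \<open>S\<close> itself.\<close>

lemma P_ba_nonempty:
  assumes S: "stokes_contraction S"
  shows "P_ba (omega_ba S (0\<^sub>v 3)) \<noteq> {}"
proof -
  obtain c s :: real where cs: "c\<^sup>2 + s\<^sup>2 = 1"
    and o: "dot3 (\<lambda>i. c * mcol S 0 i + s * mcol S 1 i) (\<lambda>i. - s * mcol S 0 i + c * mcol S 1 i) = 0"
    using rotation_orthogonalizes[of "mcol S 0" "mcol S 1"] by blast
  then show ?thesis using minK_ba_upper_decomp[OF S cs] unfolding mcol_def by blast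
qed

lemma minK_ba_lower:
  assumes S: "stokes_contraction S" and w: "wz\<^sup>2 + wx\<^sup>2 = 1"
  shows "1 - hbin (S $$ (0,0)) - hbin (wz * S $$ (0,1) + wx * S $$ (1,1)) \<le> minK_ba S (0\<^sub>v 3)"
  unfolding minK_ba_def using P_ba_lower[OF _ w] by (intro cINF_greatest P_ba_nonempty S) auto

lemma SO3_mult_zero: "Q \<in> SO3 \<Longrightarrow> Q *\<^sub>v 0\<^sub>v 3 = 0\<^sub>v 3"
  using SO3_carrier[of Q] by (intro eq_vecI) auto

lemma SO3_mult_col_dot:
  assumes Q: "Q \<in> SO3" and M: "M \<in> carrier_mat 3 3" and jk: "j < 3" "k < 3"
  shows "dot3 (mcol (Q * M) j) (mcol (Q * M) k) = dot3 (mcol M j) (mcol M k)"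
proof -
  note Qc = SO3_carrier[OF Q]
  have m: "mcol (Q * M) j i = dot3 (mrow Q i) (mcol M j)" "mcol (Q * M) k i = dot3 (mrow Q i) (mcol M k)" if "i < 3" for i
    unfolding mcol_def[of "Q * M"] using mult_index_dot3[OF Qc M that] jk by auto
  define f g where "f = mcol M j" and "g = mcol M k"
  have "dot3 (mcol (Q * M) j) (mcol (Q * M) k) = dot3 (\<lambda>i. dot3 (mrow Q i) f) (\<lambda>i. dot3 (mrow Q i) g)"
    unfolding f_def g_def dot3_def[of "mcol (Q * M) j"] dot3_def[of "\<lambda>i. dot3 (mrow Q i) (mcol M j)"] by (simp add: m)
  also have "\<dots> = dot3 f g" by (rule SO3_preserves_dot3[OF Q])
  finally show ?thesis unfolding f_def g_def .
qed

lemma col_scalar_prod_dot3: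
  assumes "M \<in> carrier_mat 3 3" "j < 3" "k < 3"
  shows "col M j \<bullet> col M k = dot3 (mcol M j) (mcol M k)"
proof -
  have "col M j \<bullet> col M k = (\<Sum>i<3. M $$ (i,j) * M $$ (i,k))"
    using assms by (simp add: scalar_prod_def lessThan_atLeast0)
  then show ?thesis by (simp add: sum_lessThan_3 dot3_def mcol_def)
qed

section \<open>Diagonal entries and the comparison of the minima\<close>

lemma diag3_carrier [simp]: "diag3 a b c \<in> carrier_mat 3 3"
  by (simp add: diag3_def)

text \<open>Each diagonal entry is a sum of \<open>e0\<close>, \<open>e1\<close>, \<open>e2\<close>
  with weights bounded by \<open>d i k\<close>. Unit rows and columns together with the
  arithmetic-geometric mean inequality make these weights doubly substochastic.\<close>

lemma SO3_diag_ky_fan: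
  assumes P: "P \<in> SO3" and Q: "Q \<in> SO3" and e: "\<bar>e1\<bar> \<le> \<bar>e0\<bar>" "\<bar>e2\<bar> \<le> \<bar>e1\<bar>"
  defines "S \<equiv> P * diag3 e0 e1 e2 * Q"
  shows "\<bar>S $$ (0,0)\<bar> \<le> \<bar>e0\<bar>" "\<bar>S $$ (1,1)\<bar> \<le> \<bar>e0\<bar>" "\<bar>S $$ (0,0)\<bar> + \<bar>S $$ (1,1)\<bar> \<le> \<bar>e0\<bar> + \<bar>e1\<bar>"
proof -
  note Pc = SO3_carrier[OF P] and Qc = SO3_carrier[OF Q]
  have PD: "(P * diag3 e0 e1 e2) $$ (i,0) = P $$ (i,0) * e0" "(P * diag3 e0 e1 e2) $$ (i,1) = P $$ (i,1) * e1"
    "(P * diag3 e0 e1 e2) $$ (i,2) = P $$ (i,2) * e2" if "i < 3" for i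
    by (subst mult_index_dot3[OF Pc diag3_carrier that]; simp add: dot3_def mrow_def mcol_def diag3_def)+
  have Sij: "S $$ (i,j) = P $$ (i,0) * e0 * Q $$ (0,j) + P $$ (i,1) * e1 * Q $$ (1,j) + P $$ (i,2) * e2 * Q $$ (2,j)"
    if "i < 3" "j < 3" for i j
    unfolding S_def mult_index_dot3[OF mult_square_carrier[OF Pc diag3_carrier] Qc that] dot3_def
    using PD[OF that(1)] by (simp add: mrow_def mcol_def)
  define d where "d i k = \<bar>P $$ (i,k) * Q $$ (k,i)\<bar>" for i k
  have Sd: "\<bar>S $$ (i,i)\<bar> \<le> \<bar>e0\<bar> * d i 0 + \<bar>e1\<bar> * d i 1 + \<bar>e2\<bar> * d i 2" if "i < 3" for i
  proof -
    have "\<bar>S $$ (i,i)\<bar> \<le> \<bar>P $$ (i,0) * e0 * Q $$ (0,i)\<bar> + \<bar>P $$ (i,1) * e1 * Q $$ (1,i)\<bar> + \<bar>P $$ (i,2) * e2 * Q $$ (2,i)\<bar>"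
      unfolding Sij[OF that that] by linarith
    then show ?thesis unfolding d_def by (simp add: abs_mult mult_ac)
  qed
  have dd: "d i k \<le> ((P $$ (i,k))\<^sup>2 + (Q $$ (k,i))\<^sup>2) / 2" "0 \<le> d i k" for i k
    using sum_squares_bound[of "\<bar>P $$ (i,k)\<bar>" "\<bar>Q $$ (k,i)\<bar>"] by (simp_all add: d_def abs_mult)
  have Pr: "(P $$ (i,0))\<^sup>2 + (P $$ (i,1))\<^sup>2 + (P $$ (i,2))\<^sup>2 = 1" and Qcl: "(Q $$ (0,i))\<^sup>2 + (Q $$ (1,i))\<^sup>2 + (Q $$ (2,i))\<^sup>2 = 1"
    and Pcl: "(P $$ (0,i))\<^sup>2 + (P $$ (1,i))\<^sup>2 + (P $$ (2,i))\<^sup>2 = 1" and Qr: "(Q $$ (i,0))\<^sup>2 + (Q $$ (i,1))\<^sup>2 + (Q $$ (i,2))\<^sup>2 = 1"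
    if "i < 3" for i
    using SO3_rows[OF P that that] SO3_cols[OF Q that that] SO3_cols[OF P that that] SO3_rows[OF Q that that]
    by (simp_all add: dot3_def mrow_def mcol_def power2_eq_square)
  have sd: "d i 0 + d i 1 + d i 2 \<le> 1" if "i < 3" for i
    using dd(1)[of i 0] dd(1)[of i 1] dd(1)[of i 2] Pr[OF that] Qcl[OF that] by argo
  have ck: "d 0 k + d 1 k \<le> 1" if "k < 3" for k
  proof -
    have "0 \<le> (P $$ (2,k))\<^sup>2" "0 \<le> (Q $$ (k,2))\<^sup>2" by simp_all
    then show ?thesis using dd(1)[of 0 k] dd(1)[of 1 k] Pcl[OF that] Qr[OF that] by argo
  qed
  have one: "\<bar>S $$ (i,i)\<bar> \<le> \<bar>e0\<bar>" if "i < 3" for i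
  proof -
    have "\<bar>e1\<bar> * d i 1 \<le> \<bar>e0\<bar> * d i 1" "\<bar>e2\<bar> * d i 2 \<le> \<bar>e0\<bar> * d i 2" using e dd(2) by (auto intro!: mult_right_mono)
    then have "\<bar>S $$ (i,i)\<bar> \<le> \<bar>e0\<bar> * (d i 0 + d i 1 + d i 2)" using Sd[OF that] by (simp add: distrib_left)
    also have "\<dots> \<le> \<bar>e0\<bar>" using sd[OF that] by (simp add: mult_left_le)
    finally show ?thesis .
  qed
  show "\<bar>S $$ (0,0)\<bar> \<le> \<bar>e0\<bar>" "\<bar>S $$ (1,1)\<bar> \<le> \<bar>e0\<bar>" using one[of 0] one[of 1] by simp_all
  \<comment> \<open>Total weight that the first two diagonal entries place on each \<open>e\<close>.
    The first two weights are at most 1 and all three sum to at most 2, so the best filling uses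
    \<open>e0\<close> and \<open>e1\<close> once each.\<close>
  define k0 k1 k2 where k: "k0 = d 0 0 + d 1 0" "k1 = d 0 1 + d 1 1" "k2 = d 0 2 + d 1 2"
  have kk: "k0 \<le> 1" "k1 \<le> 1" "k2 \<ge> 0" "k0 + k1 + k2 \<le> 2"
    using ck[of 0] ck[of 1] dd(2)[of 0 2] dd(2)[of 1 2] sd[of 0] sd[of 1] unfolding k by simp_all
  have "\<bar>S $$ (0,0)\<bar> + \<bar>S $$ (1,1)\<bar> \<le> \<bar>e0\<bar> * k0 + \<bar>e1\<bar> * k1 + \<bar>e2\<bar> * k2"
    using Sd[of 0] Sd[of 1] unfolding k by (simp add: distrib_left)
  also have "\<dots> \<le> \<bar>e0\<bar> + \<bar>e1\<bar>"
  proof -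
    have "\<bar>e2\<bar> * k2 \<le> \<bar>e1\<bar> * k2" using e kk by (intro mult_right_mono) auto
    moreover have "\<bar>e1\<bar> * (1 - k0) \<le> \<bar>e0\<bar> * (1 - k0)" using e kk by (intro mult_right_mono) auto
    moreover have "\<bar>e1\<bar> * (k0 + k1 + k2) \<le> \<bar>e1\<bar> * 2" using kk by (intro mult_left_mono) auto
    ultimately show ?thesis by (simp add: algebra_simps)
  qed
  finally show "\<bar>S $$ (0,0)\<bar> + \<bar>S $$ (1,1)\<bar> \<le> \<bar>e0\<bar> + \<bar>e1\<bar>" .
qed

lemma stokes_contraction_rotated:
  "stokes_contraction R \<Longrightarrow> Q \<in> SO3 \<Longrightarrow> P \<in> SO3 \<Longrightarrow> stokes_contraction (Q * R * P)"
  by (intro stokes_contraction_right stokes_contraction_left)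

text \<open>The bounds by 1 make the suprema over rotations well behaved. The comparison is the
  direction (0, 1) of the lower bound and reflects that fixing more parameters leaves fewer
  channels.\<close>

lemma unital_minK_bounds:
  assumes S: "stokes_contraction S"
  shows "minK_bc S t = 1 - hbin (S $$ (0,0)) - hbin (S $$ (1,1))" "minK_bc S t \<le> 1"
    "minK_bc S t \<le> minK_ba S (0\<^sub>v 3)" "minK_ba S (0\<^sub>v 3) \<le> 1"
proof -
  note d = stokes_contraction_diag[OF S]
  show e: "minK_bc S t = 1 - hbin (S $$ (0,0)) - hbin (S $$ (1,1))" for t by (rule minK_bc_eq[OF d])
  show "minK_bc S t \<le> 1" unfolding e using hbin_nonneg[OF d(1)] hbin_nonneg[OF d(2)] by simp
  show "minK_bc S t \<le> minK_ba S (0\<^sub>v 3)" unfolding e using minK_ba_lower[OF S, of 0 1] by simp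
  obtain Q T where Q: "Q \<in> SO3" "T \<in> SO3"
    and le: "minK_ba S (0\<^sub>v 3) \<le> 1 - hbin ((Q * (S * T)) $$ (0,0)) - hbin ((Q * (S * T)) $$ (1,1))"
    using minK_ba_le_rotated[OF S] by blast
  note d' = stokes_contraction_diag[OF stokes_contraction_left[OF Q(1) stokes_contraction_right[OF Q(2) S]]]
  show "minK_ba S (0\<^sub>v 3) \<le> 1" using le hbin_nonneg[OF d'(1)] hbin_nonneg[OF d'(2)] by simp
qed

section \<open>Suprema over compensating rotations\<close>

lemma J1_bounds:
  assumes R: "stokes_contraction R" and OB: "OB \<in> SO3"
  shows "minK_ba (OB * R) (0\<^sub>v 3) \<le> J1 R (0\<^sub>v 3)" "minK_bc (OB * R) t \<le> J1t R (0\<^sub>v 3)"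
proof -
  note c = stokes_contraction_left[OF _ R]
  have "bdd_above ((\<lambda>Q. minK_ba (Q * R) (Q *\<^sub>v 0\<^sub>v 3)) ` SO3)"
    using unital_minK_bounds(4)[OF c] by (intro bdd_aboveI2[of _ _ 1]) (simp add: SO3_mult_zero)
  from cSUP_upper[OF OB this] show "minK_ba (OB * R) (0\<^sub>v 3) \<le> J1 R (0\<^sub>v 3)"
    unfolding J1_def by (simp add: SO3_mult_zero[OF OB])
  have "bdd_above ((\<lambda>Q. minK_bc (Q * R) (Q *\<^sub>v 0\<^sub>v 3)) ` SO3)"
    using unital_minK_bounds(2)[OF c] by (intro bdd_aboveI2[of _ _ 1]) simp
  from cSUP_upper[OF OB this] show "minK_bc (OB * R) t \<le> J1t R (0\<^sub>v 3)"
    unfolding J1t_def using unital_minK_bounds(1)[OF c[OF OB]] by simp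
qed

lemma J2_bounds:
  assumes R: "stokes_contraction R" and O: "OA \<in> SO3" "OB \<in> SO3"
  shows "minK_ba (OB * R * OA) (0\<^sub>v 3) \<le> J2 R (0\<^sub>v 3)" "minK_bc (OB * R * OA) t \<le> J2t R (0\<^sub>v 3)"
proof -
  note c = stokes_contraction_rotated[OF R]
  have W: "(OA, OB) \<in> SO3 \<times> SO3" using O by simp
  have "bdd_above ((\<lambda>W. minK_ba (snd W * R * fst W) (snd W *\<^sub>v 0\<^sub>v 3)) ` (SO3 \<times> SO3))"
    using unital_minK_bounds(4)[OF c] by (intro bdd_aboveI2[of _ _ 1]) (auto simp: SO3_mult_zero)
  from cSUP_upper[OF W this] show "minK_ba (OB * R * OA) (0\<^sub>v 3) \<le> J2 R (0\<^sub>v 3)"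
    unfolding J2_def using SO3_mult_zero[OF O(2)] by simp
  have "bdd_above ((\<lambda>W. minK_bc (snd W * R * fst W) (snd W *\<^sub>v 0\<^sub>v 3)) ` (SO3 \<times> SO3))"
    using unital_minK_bounds(2)[OF c] by (intro bdd_aboveI2[of _ _ 1]) auto
  from cSUP_upper[OF W this] show "minK_bc (OB * R * OA) t \<le> J2t R (0\<^sub>v 3)"
    unfolding J2t_def using unital_minK_bounds(1)[OF c[OF O(2,1)]] by simp
qed

text \<open>The rotations on both sides that appear in the upper bound for \<open>minK_ba\<close>
  are absorbed into the compensating unitaries, over which \<open>J2t\<close> takes the supremum
  anyway.\<close>

lemma J2_eq_J2t:
  assumes R: "stokes_contraction R"
  shows "J2 R (0\<^sub>v 3) = J2t R (0\<^sub>v 3)"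
proof (rule antisym)
  note Rc = stokes_contractionD(1)[OF R]
  have ne: "SO3 \<times> SO3 \<noteq> {}" using SO3_one by auto
  note c = stokes_contraction_rotated[OF R]
  show "J2 R (0\<^sub>v 3) \<le> J2t R (0\<^sub>v 3)" unfolding J2_def
  proof (rule cSUP_least[OF ne])
    fix W :: "real mat \<times> real mat" assume "W \<in> SO3 \<times> SO3"
    then obtain OA OB where W: "W = (OA, OB)" "OA \<in> SO3" "OB \<in> SO3" by auto
    obtain Q T where Q: "Q \<in> SO3" "T \<in> SO3"
      and le: "minK_ba (OB * R * OA) (0\<^sub>v 3) \<le> 1 - hbin ((Q * (OB * R * OA * T)) $$ (0,0)) - hbin ((Q * (OB * R * OA * T)) $$ (1,1))"
      using minK_ba_le_rotated[OF c[OF W(3,2)]] by blast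
    have "Q * (OB * R * OA * T) = (Q * OB) * R * (OA * T)"
      using Rc SO3_carrier[OF Q(1)] SO3_carrier[OF Q(2)] SO3_carrier[OF W(2)] SO3_carrier[OF W(3)]
      by (simp add: assoc_mult_mat[of _ 3 3 _ 3 _ 3])
    with le have "minK_ba (OB * R * OA) (0\<^sub>v 3) \<le> minK_bc ((Q * OB) * R * (OA * T)) (0\<^sub>v 3)"
      using unital_minK_bounds(1)[OF c[OF SO3_mult[OF Q(1) W(3)] SO3_mult[OF W(2) Q(2)]]] by simp
    also have "\<dots> \<le> J2t R (0\<^sub>v 3)" by (rule J2_bounds(2)[OF R SO3_mult[OF W(2) Q(2)] SO3_mult[OF Q(1) W(3)]])
    finally show "minK_ba (snd W * R * fst W) (snd W *\<^sub>v 0\<^sub>v 3) \<le> J2t R (0\<^sub>v 3)"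
      using W by (simp add: SO3_mult_zero)
  qed
  show "J2t R (0\<^sub>v 3) \<le> J2 R (0\<^sub>v 3)" unfolding J2t_def
  proof (rule cSUP_least[OF ne])
    fix W :: "real mat \<times> real mat" assume "W \<in> SO3 \<times> SO3"
    then have W: "fst W \<in> SO3" "snd W \<in> SO3" by auto
    show "minK_bc (snd W * R * fst W) (snd W *\<^sub>v 0\<^sub>v 3) \<le> J2 R (0\<^sub>v 3)"
      using unital_minK_bounds(3)[OF c[OF W(2,1)]] J2_bounds(1)[OF R W] by (rule order_trans)
  qed
qed

lemma J2t_attained:
  assumes R: "stokes_contraction R" and O: "OA \<in> SO3" "OB \<in> SO3"
    and D: "OB * R * OA = diag3 e0 e1 e2" and e: "\<bar>e1\<bar> \<le> \<bar>e0\<bar>" "\<bar>e2\<bar> \<le> \<bar>e1\<bar>"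
  shows "J2t R (0\<^sub>v 3) = minK_bc (OB * R * OA) t"
proof (rule antisym)
  note Rc = stokes_contractionD(1)[OF R] and Ac = SO3_carrier[OF O(1)] and Bc = SO3_carrier[OF O(2)]
  note c = stokes_contraction_rotated[OF R]
  have d: "diag3 e0 e1 e2 $$ (0,0) = e0" "diag3 e0 e1 e2 $$ (1,1) = e1" by (simp_all add: diag3_def)
  have v: "minK_bc (OB * R * OA) t = 1 - hbin e0 - hbin e1"
    unfolding unital_minK_bounds(1)[OF c[OF O(2,1)]] unfolding D d ..
  have e0: "\<bar>e0\<bar> \<le> 1" using stokes_contraction_diag(1)[OF c[OF O(2,1)]] unfolding D d .
  show "minK_bc (OB * R * OA) t \<le> J2t R (0\<^sub>v 3)" by (rule J2_bounds(2)[OF R O])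
  show "J2t R (0\<^sub>v 3) \<le> minK_bc (OB * R * OA) t" unfolding J2t_def
  proof (rule cSUP_least)
    show "SO3 \<times> SO3 \<noteq> {}" using SO3_one by auto
    fix W :: "real mat \<times> real mat" assume "W \<in> SO3 \<times> SO3"
    then have W: "fst W \<in> SO3" "snd W \<in> SO3" by auto
    \<comment> \<open>Relative to the diagonal form, every other pair of compensators is again a
      pair of rotations, so Ky Fan's inequality applies.\<close>
    define P where "P = snd W * transpose_mat OB"
    define Q where "Q = transpose_mat OA * fst W"
    have P: "P \<in> SO3" and Q: "Q \<in> SO3" unfolding P_def Q_def using W O by (simp_all add: SO3_mult SO3_transpose)
    have S: "snd W * R * fst W = P * diag3 e0 e1 e2 * Q"
    proof -
      have t: "transpose_mat OA \<in> carrier_mat 3 3" "transpose_mat OB \<in> carrier_mat 3 3" using Ac Bc by auto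
      have A1: "OA * transpose_mat OA = 1\<^sub>m 3" using O(1) by (simp add: SO3_def)
      have "P * diag3 e0 e1 e2 * Q = snd W * (transpose_mat OB * OB) * R * (OA * transpose_mat OA) * fst W"
        unfolding P_def Q_def D[symmetric] using Rc Ac Bc t SO3_carrier[OF W(1)] SO3_carrier[OF W(2)]
        by (simp add: assoc_mult_mat[of _ 3 3 _ 3 _ 3])
      then show ?thesis unfolding SO3_transpose_mult[OF O(2)] A1
        using Rc SO3_carrier[OF W(1)] SO3_carrier[OF W(2)] by (simp add: right_mult_one_mat[of _ 3 3])
    qed
    note kf = SO3_diag_ky_fan[OF P Q e, folded S]
    have "hbin \<bar>e0\<bar> + hbin \<bar>e1\<bar> \<le> hbin \<bar>(snd W * R * fst W) $$ (0,0)\<bar> + hbin \<bar>(snd W * R * fst W) $$ (1,1)\<bar>"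
      using kf e e0 by (intro hbin_weak_majorization) auto
    then show "minK_bc (snd W * R * fst W) (snd W *\<^sub>v 0\<^sub>v 3) \<le> minK_bc (OB * R * OA) t"
      unfolding v unital_minK_bounds(1)[OF c[OF W(2,1)]] by simp
  qed
qed

text \<open>Left rotations preserve inner products of columns, so orthogonality passes to every
  \<open>OB * R\<close>. The remaining output rotation is absorbed into the supremum.\<close>

lemma J1_eq_J1t_if_orthogonal:
  assumes R: "stokes_contraction R" and orth: "dot3 (mcol R 0) (mcol R 1) = 0"
  shows "J1 R (0\<^sub>v 3) = J1t R (0\<^sub>v 3)"
proof (rule antisym)
  note Rc = stokes_contractionD(1)[OF R]
  have ne: "SO3 \<noteq> {}" using SO3_one by auto
  note c = stokes_contraction_left[OF _ R]
  show "J1 R (0\<^sub>v 3) \<le> J1t R (0\<^sub>v 3)" unfolding J1_def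
  proof (rule cSUP_least[OF ne])
    fix OB assume OB: "OB \<in> SO3"
    have BR: "OB * R * 1\<^sub>m 3 = OB * R" using Rc SO3_carrier[OF OB] by (intro right_mult_one_mat[of _ 3 3]) simp
    have "dot3 (mcol (OB * R) 0) (mcol (OB * R) 1) = 0" using SO3_mult_col_dot[OF OB Rc, of 0 1] orth by simp
    then obtain Q where Q: "Q \<in> SO3"
      and le: "minK_ba (OB * R) (0\<^sub>v 3) \<le> 1 - hbin ((Q * (OB * R)) $$ (0,0)) - hbin ((Q * (OB * R)) $$ (1,1))"
      using minK_ba_upper[OF c[OF OB] SO3_one] unfolding BR by auto
    have "Q * (OB * R) = Q * OB * R" using Rc SO3_carrier[OF OB] SO3_carrier[OF Q] by simp
    with le have "minK_ba (OB * R) (0\<^sub>v 3) \<le> minK_bc (Q * OB * R) (0\<^sub>v 3)"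
      using unital_minK_bounds(1)[OF c[OF SO3_mult[OF Q OB]]] by simp
    also have "\<dots> \<le> J1t R (0\<^sub>v 3)" by (rule J1_bounds(2)[OF R SO3_mult[OF Q OB]])
    finally show "minK_ba (OB * R) (OB *\<^sub>v 0\<^sub>v 3) \<le> J1t R (0\<^sub>v 3)" by (simp add: SO3_mult_zero[OF OB])
  qed
  show "J1t R (0\<^sub>v 3) \<le> J1 R (0\<^sub>v 3)" unfolding J1t_def
  proof (rule cSUP_least[OF ne])
    fix OB assume OB: "OB \<in> SO3"
    show "minK_bc (OB * R) (OB *\<^sub>v 0\<^sub>v 3) \<le> J1 R (0\<^sub>v 3)"
      using unital_minK_bounds(3)[OF c[OF OB]] J1_bounds(1)[OF R OB] by (rule order_trans)
  qed
qed

text \<open>The two diagonal entries are inner products of unit rows with fixed columns. Parallel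
  rows attain equality in Cauchy-Schwarz for both entries at once.\<close>

lemma J1t_attained:
  assumes R: "stokes_contraction R" and OB: "OB \<in> SO3"
    and r0: "\<And>k. k < 3 \<Longrightarrow> mrow OB 0 k = x * mcol R 0 k" and r1: "\<And>k. k < 3 \<Longrightarrow> mrow OB 1 k = y * mcol R 1 k"
  shows "J1t R (0\<^sub>v 3) = minK_bc (OB * R) t"
proof (rule antisym)
  note Rc = stokes_contractionD(1)[OF R]
  note c = stokes_contraction_left[OF _ R]
  have ent: "(Q * R) $$ (i,i) = dot3 (mrow Q i) (mcol R i)" if "Q \<in> SO3" "i < 3" for Q i
    by (rule mult_index_dot3[OF SO3_carrier[OF that(1)] Rc that(2) that(2)])
  have sq: "((OB * R) $$ (i,i))\<^sup>2 = dot3 (mcol R i) (mcol R i)"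
    if i: "i < 3" and r: "\<And>k. k < 3 \<Longrightarrow> mrow OB i k = z * mcol R i k" for i z
  proof -
    define n where "n = dot3 (mcol R i) (mcol R i)"
    have "dot3 (mrow OB i) (mrow OB i) = z * z * n" unfolding n_def dot3_def by (simp add: r algebra_simps)
    \<comment> \<open>A unit row proportional to the column forces the column to be nonzero and
      fixes the scalar up to sign.\<close>
    then have zz: "z * z * n = 1" using SO3_rows[OF OB i i] by simp
    have "(OB * R) $$ (i,i) = z * n" unfolding ent[OF OB i] n_def dot3_def by (simp add: r algebra_simps)
    then have "((OB * R) $$ (i,i))\<^sup>2 = (z * z * n) * n" by (simp add: power2_eq_square algebra_simps)
    then show ?thesis unfolding zz n_def[symmetric] by simp
  qed
  have le: "hbin ((OB * R) $$ (i,i)) \<le> hbin ((Q * R) $$ (i,i))"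
    if Q: "Q \<in> SO3" and i: "i < 3" "i = 0 \<or> i = 1" and r: "\<And>k. k < 3 \<Longrightarrow> mrow OB i k = z * mcol R i k" for Q i z
  proof (rule hbin_antimono)
    have s: "((OB * R) $$ (i,i))\<^sup>2 = dot3 (mcol R i) (mcol R i)" by (rule sq[OF i(1)]) (rule r)
    have "((Q * R) $$ (i,i))\<^sup>2 \<le> ((OB * R) $$ (i,i))\<^sup>2"
      unfolding s ent[OF Q i(1)] using SO3_rows[OF Q i(1) i(1)] by (intro dot3_cauchy_unit) simp
    then show "\<bar>(Q * R) $$ (i,i)\<bar> \<le> \<bar>(OB * R) $$ (i,i)\<bar>" by (simp only: abs_le_square_iff)
    show "\<bar>(OB * R) $$ (i,i)\<bar> \<le> 1" using stokes_contraction_diag[OF c[OF OB]] i(2) by blast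
  qed
  show "J1t R (0\<^sub>v 3) \<le> minK_bc (OB * R) t" unfolding J1t_def
  proof (rule cSUP_least)
    show "SO3 \<noteq> {}" using SO3_one by auto
    fix Q assume Q: "Q \<in> SO3"
    have "hbin ((OB * R) $$ (0,0)) \<le> hbin ((Q * R) $$ (0,0))" "hbin ((OB * R) $$ (1,1)) \<le> hbin ((Q * R) $$ (1,1))"
      by (rule le[OF Q _ _ r0], simp, simp, simp) (rule le[OF Q _ _ r1], simp, simp, simp)
    then show "minK_bc (Q * R) (Q *\<^sub>v 0\<^sub>v 3) \<le> minK_bc (OB * R) t"
      unfolding unital_minK_bounds(1)[OF c[OF Q]] unital_minK_bounds(1)[OF c[OF OB]] by simp
  qed
  show "minK_bc (OB * R) t \<le> J1t R (0\<^sub>v 3)" by (rule J1_bounds(2)[OF R OB])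
qed

lemma J1t_less_J1_if_not_orthogonal:
  assumes R: "stokes_contraction R" and no: "dot3 (mcol R 0) (mcol R 1) \<noteq> 0"
  shows "J1t R (0\<^sub>v 3) < J1 R (0\<^sub>v 3)"
proof -
  note Rc = stokes_contractionD(1)[OF R]
  note c = stokes_contraction_left[OF _ R]
  have ent: "(Q * R) $$ (i,j) = dot3 (mrow Q i) (mcol R j)" if "Q \<in> SO3" "i < 3" "j < 3" for Q i j
    by (rule mult_index_dot3[OF SO3_carrier[OF that(1)] Rc that(2,3)])
  define n0 where "n0 = sqrt (dot3 (mcol R 0) (mcol R 0))"
  define n1 where "n1 = sqrt (dot3 (mcol R 1) (mcol R 1))"
  have z: "dot3 (mcol R 0) (mcol R 0) \<noteq> 0" "dot3 (mcol R 1) (mcol R 1) \<noteq> 0"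
  proof -
    have "dot3 x y = 0" "dot3 y x = 0" if "dot3 x x = 0" for x y
      using dot3_self_zero[OF that] by (simp_all add: dot3_def)
    then show "dot3 (mcol R 0) (mcol R 0) \<noteq> 0" "dot3 (mcol R 1) (mcol R 1) \<noteq> 0" using no by blast+
  qed
  have n0: "0 < n0" and n1: "0 < n1" unfolding n0_def n1_def using z by (simp_all add: less_le)
  have le1: "n0 \<le> 1" "n1 \<le> 1" unfolding n0_def n1_def using stokes_contraction_col[OF R] by simp_all
  obtain f where f: "dot3 f f = 1" "mcol R 0 = (\<lambda>i. n0 * f i)" using normalize3[OF z(1)] unfolding n0_def by blast
  obtain g where g: "dot3 g g = 1" "mcol R 1 = (\<lambda>i. n1 * g i)" using normalize3[OF z(2)] unfolding n1_def by blast
  define k where "k = dot3 f g"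
  have k: "k \<noteq> 0" "k\<^sup>2 \<le> 1"
  proof -
    have "dot3 (mcol R 0) (mcol R 1) = n0 * n1 * k" unfolding f(2) g(2) k_def dot3_def by (simp add: algebra_simps)
    then show "k \<noteq> 0" using no by auto
    show "k\<^sup>2 \<le> 1" using dot3_cauchy_unit[OF f(1), of g] g(1) by (simp add: k_def)
  qed
  \<comment> \<open>The fraction 1/8 makes simultaneous excess contradictory: if \<open>p\<close>
    and \<open>q\<close> both exceed \<open>th\<close> in modulus, the alignment inequality gives
    \<open>k\<^sup>2 \<le> k\<^sup>2 / 2\<close>.\<close>
  define th where "th = sqrt (1 - k\<^sup>2 / 8)"
  have th: "0 \<le> th" "th < 1" "th\<^sup>2 = 1 - k\<^sup>2 / 8" using k by (simp_all add: th_def)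
  have s0: "hbin n0 < hbin (th * n0)" using n0 le1 th by (intro hbin_strict_antimono) (auto simp: abs_mult)
  have s1: "hbin n1 < hbin (th * n1)" using n1 le1 th by (intro hbin_strict_antimono) (auto simp: abs_mult)
  \<comment> \<open>For each rotation at least one entry falls short by the factor
    \<open>th\<close>; \<open>m\<close> covers both cases independently of the rotation, so the gap
    survives the supremum.\<close>
  define m where "m = max (1 - hbin (th * n0) - hbin n1) (1 - hbin n0 - hbin (th * n1))"
  have "J1t R (0\<^sub>v 3) \<le> m" unfolding J1t_def
  proof (rule cSUP_least)
    show "SO3 \<noteq> {}" using SO3_one by auto
    fix Q assume Q: "Q \<in> SO3"
    define p where "p = dot3 (mrow Q 0) f"
    define q where "q = dot3 (mrow Q 1) g"
    have "(Q * R) $$ (0,0) = dot3 (mrow Q 0) (mcol R 0)" by (rule ent[OF Q]) auto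
    then have Q00: "(Q * R) $$ (0,0) = n0 * p" unfolding p_def f(2) dot3_scale .
    have "(Q * R) $$ (1,1) = dot3 (mrow Q 1) (mcol R 1)" by (rule ent[OF Q]) auto
    then have Q11: "(Q * R) $$ (1,1) = n1 * q" unfolding q_def g(2) dot3_scale .
    have o: "dot3 (mrow Q 0) (mrow Q 0) = 1" "dot3 (mrow Q 1) (mrow Q 1) = 1" "dot3 (mrow Q 0) (mrow Q 1) = 0"
      using SO3_rows[OF Q, of 0 0] SO3_rows[OF Q, of 1 1] SO3_rows[OF Q, of 0 1] by simp_all
    have k2: "k\<^sup>2 \<le> 2 * (1 - p\<^sup>2) + 2 * (1 - q\<^sup>2)" unfolding k_def p_def q_def
      by (rule nonorthogonal_alignment[OF o f(1) g(1)])
    have p1: "\<bar>p\<bar> \<le> 1" "\<bar>q\<bar> \<le> 1"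
      using dot3_cauchy_unit[OF o(1), of f] dot3_cauchy_unit[OF o(2), of g] f(1) g(1)
      by (simp_all add: p_def q_def abs_square_le_1)
    have h0: "hbin (y * n0) \<le> hbin (n0 * p)" if "\<bar>p\<bar> \<le> \<bar>y\<bar>" "\<bar>y\<bar> \<le> 1" for y
      using that n0 le1 mult_mono[of "\<bar>y\<bar>" 1 n0 1] by (intro hbin_antimono) (auto simp: abs_mult mult.commute)
    have h1: "hbin (y * n1) \<le> hbin (n1 * q)" if "\<bar>q\<bar> \<le> \<bar>y\<bar>" "\<bar>y\<bar> \<le> 1" for y
      using that n1 le1 mult_mono[of "\<bar>y\<bar>" 1 n1 1] by (intro hbin_antimono) (auto simp: abs_mult mult.commute)
    have "p\<^sup>2 \<le> th\<^sup>2 \<or> q\<^sup>2 \<le> th\<^sup>2"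
    proof (rule ccontr)
      assume "\<not> (p\<^sup>2 \<le> th\<^sup>2 \<or> q\<^sup>2 \<le> th\<^sup>2)"
      then have "k\<^sup>2 \<le> k\<^sup>2 / 2" using k2 th(3) by argo
      then show False using k(1) by simp
    qed
    then have "\<bar>p\<bar> \<le> th \<or> \<bar>q\<bar> \<le> th" using th(1) by (metis abs_le_square_iff abs_of_nonneg)
    then have "1 - hbin (n0 * p) - hbin (n1 * q) \<le> m"
    proof
      assume "\<bar>p\<bar> \<le> th"
      then have "hbin (th * n0) \<le> hbin (n0 * p)" using th by (intro h0) auto
      moreover have "hbin n1 \<le> hbin (n1 * q)" using h1[of 1] p1 by simp
      ultimately show ?thesis unfolding m_def by simp
    next
      assume "\<bar>q\<bar> \<le> th"
      then have "hbin (th * n1) \<le> hbin (n1 * q)" using th by (intro h1) auto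
      moreover have "hbin n0 \<le> hbin (n0 * p)" using h0[of 1] p1 by simp
      ultimately show ?thesis unfolding m_def by simp
    qed
    then show "minK_bc (Q * R) (Q *\<^sub>v 0\<^sub>v 3) \<le> m" unfolding unital_minK_bounds(1)[OF c[OF Q]] Q00 Q11 .
  qed
  also have "m < 1 - hbin n0 - hbin n1" unfolding m_def using s0 s1 by simp
  also have "\<dots> \<le> J1 R (0\<^sub>v 3)"
  proof -
    \<comment> \<open>The rows \<open>f\<close> and \<open>v\<close> span a plane containing both
      columns. The direction of the second column in this plane then serves as \<open>w\<close> and
      recovers its whole norm \<open>n1\<close>.\<close>
    obtain v where v: "dot3 v v = 1" "dot3 f v = 0" "\<forall>i<3. g i = dot3 f g * f i + dot3 v g * v i"
      using gram_schmidt3[OF f(1)] by blast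
    obtain Q where Q: "Q \<in> SO3" "\<forall>j<3. mrow Q 0 j = f j \<and> mrow Q 1 j = v j" using SO3_of_rows[OF f(1) v(1,2)] by blast
    have row: "dot3 (mrow Q 0) x = dot3 f x" "dot3 (mrow Q 1) x = dot3 v x" for x using Q(2) by (simp_all add: dot3_def)
    have e: "(Q * R) $$ (0,0) = n0" "(Q * R) $$ (0,1) = n1 * dot3 f g" "(Q * R) $$ (1,1) = n1 * dot3 v g"
      using ent[OF Q(1), of 0 0] ent[OF Q(1), of 0 1] ent[OF Q(1), of 1 1] f(1)
      by (simp_all add: row row[unfolded One_nat_def] f(2) g(2) dot3_scale g(2)[unfolded One_nat_def])
    have w: "(dot3 f g)\<^sup>2 + (dot3 v g)\<^sup>2 = 1"
    proof -
      have "dot3 g g = dot3 g (\<lambda>i. dot3 f g * f i + dot3 v g * v i)"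
        unfolding dot3_def[of g g] dot3_def[of g "\<lambda>i. dot3 f g * f i + dot3 v g * v i"] using v(3) by simp
      also have "\<dots> = dot3 f g * dot3 g f + dot3 v g * dot3 g v" by (rule dot3_add)
      finally show ?thesis using g(1) by (simp add: power2_eq_square dot3_commute)
    qed
    have "dot3 f g * (n1 * dot3 f g) + dot3 v g * (n1 * dot3 v g) = n1 * ((dot3 f g)\<^sup>2 + (dot3 v g)\<^sup>2)"
      by (simp add: power2_eq_square algebra_simps)
    then have "dot3 f g * (n1 * dot3 f g) + dot3 v g * (n1 * dot3 v g) = n1" unfolding w by simp
    then have "1 - hbin n0 - hbin n1 \<le> minK_ba (Q * R) (0\<^sub>v 3)"
      using minK_ba_lower[OF c[OF Q(1)] w] unfolding e by simp
    also have "\<dots> \<le> J1 R (0\<^sub>v 3)" by (rule J1_bounds(1)[OF R Q(1)])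
    finally show ?thesis .
  qed
  finally show ?thesis .
qed

theorem theorem7:
  fixes R A B :: "real mat" and ez ex ey :: real
  assumes unital_channel: "qubit_channel R (0\<^sub>v 3)"
    and A: "A \<in> SO3" and B: "B \<in> SO3"
    and decomp: "R = B * diag3 ez ex ey * A"
  shows "J2 R (0\<^sub>v 3) = J2t R (0\<^sub>v 3) \<and>
    (\<forall>OA \<in> SO3. \<forall>OB \<in> SO3. \<forall>ez' ex' ey'.
           OB * R * OA = diag3 ez' ex' ey' \<and> \<bar>ez'\<bar> \<ge> \<bar>ex'\<bar> \<and> \<bar>ex'\<bar> \<ge> \<bar>ey'\<bar>
           \<longrightarrow> J2t R (0\<^sub>v 3) = minK_bc (OB * R * OA) (OB *\<^sub>v 0\<^sub>v 3)) \<and>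
    (J1 R (0\<^sub>v 3) = J1t R (0\<^sub>v 3) \<longleftrightarrow>
           col (diag3 ez ex ey * A) 0 \<bullet> col (diag3 ez ex ey * A) 1 = 0) \<and>
    (col (diag3 ez ex ey * A) 0 \<bullet> col (diag3 ez ex ey * A) 1 = 0 \<longrightarrow>
           (\<forall>OB \<in> SO3. (\<exists>c. row OB 0 = c \<cdot>\<^sub>v col R 0) \<and> (\<exists>c. row OB 1 = c \<cdot>\<^sub>v col R 1)
              \<longrightarrow> J1t R (0\<^sub>v 3) = minK_bc (OB * R) (OB *\<^sub>v 0\<^sub>v 3)))"
proof -
  have R: "stokes_contraction R" by (rule qubit_channel_contraction[OF unital_channel])
  note Rc = stokes_contractionD(1)[OF R]
  have DA: "diag3 ez ex ey * A \<in> carrier_mat 3 3" using SO3_carrier[OF A] by simp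
  have "R = B * (diag3 ez ex ey * A)"
    unfolding decomp using SO3_carrier[OF A] SO3_carrier[OF B] by (simp add: assoc_mult_mat[of _ 3 3 _ 3 _ 3])
  \<comment> \<open>The rotation \<open>B\<close> preserves the inner products of columns, so the
    condition can be read off from \<open>R\<close> itself.\<close>
  then have orth: "col (diag3 ez ex ey * A) 0 \<bullet> col (diag3 ez ex ey * A) 1 = dot3 (mcol R 0) (mcol R 1)"
    using SO3_mult_col_dot[OF B DA, of 0 1] col_scalar_prod_dot3[OF DA, of 0 1] by simp
  have iff: "J1 R (0\<^sub>v 3) = J1t R (0\<^sub>v 3) \<longleftrightarrow> dot3 (mcol R 0) (mcol R 1) = 0"
    using J1_eq_J1t_if_orthogonal[OF R] J1t_less_J1_if_not_orthogonal[OF R] by fastforce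
  have rows: "J1t R (0\<^sub>v 3) = minK_bc (OB * R) t"
    if OB: "OB \<in> SO3" and x: "row OB 0 = x \<cdot>\<^sub>v col R 0" and y: "row OB 1 = y \<cdot>\<^sub>v col R 1" for OB x y t
  proof (rule J1t_attained[OF R OB])
    note OBc = SO3_carrier[OF OB]
    show "mrow OB 0 k = x * mcol R 0 k" if "k < 3" for k
      using arg_cong[OF x, of "\<lambda>v. v $ k"] that OBc Rc by (simp add: mrow_def mcol_def)
    show "mrow OB 1 k = y * mcol R 1 k" if "k < 3" for k
      using arg_cong[OF y, of "\<lambda>v. v $ k"] that OBc Rc by (simp add: mrow_def mcol_def)
  qed
  show ?thesis unfolding orth iff
    using J2_eq_J2t[OF R] J2t_attained[OF R] rows by blast
qed

end
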